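(* Let $\mathcal{X},\mathcal{Y},\hat{\mathcal{X}}$ be finite sets, $P_{X,Y}$ a probability distribution on $\mathcal{X}\times\mathcal{Y}$, $F:\mathcal{X}\times\mathcal{Y}\to\mathcal{F}$ a function, and $d:\mathcal{F}\times\hat{\mathcal{X}}\to[0,\infty)$ a distortion measure. Let $\mathcal{R}_{\text{help}}$ be the rate-distortion-equivocation region, defined in the context, for lossy source coding with (non-causal) side information $Y^n$ at a stochastic decoder and end-user privacy at the helper that provides $Y^n$. Let $\mathcal{R}_{\text{in}}^{(\text{help})}$ be the set of all $(R,D,\triangle)\in\mathbb{R}_+^3$ such that $$R\ge I(X;U|Y),\qquad D\ge E[d(F(X,Y),\hat{X})],\qquad \triangle\le H(\hat{X}|U,Y)+I(X;\hat{X}|Y),$$ for some random variables $(X,Y,U,\hat{X})$, with $U\in\mathcal{U}$, $\hat{X}\in\hat{\mathcal{X}}$, whose joint distribution has the form $P_{X,Y}(x,y)P_{U|X}(u|x)P_{\hat{X}|U,Y}(\hat{x}|u,y)$ with $|\mathcal{U}|\le|\mathcal{X}|+3$. Let $\mathcal{R}_{\text{out}}^{(\text{help})}$ be the set of all $(R,D,\triangle)\in\mathbb{R}_+^3$ such that $$R\ge I(X;U|Y),\qquad D\ge E[d(F(X,Y),\hat{X})],\qquad \triangle\le H(\hat{X}|U,Y)+I(X;V,\hat{X}|Y),$$ for some random variables $(X,Y,U,V,\hat{X})$, with $U,V$ taking values in some finite sets and $\hat{X}\in\hat{\mathcal{X}}$, whose joint distribution has the form $P_{X,Y}(x,y)P_{U|X}(u|x)P_{V,\hat{X}|U,Y}(v,\hat{x}|u,y)$.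 Then $$\mathcal{R}_{\text{in}}^{(\text{help})}\subseteq\mathcal{R}_{\text{help}}\subseteq\mathcal{R}_{\text{out}}^{(\text{help})}.$$
   Context: $(X^n,Y^n)$ denotes $n$-length sequences with $(X_i,Y_i)$, $i=1,\dots,n$, i.i.d. according to $P_{X,Y}$. The function $F^{(n)}(X^n,Y^n)$ is component-wise: its $i$-th component is $F(X_i,Y_i)$. The distortion is $d^{(n)}(F^{(n)}(X^n,Y^n),\hat{X}^n)=\frac1n\sum_{i=1}^n d(F(X_i,Y_i),\hat{X}_i)$. A $(|\mathcal{W}^{(n)}|,n)$-code consists of a finite set $\mathcal{W}^{(n)}$, a deterministic encoder $f^{(n)}:\mathcal{X}^n\to\mathcal{W}^{(n)}$, and a stochastic decoder which maps $w\in\mathcal{W}^{(n)}$ and $y^n\in\mathcal{Y}^n$ to a random $\hat{x}^n\in\hat{\mathcal{X}}^n$ according to an arbitrary conditional distribution $p(\hat{x}^n|w,y^n)$. With $W=f^{(n)}(X^n)$, the decoder output $\hat{X}^n$ is drawn from $p(\cdot|W,Y^n)$, conditionally independent of $X^n$ given $(W,Y^n)$. A tuple $(R,D,\triangle)\in\mathbb{R}_+^3$ is achievable if for any $\delta>0$ and all sufficiently large $n$ there exists a $(|\mathcal{W}^{(n)}|,n)$-code such that $\frac1n\log|\mathcal{W}^{(n)}|\le R+\delta$, $E[d^{(n)}(F^{(n)}(X^n,Y^n),\hat{X}^n)]\le D+\delta$, and $\frac1n H(\hat{X}^n|Y^n)\ge\triangle-\delta$. The region $\mathcal{R}_{\text{help}}$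 is the set of all achievable tuples. $H$ and $I$ denote Shannon entropy and mutual information (with the same logarithm base throughout), and $\mathbb{R}_+=[0,\infty)$. *)

theory Defs
  imports "HOL-Probability.Probability"
begin

text \<open>Alphabets are finite types, distributions on them are \<open>pmf\<close>s, and the parameter \<open>b\<close> is
  the common base of all logarithms. Random variables are functions on the sample space of a
  \<open>pmf\<close>; the spaces \<open>count_space UNIV\<close> below are always over countable types.\<close>

abbreviation cond_entropy ::
  "real \<Rightarrow> 'o pmf \<Rightarrow> ('o \<Rightarrow> 'a) \<Rightarrow> ('o \<Rightarrow> 'b) \<Rightarrow> real" where
  "cond_entropy b Q A B \<equiv>
     prob_space.conditional_entropy (measure_pmf Q) b (count_space UNIV) (count_space UNIV) A B"

abbreviation cond_mutual_info ::
  "real \<Rightarrow> 'o pmf \<Rightarrow> ('o \<Rightarrow> 'a) \<Rightarrow> ('o \<Rightarrow> 'b) \<Rightarrow> ('o \<Rightarrow> 'c) \<Rightarrow> real" where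
  "cond_mutual_info b Q A B C \<equiv>
     prob_space.conditional_mutual_information (measure_pmf Q) b
       (count_space UNIV) (count_space UNIV) (count_space UNIV) A B C"


subsection \<open>Codes and the operational region\<close>

text \<open>Sequences of length \<open>n\<close> are lists of length \<open>n\<close>. The message set is a finite set of
  natural numbers, which is no restriction up to relabelling.\<close>

definition is_code ::
  "nat \<Rightarrow> nat set \<Rightarrow> ('x list \<Rightarrow> nat) \<Rightarrow> (nat \<Rightarrow> 'y list \<Rightarrow> 'xh list pmf) \<Rightarrow> bool" where
  "is_code n W f g \<longleftrightarrow>
     finite W \<and>
     (\<forall>xs. length xs = n \<longrightarrow> f xs \<in> W) \<and>
     (\<forall>w\<in>W. \<forall>ys. length ys = n \<longrightarrow> set_pmf (g w ys) \<subseteq> {hs. length hs = n})"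

text \<open>Joint law of source sequence, side information and decoder output.\<close>

definition code_joint ::
  "('x \<times> 'y) pmf \<Rightarrow> nat \<Rightarrow> ('x list \<Rightarrow> nat) \<Rightarrow> (nat \<Rightarrow> 'y list \<Rightarrow> 'xh list pmf)
     \<Rightarrow> ('x list \<times> 'y list \<times> 'xh list) pmf" where
  "code_joint P n f g =
     do { xys \<leftarrow> replicate_pmf n P;
          hs \<leftarrow> g (f (map fst xys)) (map snd xys);
          return_pmf (map fst xys, map snd xys, hs) }"

definition block_distortion ::
  "('x \<Rightarrow> 'y \<Rightarrow> 'f) \<Rightarrow> ('f \<Rightarrow> 'xh \<Rightarrow> real) \<Rightarrow> nat \<Rightarrow> 'x list \<Rightarrow> 'y list \<Rightarrow> 'xh list \<Rightarrow> real" where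
  "block_distortion F d n xs ys hs = (1 / real n) * (\<Sum>i<n. d (F (xs ! i) (ys ! i)) (hs ! i))"

definition achievable ::
  "real \<Rightarrow> ('x::finite \<times> 'y::finite) pmf \<Rightarrow> ('x \<Rightarrow> 'y \<Rightarrow> 'f) \<Rightarrow> ('f \<Rightarrow> 'xh::finite \<Rightarrow> real)
     \<Rightarrow> real \<Rightarrow> real \<Rightarrow> real \<Rightarrow> bool" where
  "achievable b P F d R D \<Delta> \<longleftrightarrow>
     (\<forall>\<delta>>0. \<forall>\<^sub>F n in sequentially. \<exists>W f g.
        is_code n W f g \<and>
        (1 / real n) * log b (real (card W)) \<le> R + \<delta> \<and>
        measure_pmf.expectation (code_joint P n f g)
          (\<lambda>(xs, ys, hs). block_distortion F d n xs ys hs) \<le> D + \<delta> \<and>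
        (1 / real n) * cond_entropy b (code_joint P n f g)
          (\<lambda>(xs, ys, hs). hs) (\<lambda>(xs, ys, hs). ys) \<ge> \<Delta> - \<delta>)"

definition R_help ::
  "real \<Rightarrow> ('x::finite \<times> 'y::finite) pmf \<Rightarrow> ('x \<Rightarrow> 'y \<Rightarrow> 'f) \<Rightarrow> ('f \<Rightarrow> 'xh::finite \<Rightarrow> real)
     \<Rightarrow> (real \<times> real \<times> real) set" where
  "R_help b P F d =
     {(R, D, \<Delta>). R \<ge> 0 \<and> D \<ge> 0 \<and> \<Delta> \<ge> 0 \<and> achievable b P F d R D \<Delta>}"


subsection \<open>The single-letter regions\<close>

definition joint_in ::
  "('x \<times> 'y) pmf \<Rightarrow> ('x \<Rightarrow> nat pmf) \<Rightarrow> (nat \<Rightarrow> 'y \<Rightarrow> 'xh pmf)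
     \<Rightarrow> ('x \<times> 'y \<times> nat \<times> 'xh) pmf" where
  "joint_in P PU PH =
     do { (x, y) \<leftarrow> P; u \<leftarrow> PU x; h \<leftarrow> PH u y; return_pmf (x, y, u, h) }"

definition joint_out ::
  "('x \<times> 'y) pmf \<Rightarrow> ('x \<Rightarrow> nat pmf) \<Rightarrow> (nat \<Rightarrow> 'y \<Rightarrow> (nat \<times> 'xh) pmf)
     \<Rightarrow> ('x \<times> 'y \<times> nat \<times> nat \<times> 'xh) pmf" where
  "joint_out P PU PVH =
     do { (x, y) \<leftarrow> P; u \<leftarrow> PU x; (v, h) \<leftarrow> PVH u y; return_pmf (x, y, u, v, h) }"

text \<open>The auxiliary alphabets \<open>\<U>\<close> and \<open>\<V>\<close> are finite sets of natural numbers, again up to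
  relabelling.\<close>

definition R_in ::
  "real \<Rightarrow> ('x::finite \<times> 'y::finite) pmf \<Rightarrow> ('x \<Rightarrow> 'y \<Rightarrow> 'f) \<Rightarrow> ('f \<Rightarrow> 'xh::finite \<Rightarrow> real)
     \<Rightarrow> (real \<times> real \<times> real) set" where
  "R_in b P F d =
     {(R, D, \<Delta>). R \<ge> 0 \<and> D \<ge> 0 \<and> \<Delta> \<ge> 0 \<and>
       (\<exists>\<U> PU PH.
          finite \<U> \<and> card \<U> \<le> CARD('x) + 3 \<and> (\<forall>x. set_pmf (PU x) \<subseteq> \<U>) \<and>
          (let Q = joint_in P PU PH;
               X = (\<lambda>(x, y, u, h). x);
               Y = (\<lambda>(x, y, u, h). y);
               U = (\<lambda>(x, y, u, h). u);
               H = (\<lambda>(x, y, u, h). h)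
           in R \<ge> cond_mutual_info b Q X U Y \<and>
              D \<ge> measure_pmf.expectation Q (\<lambda>\<omega>. d (F (X \<omega>) (Y \<omega>)) (H \<omega>)) \<and>
              \<Delta> \<le> cond_entropy b Q H (\<lambda>\<omega>. (U \<omega>, Y \<omega>)) + cond_mutual_info b Q X H Y))}"

definition R_out ::
  "real \<Rightarrow> ('x::finite \<times> 'y::finite) pmf \<Rightarrow> ('x \<Rightarrow> 'y \<Rightarrow> 'f) \<Rightarrow> ('f \<Rightarrow> 'xh::finite \<Rightarrow> real)
     \<Rightarrow> (real \<times> real \<times> real) set" where
  "R_out b P F d =
     {(R, D, \<Delta>). R \<ge> 0 \<and> D \<ge> 0 \<and> \<Delta> \<ge> 0 \<and>
       (\<exists>\<U> \<V> PU PVH.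
          finite \<U> \<and> finite \<V> \<and> (\<forall>x. set_pmf (PU x) \<subseteq> \<U>) \<and>
          (\<forall>u\<in>\<U>. \<forall>y. set_pmf (PVH u y) \<subseteq> \<V> \<times> UNIV) \<and>
          (let Q = joint_out P PU PVH;
               X = (\<lambda>(x, y, u, v, h). x);
               Y = (\<lambda>(x, y, u, v, h). y);
               U = (\<lambda>(x, y, u, v, h). u);
               V = (\<lambda>(x, y, u, v, h). v);
               H = (\<lambda>(x, y, u, v, h). h)
           in R \<ge> cond_mutual_info b Q X U Y \<and>
              D \<ge> measure_pmf.expectation Q (\<lambda>\<omega>. d (F (X \<omega>) (Y \<omega>)) (H \<omega>)) \<and>
              \<Delta> \<le> cond_entropy b Q H (\<lambda>\<omega>. (U \<omega>, Y \<omega>))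
                   + cond_mutual_info b Q X (\<lambda>\<omega>. (V \<omega>, H \<omega>)) Y))}"

end

theory Submission
  imports Defs "HOL-Real_Asymp.Real_Asymp"
begin

text \<open>
  Outer bound. For fixed \<open>U\<close>, the choice \<open>V = U\<close> maximises \<open>I(X;V,Xh|Y)\<close>, because \<open>X\<close> is
  independent of \<open>(V, Xh)\<close> given \<open>(U, Y)\<close>. Hence only \<open>P\<^sub>X\<close>, \<open>H(X|U,Y)\<close>, the mean distortion and
  \<open>H(Xh|U,Y)\<close> matter. These are averages over \<open>u\<close> of a continuous function of \<open>P(x|u)\<close> and \<open>P(xh|u,y)\<close>,
  so the attainable tuples form the convex hull of a compact set, which is compact: the region
  is convex and closed without any bound on the size of \<open>U\<close>. A block code gives, for each \<open>i\<close>, such a tuple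
  with \<open>U\<^sub>i = (W, X\<^sub>1 \<dots> X\<^sub>i\<^sub>-\<^sub>1, Y without Y\<^sub>i)\<close>, and their average satisfies the three constraints up to \<open>\<delta>\<close>.

  Inner bound. Random binning yields a decoder whose reconstruction \<open>Uh\<close> of the codeword is such that
  \<open>(X\<^sub>i, Y\<^sub>i, Uh\<^sub>i)\<close> has the desired empirical averages, and \<open>Xh\<^sub>i\<close> is drawn
  from \<open>P(xh|Uh\<^sub>i, Y\<^sub>i)\<close>. As \<open>Uh\<close> is a function of \<open>(X, Y)\<close>,
  \<open>H(Xh|Y) = H(Xh|X,Y) + H(X|Y) - H(X|Xh,Y)\<close> for the blocks. The first term is an average of
  single-letter entropies, and the last is at most a cross entropy, again an average of single letters.
  So distortion and equivocation reduce to the empirical averages of three bounded functions.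
\<close>

subsection \<open>Entropy of finitely supported distributions\<close>

text \<open>In the converse a smaller \<open>\<delta>\<close> forces another block length and so
  another alphabet for \<open>U\<^sub>i\<close>; no limit of the auxiliary variables is at hand, and
  the limit is taken among tuples of numbers instead. The equivocation bound is
  \<open>H(Xh|Y) \<le> H(W|Y) + H(Xh|W,Y)\<close>. Since \<open>W\<close> is a function of
  \<open>X\<close>, the first term is \<open>H(X|Y) - H(X|W,Y)\<close>, a sum of the informations
  \<open>I(X\<^sub>i;U\<^sub>i|Y\<^sub>i)\<close>; the second equals \<open>H(Xh|X,Y)\<close>,
  because the decoder sees \<open>X\<close> only through \<open>W\<close>.

  In the direct part nothing is known about the codeword that a failing decoder returns. Failures
  are rare, hence harmless for averages of bounded functions; the cross entropy becomes bounded once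
  \<open>P(x|xh,y)\<close> has been smoothed to be positive everywhere. All typicality is one-sided:
  a finite list of functions whose sums must not exceed their means by much. Two log-likelihood
  ratios in this list control the binning, three further functions control distortion and
  equivocation.\<close>

lemma expectation_bind_finite:
  fixes h :: "'b \<Rightarrow> real"
  assumes "finite (set_pmf p)" "\<And>x. x \<in> set_pmf p \<Longrightarrow> finite (set_pmf (f x))"
  shows "measure_pmf.expectation (p \<bind> f) h
    = measure_pmf.expectation p (\<lambda>x. measure_pmf.expectation (f x) h)"
proof -
  have "measure_pmf.expectation (p \<bind> f) h
      = (\<Sum>a\<in>set_pmf p. pmf p a *\<^sub>R measure_pmf.expectation (f a) h)"
    by (rule pmf_expectation_bind) (use assms in auto)
  also have "\<dots> = measure_pmf.expectation p (\<lambda>x. measure_pmf.expectation (f x) h)"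
    by (rule integral_measure_pmf[symmetric]) (use assms in auto)
  finally show ?thesis .
qed

lemma integrable_finite_pmf [simp]:
  fixes h :: "'a \<Rightarrow> real"
  assumes "finite (set_pmf p)"
  shows "integrable (measure_pmf p) h"
  by (rule integrable_measure_pmf_finite[OF assms])

lemma expectation_mono_finite:
  fixes g h :: "'a \<Rightarrow> real"
  assumes "finite (set_pmf p)" "\<And>x. x \<in> set_pmf p \<Longrightarrow> g x \<le> h x"
  shows "measure_pmf.expectation p g \<le> measure_pmf.expectation p h"
  using assms by (intro integral_mono_AE) (auto simp: AE_measure_pmf_iff)

lemma expectation_cong_set_pmf:
  fixes g h :: "'a \<Rightarrow> real"
  assumes "\<And>x. x \<in> set_pmf p \<Longrightarrow> g x = h x"
  shows "measure_pmf.expectation p g = measure_pmf.expectation p h"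
  using assms by (intro integral_cong_AE) (auto simp: AE_measure_pmf_iff)

lemma expectation_finite_sum:
  fixes h :: "'a \<Rightarrow> real"
  assumes "finite A" "set_pmf p \<subseteq> A"
  shows "measure_pmf.expectation p h = (\<Sum>a\<in>A. pmf p a * h a)"
  using assms by (subst integral_measure_pmf[of A]) auto

lemma pmf_bind_Pair:
  "pmf (p \<bind> (\<lambda>c. map_pmf (Pair c) (K c))) (c, a) = pmf p c * pmf (K c) a"
proof -
  have "pmf (p \<bind> (\<lambda>c. map_pmf (Pair c) (K c))) (c, a)
      = measure_pmf.expectation p (\<lambda>c'. indicator {c} c' * pmf (K c) a)"
    unfolding pmf_bind
  proof (intro Bochner_Integration.integral_cong refl)
    fix c' show "pmf (map_pmf (Pair c') (K c')) (c, a) = indicator {c} c' * pmf (K c) a"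
    proof (cases "c' = c")
      case True
      then show ?thesis by (simp add: pmf_map_inj' inj_on_def)
    next
      case False
      then have "(c, a) \<notin> set_pmf (map_pmf (Pair c') (K c'))" by auto
      with False show ?thesis by (simp add: pmf_eq_0_set_pmf)
    qed
  qed
  also have "\<dots> = pmf p c * pmf (K c) a"
    by (simp add: measure_pmf_single)
  finally show ?thesis .
qed

section \<open>Entropy: chain rule, Gibbs' inequality, submodularity\<close>

locale entropy_base =
  fixes b :: real
  assumes b_gt_1: "1 < b"
begin

definition H :: "'a pmf \<Rightarrow> real" where
  "H p = measure_pmf.expectation p (\<lambda>a. - log b (pmf p a))"

text \<open>Conditional entropy and conditional information get no constants of their own: they are
  sums and differences of \<open>ent\<close> of tuples, so that their identities reduce to
  rearranging tuples.\<close>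

definition ent :: "'o pmf \<Rightarrow> ('o \<Rightarrow> 'a) \<Rightarrow> real" where
  "ent Q A = H (map_pmf A Q)"

lemma ent_expectation:
  "ent Q A = measure_pmf.expectation Q (\<lambda>\<omega>. - log b (pmf (map_pmf A Q) (A \<omega>)))"
  by (simp add: ent_def H_def)

lemma ent_map_pmf: "ent (map_pmf f Q) A = ent Q (\<lambda>\<omega>. A (f \<omega>))"
  by (simp add: ent_def pmf.map_comp o_def)

lemma H_map_inj:
  assumes "inj_on f (set_pmf p)"
  shows "H (map_pmf f p) = H p"
  unfolding H_def integral_map_pmf
  by (rule expectation_cong_set_pmf) (simp add: pmf_map_inj assms)

lemma ent_relabel:
  assumes "inj_on f (A ` set_pmf Q)"
  shows "ent Q (\<lambda>\<omega>. f (A \<omega>)) = ent Q A"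
proof -
  have "map_pmf (\<lambda>\<omega>. f (A \<omega>)) Q = map_pmf f (map_pmf A Q)"
    by (simp add: pmf.map_comp o_def)
  then show ?thesis using H_map_inj[of f "map_pmf A Q"] assms by (simp add: ent_def)
qed

text \<open>Variables that determine each other on the support have laws that are relabellings of
  one another. This covers reordering a tuple as well as adding or removing a component that is a
  function of the others.\<close>

lemma ent_cong_inj:
  assumes "\<And>\<omega> \<omega>'. \<omega> \<in> set_pmf Q \<Longrightarrow> \<omega>' \<in> set_pmf Q \<Longrightarrow> A \<omega> = A \<omega>' \<longleftrightarrow> B \<omega> = B \<omega>'"
  shows "ent Q A = ent Q B"
proof -
  define f where "f a = B (SOME \<omega>. \<omega> \<in> set_pmf Q \<and> A \<omega> = a)" for a
  have fA: "f (A \<omega>) = B \<omega>" if "\<omega> \<in> set_pmf Q" for \<omega>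
  proof -
    define \<omega>' where "\<omega>' = (SOME \<omega>'. \<omega>' \<in> set_pmf Q \<and> A \<omega>' = A \<omega>)"
    have "\<omega>' \<in> set_pmf Q \<and> A \<omega>' = A \<omega>"
      unfolding \<omega>'_def by (rule someI_ex) (use that in auto)
    then show ?thesis using assms[of \<omega>' \<omega>] that by (simp add: f_def \<omega>'_def)
  qed
  have "map_pmf B Q = map_pmf (\<lambda>\<omega>. f (A \<omega>)) Q"
    by (rule map_pmf_cong) (simp_all add: fA)
  then have "ent Q B = ent Q (\<lambda>\<omega>. f (A \<omega>))" by (simp add: ent_def)
  also have "\<dots> = ent Q A"
    by (rule ent_relabel) (use assms fA in \<open>force simp: inj_on_def\<close>)
  finally show ?thesis by simp
qed

lemma H_bind_Pair:
  assumes "finite (set_pmf p)" "\<And>c. c \<in> set_pmf p \<Longrightarrow> finite (set_pmf (K c))"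
  shows "H (p \<bind> (\<lambda>c. map_pmf (Pair c) (K c))) = H p + measure_pmf.expectation p (\<lambda>c. H (K c))"
proof -
  have "H (p \<bind> (\<lambda>c. map_pmf (Pair c) (K c)))
     = measure_pmf.expectation p (\<lambda>c. measure_pmf.expectation (K c)
          (\<lambda>a. - log b (pmf p c * pmf (K c) a)))"
    unfolding H_def using assms
    by (subst expectation_bind_finite) (auto simp: pmf_bind_Pair)
  also have "\<dots> = measure_pmf.expectation p (\<lambda>c. - log b (pmf p c) + H (K c))"
  proof (rule expectation_cong_set_pmf)
    fix c assume c: "c \<in> set_pmf p"
    have "measure_pmf.expectation (K c) (\<lambda>a. - log b (pmf p c * pmf (K c) a))
       = measure_pmf.expectation (K c) (\<lambda>a. - log b (pmf p c) + - log b (pmf (K c) a))"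
      using c by (intro expectation_cong_set_pmf) (auto simp: log_mult set_pmf_iff)
    also have "\<dots> = - log b (pmf p c) + H (K c)"
      unfolding H_def using assms(2)[OF c] by (subst Bochner_Integration.integral_add) auto
    finally show "measure_pmf.expectation (K c) (\<lambda>a. - log b (pmf p c * pmf (K c) a))
       = - log b (pmf p c) + H (K c)" .
  qed
  also have "\<dots> = H p + measure_pmf.expectation p (\<lambda>c. H (K c))"
    unfolding H_def using assms(1) by (subst Bochner_Integration.integral_add) auto
  finally show ?thesis .
qed

text \<open>Cross entropy dominates conditional entropy. Here \<open>r a c\<close> is any guess at
  \<open>P(a|c)\<close>, summing to at most 1 over the values \<open>a\<close> that occur together
  with \<open>c\<close>. The guesses used later are \<open>P(a|c)\<close> with a further variable
  ignored, the uniform law, and a product of smoothed letter laws.\<close>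

lemma gibbs:
  fixes A :: "'o \<Rightarrow> 'a" and C :: "'o \<Rightarrow> 'c"
  assumes fin: "finite (set_pmf Q)"
    and pos: "\<And>\<omega>. \<omega> \<in> set_pmf Q \<Longrightarrow> 0 < r (A \<omega>) (C \<omega>)"
    and sub: "\<And>c. c \<in> C ` set_pmf Q \<Longrightarrow> (\<Sum>a\<in>{a. (a, c) \<in> (\<lambda>\<omega>. (A \<omega>, C \<omega>)) ` set_pmf Q}. r a c) \<le> 1"
  shows "ent Q (\<lambda>\<omega>. (A \<omega>, C \<omega>)) - ent Q C \<le> measure_pmf.expectation Q (\<lambda>\<omega>. - log b (r (A \<omega>) (C \<omega>)))"
proof -
  define AC where "AC = map_pmf (\<lambda>\<omega>. (A \<omega>, C \<omega>)) Q"
  define PC where "PC = map_pmf C Q"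
  have finAC: "finite (set_pmf AC)" and finC: "finite (set_pmf PC)"
    using fin by (simp_all add: AC_def PC_def)
  have posAC: "0 < pmf AC (A \<omega>, C \<omega>)" and posC: "0 < pmf PC (C \<omega>)" if "\<omega> \<in> set_pmf Q" for \<omega>
    using that by (auto simp: AC_def PC_def intro!: pmf_positive)
  \<comment> \<open>Likelihood ratio of the guess \<open>r\<close> to the true
    \<open>P(a|c)\<close>: its mean is at most 1, and \<open>ln t \<le> t - 1\<close> turns this
    into the claim.\<close>
  let ?t = "\<lambda>\<omega>. r (A \<omega>) (C \<omega>) * pmf PC (C \<omega>) / pmf AC (A \<omega>, C \<omega>)"
  have "ent Q (\<lambda>\<omega>. (A \<omega>, C \<omega>)) - ent Q C + measure_pmf.expectation Q (\<lambda>\<omega>. log b (r (A \<omega>) (C \<omega>)))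
     = measure_pmf.expectation Q (\<lambda>\<omega>. - log b (pmf AC (A \<omega>, C \<omega>)) - - log b (pmf PC (C \<omega>))
           + log b (r (A \<omega>) (C \<omega>)))"
    unfolding ent_expectation AC_def PC_def using fin
    by (subst Bochner_Integration.integral_add, simp, simp, subst Bochner_Integration.integral_diff) auto
  also have "\<dots> \<le> measure_pmf.expectation Q (\<lambda>\<omega>. (?t \<omega> - 1) / ln b)"
  proof (rule expectation_mono_finite[OF fin])
    fix \<omega> assume w: "\<omega> \<in> set_pmf Q"
    have t: "0 < ?t \<omega>" using pos[OF w] posAC[OF w] posC[OF w] by simp
    have "- log b (pmf AC (A \<omega>, C \<omega>)) - - log b (pmf PC (C \<omega>)) + log b (r (A \<omega>) (C \<omega>)) = log b (?t \<omega>)"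
      using pos[OF w] posAC[OF w] posC[OF w] by (simp add: log_mult log_divide)
    also have "\<dots> \<le> (?t \<omega> - 1) / ln b"
      unfolding log_def using ln_le_minus_one[OF t] b_gt_1 by (intro divide_right_mono) auto
    finally show "- log b (pmf AC (A \<omega>, C \<omega>)) - - log b (pmf PC (C \<omega>)) + log b (r (A \<omega>) (C \<omega>))
        \<le> (?t \<omega> - 1) / ln b" .
  qed
  also have "\<dots> = (measure_pmf.expectation Q ?t - 1) / ln b"
    using fin by (simp add: Bochner_Integration.integral_diff)
  also have "\<dots> \<le> 0"
  proof -
    have "measure_pmf.expectation Q ?t
        = measure_pmf.expectation AC (\<lambda>(a, c). r a c * pmf PC c / pmf AC (a, c))"
      by (simp add: AC_def)
    also have "\<dots> = (\<Sum>(a, c)\<in>set_pmf AC. r a c * pmf PC c)"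
      by (subst expectation_finite_sum[OF finAC order_refl])
         (auto intro!: sum.cong simp: set_pmf_iff)
    also have "\<dots> = (\<Sum>(c, a)\<in>Sigma (set_pmf PC) (\<lambda>c. {a. (a, c) \<in> set_pmf AC}). r a c * pmf PC c)"
      by (rule sum.reindex_bij_witness[of _ "\<lambda>(c, a). (a, c)" "\<lambda>(a, c). (c, a)"])
         (auto simp: AC_def PC_def)
    also have "\<dots> = (\<Sum>c\<in>set_pmf PC. \<Sum>a\<in>{a. (a, c) \<in> set_pmf AC}. r a c * pmf PC c)"
    proof (rule sum.Sigma[symmetric])
      show "\<forall>c\<in>set_pmf PC. finite {a. (a, c) \<in> set_pmf AC}"
      proof
        fix c
        have "{a. (a, c) \<in> set_pmf AC} \<subseteq> fst ` set_pmf AC" by force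
        then show "finite {a. (a, c) \<in> set_pmf AC}" using finAC finite_subset by blast
      qed
    qed (use finC in simp)
    also have "\<dots> \<le> (\<Sum>c\<in>set_pmf PC. pmf PC c)"
    proof (rule sum_mono)
      fix c assume c: "c \<in> set_pmf PC"
      have "(\<Sum>a\<in>{a. (a, c) \<in> set_pmf AC}. r a c) \<le> 1"
        using sub[of c] c by (simp add: AC_def PC_def)
      then have "(\<Sum>a\<in>{a. (a, c) \<in> set_pmf AC}. r a c) * pmf PC c \<le> 1 * pmf PC c"
        by (rule mult_right_mono) simp
      then show "(\<Sum>a\<in>{a. (a, c) \<in> set_pmf AC}. r a c * pmf PC c) \<le> pmf PC c"
        by (simp add: sum_distrib_right)
    qed
    also have "\<dots> = 1" by (rule sum_pmf_eq_1) (use finC in auto)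
    finally show ?thesis using b_gt_1 by (intro divide_nonpos_pos) auto
  qed
  finally show ?thesis using fin by simp
qed

lemma sum_pmf_pair_le:
  assumes "finite S"
  shows "(\<Sum>a\<in>S. pmf (map_pmf (\<lambda>\<omega>. (A \<omega>, C \<omega>)) Q) (a, c)) \<le> pmf (map_pmf C Q) c"
proof -
  have "(\<Sum>a\<in>S. pmf (map_pmf (\<lambda>\<omega>. (A \<omega>, C \<omega>)) Q) (a, c))
     = measure (map_pmf (\<lambda>\<omega>. (A \<omega>, C \<omega>)) Q) ((\<lambda>a. (a, c)) ` S)"
    using assms by (subst measure_measure_pmf_finite) (auto simp: sum.reindex inj_on_def)
  also have "\<dots> \<le> measure (map_pmf (\<lambda>\<omega>. (A \<omega>, C \<omega>)) Q) (snd -` {c})"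
    by (rule measure_pmf.finite_measure_mono) auto
  also have "\<dots> = measure (map_pmf snd (map_pmf (\<lambda>\<omega>. (A \<omega>, C \<omega>)) Q)) {c}"
    by simp
  also have "\<dots> = pmf (map_pmf C Q) c"
    by (simp add: pmf.map_comp o_def measure_pmf_single del: measure_map_pmf)
  finally show ?thesis .
qed

text \<open>Conditioning reduces entropy: \<open>gibbs\<close> for the condition
  \<open>(C, E)\<close> with the guess \<open>P(a|c)\<close>, which disregards
  \<open>e\<close>.\<close>

lemma ent_submodular:
  assumes fin: "finite (set_pmf Q)"
  shows "ent Q (\<lambda>\<omega>. (A \<omega>, C \<omega>, E \<omega>)) - ent Q (\<lambda>\<omega>. (C \<omega>, E \<omega>)) \<le> ent Q (\<lambda>\<omega>. (A \<omega>, C \<omega>)) - ent Q C"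
proof -
  define AC where "AC = map_pmf (\<lambda>\<omega>. (A \<omega>, C \<omega>)) Q"
  define PC where "PC = map_pmf C Q"
  have posAC: "0 < pmf AC (A \<omega>, C \<omega>)" and posC: "0 < pmf PC (C \<omega>)" if "\<omega> \<in> set_pmf Q" for \<omega>
    using that by (auto simp: AC_def PC_def intro!: pmf_positive)
  have "ent Q (\<lambda>\<omega>. (A \<omega>, C \<omega>, E \<omega>)) - ent Q (\<lambda>\<omega>. (C \<omega>, E \<omega>))
    \<le> measure_pmf.expectation Q (\<lambda>\<omega>. - log b ((\<lambda>a (c, e). pmf AC (a, c) / pmf PC c) (A \<omega>) (C \<omega>, E \<omega>)))"
  proof (rule gibbs[OF fin], goal_cases)
    case (1 \<omega>)
    then show ?case using posAC posC by simp
  next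
    case (2 z)
    obtain c e where z: "z = (c, e)" by force
    let ?S = "{a. (a, z) \<in> (\<lambda>\<omega>. (A \<omega>, C \<omega>, E \<omega>)) ` set_pmf Q}"
    have "?S \<subseteq> A ` set_pmf Q" by auto
    then have "finite ?S" using fin finite_subset by blast
    from sum_pmf_pair_le[OF this, of A C Q c]
    have "(\<Sum>a\<in>?S. pmf AC (a, c)) \<le> pmf PC c" by (simp add: AC_def PC_def)
    moreover have "0 < pmf PC c" using 2 posC by (auto simp: z)
    ultimately show ?case by (simp add: z sum_divide_distrib[symmetric])
  qed
  also have "\<dots> = measure_pmf.expectation Q (\<lambda>\<omega>. - log b (pmf AC (A \<omega>, C \<omega>)) - - log b (pmf PC (C \<omega>)))"
    using posAC posC by (intro expectation_cong_set_pmf) (auto simp: log_divide less_le)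
  also have "\<dots> = ent Q (\<lambda>\<omega>. (A \<omega>, C \<omega>)) - ent Q C"
    unfolding ent_expectation AC_def PC_def using fin by (subst Bochner_Integration.integral_diff) auto
  finally show ?thesis .
qed

lemma ent_cond_le_log_card:
  assumes fin: "finite (set_pmf Q)" and "finite S" "A ` set_pmf Q \<subseteq> S"
  shows "ent Q (\<lambda>\<omega>. (A \<omega>, C \<omega>)) - ent Q C \<le> log b (card S)"
proof -
  have "S \<noteq> {}" using assms(3) set_pmf_not_empty[of Q] by auto
  then have c: "card S > 0" using assms by (simp add: card_gt_0_iff)
  have "ent Q (\<lambda>\<omega>. (A \<omega>, C \<omega>)) - ent Q C
    \<le> measure_pmf.expectation Q (\<lambda>\<omega>. - log b ((\<lambda>a c. 1 / real (card S)) (A \<omega>) (C \<omega>)))"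
  proof (rule gibbs[OF fin], goal_cases)
    case (1 \<omega>)
    then show ?case using c by simp
  next
    case (2 z)
    let ?S = "{a. (a, z) \<in> (\<lambda>\<omega>. (A \<omega>, C \<omega>)) ` set_pmf Q}"
    have "card ?S \<le> card S" by (rule card_mono) (use assms in auto)
    then show ?case using c by simp
  qed
  also have "\<dots> = log b (card S)" using c by (simp add: log_divide)
  finally show ?thesis .
qed

section \<open>Library entropies as finite sums\<close>

lemma information_space_pmf: "information_space (measure_pmf Q) b"
  by (intro information_space.intro information_space_axioms.intro b_gt_1) 
     (simp add: prob_space_measure_pmf)

lemma distributed_pmf:
  "distributed (measure_pmf Q) (count_space UNIV) A (\<lambda>a. ennreal (pmf (map_pmf A Q) a))"
  unfolding distributed_def
  by (auto simp: measure_pmf_eq_density[symmetric] map_pmf_rep_eq)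

lemma integrable_count_space_pmf:
  fixes g :: "'a \<Rightarrow> real"
  assumes "finite (set_pmf p)"
  shows "integrable (count_space UNIV) (\<lambda>x. pmf p x * g x)"
proof -
  have "integrable (density (count_space UNIV) (\<lambda>x. ennreal (pmf p x))) g"
    using integrable_finite_pmf[OF assms, of g] by (simp only: measure_pmf_eq_density)
  then show ?thesis by (subst (asm) integrable_density) auto
qed

lemma integral_count_space_pmf:
  fixes g :: "'a \<Rightarrow> real"
  shows "integral\<^sup>L (count_space UNIV) (\<lambda>x. pmf p x * g x) = measure_pmf.expectation p g"
  unfolding measure_pmf_eq_density by (subst integral_density) auto

lemma finite_entropy_pmf:
  assumes "finite (set_pmf Q)"
  shows "information_space.finite_entropy (measure_pmf Q) b (count_space UNIV) A (pmf (map_pmf A Q))"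
proof -
  interpret information_space "measure_pmf Q" b by (rule information_space_pmf)
  show ?thesis
    unfolding finite_entropy_def using assms 
    by (auto simp: distributed_pmf integrable_count_space_pmf)
qed

lemma pair_count_space_UNIV:
  "count_space (UNIV :: 'a::countable set) \<Otimes>\<^sub>M count_space (UNIV :: 'c::countable set) = count_space UNIV"
  by (subst pair_measure_countable) auto

text \<open>Countable types make a product of counting measures a counting measure, and finite
  support makes every function integrable, so the integrals behind the library notion become finite
  sums. The next lemma does the same for conditional information; the later arguments are carried
  out in \<open>ent\<close>.\<close>

lemma cond_entropy_eq_ent:
  fixes A :: "'o \<Rightarrow> 'a::countable" and C :: "'o \<Rightarrow> 'c::countable"
  assumes fin: "finite (set_pmf Q)"
  shows "cond_entropy b Q A C = ent Q (\<lambda>\<omega>. (A \<omega>, C \<omega>)) - ent Q C"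
proof -
  interpret information_space "measure_pmf Q" b by (rule information_space_pmf)
  define AC where "AC = map_pmf (\<lambda>\<omega>. (A \<omega>, C \<omega>)) Q"
  define PC where "PC = map_pmf C Q"
  have "cond_entropy b Q A C = - (\<integral>(a, c). pmf AC (a, c) * log b (pmf AC (a, c) / pmf PC c)
      \<partial>(count_space UNIV \<Otimes>\<^sub>M count_space UNIV))"
    unfolding AC_def PC_def
    by (rule conditional_entropy_generic_eq)
       (auto simp: pair_count_space_UNIV distributed_pmf sigma_finite_measure_count_space)
  also have "\<dots> = - (\<integral>z. pmf AC z * log b (pmf AC z / pmf PC (snd z)) \<partial>count_space UNIV)"
    by (simp add: pair_count_space_UNIV split_beta')
  also have "\<dots> = - measure_pmf.expectation AC (\<lambda>z. log b (pmf AC z / pmf PC (snd z)))"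
    by (simp add: integral_count_space_pmf)
  also have "\<dots> = measure_pmf.expectation Q (\<lambda>\<omega>. - log b (pmf AC (A \<omega>, C \<omega>) / pmf PC (C \<omega>)))"
    by (simp add: AC_def)
  also have "\<dots> = measure_pmf.expectation Q (\<lambda>\<omega>. - log b (pmf AC (A \<omega>, C \<omega>)) - - log b (pmf PC (C \<omega>)))"
    by (rule expectation_cong_set_pmf) (auto simp: log_divide AC_def PC_def set_pmf_iff[symmetric] pmf_eq_0_set_pmf)
  also have "\<dots> = ent Q (\<lambda>\<omega>. (A \<omega>, C \<omega>)) - ent Q C"
    unfolding ent_expectation AC_def PC_def using fin by (subst Bochner_Integration.integral_diff) auto
  finally show ?thesis .
qed

lemma cond_mutual_info_eq_ent:
  fixes X :: "'o \<Rightarrow> 'a::countable" and Y :: "'o \<Rightarrow> 'c::countable" and Z :: "'o \<Rightarrow> 'e::countable"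
  assumes fin: "finite (set_pmf Q)"
  shows "cond_mutual_info b Q X Y Z = ent Q (\<lambda>\<omega>. (X \<omega>, Z \<omega>)) + ent Q (\<lambda>\<omega>. (Y \<omega>, Z \<omega>))
     - ent Q (\<lambda>\<omega>. (X \<omega>, Y \<omega>, Z \<omega>)) - ent Q Z"
proof -
  interpret information_space "measure_pmf Q" b by (rule information_space_pmf)
  define P3 where "P3 = map_pmf (\<lambda>\<omega>. (X \<omega>, Y \<omega>, Z \<omega>)) Q"
  define PXZ where "PXZ = map_pmf (\<lambda>\<omega>. (X \<omega>, Z \<omega>)) Q"
  define PYZ where "PYZ = map_pmf (\<lambda>\<omega>. (Y \<omega>, Z \<omega>)) Q"
  define PZ where "PZ = map_pmf Z Q"
  have "cond_mutual_info b Q X Y Z = (\<integral>(x, y, z). pmf P3 (x, y, z) *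
      log b (pmf P3 (x, y, z) / (pmf PXZ (x, z) * (pmf PYZ (y, z) / pmf PZ z)))
      \<partial>(count_space UNIV \<Otimes>\<^sub>M count_space UNIV \<Otimes>\<^sub>M count_space UNIV))"
    unfolding P3_def PXZ_def PYZ_def PZ_def
    by (rule conditional_mutual_information_generic_eq'[where Px = "pmf (map_pmf X Q)"])
       (use fin in \<open>auto simp: pair_count_space_UNIV finite_entropy_pmf sigma_finite_measure_count_space\<close>)
  also have "\<dots> = (\<integral>w. pmf P3 w * (\<lambda>(x, y, z). log b (pmf P3 (x, y, z) /
      (pmf PXZ (x, z) * (pmf PYZ (y, z) / pmf PZ z)))) w \<partial>count_space UNIV)"
    by (simp add: pair_count_space_UNIV split_beta')
  also have "\<dots> = measure_pmf.expectation P3 (\<lambda>(x, y, z). log b (pmf P3 (x, y, z) /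
      (pmf PXZ (x, z) * (pmf PYZ (y, z) / pmf PZ z))))"
    by (rule integral_count_space_pmf)
  also have "\<dots> = measure_pmf.expectation Q (\<lambda>\<omega>. log b (pmf P3 (X \<omega>, Y \<omega>, Z \<omega>) /
      (pmf PXZ (X \<omega>, Z \<omega>) * (pmf PYZ (Y \<omega>, Z \<omega>) / pmf PZ (Z \<omega>)))))"
    by (simp add: P3_def)
  also have "\<dots> = measure_pmf.expectation Q (\<lambda>\<omega>. - log b (pmf PXZ (X \<omega>, Z \<omega>))
      + - log b (pmf PYZ (Y \<omega>, Z \<omega>)) - - log b (pmf P3 (X \<omega>, Y \<omega>, Z \<omega>)) - - log b (pmf PZ (Z \<omega>)))"
  proof (rule expectation_cong_set_pmf)
    fix \<omega> assume "\<omega> \<in> set_pmf Q"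
    then have "pmf P3 (X \<omega>, Y \<omega>, Z \<omega>) > 0" "pmf PXZ (X \<omega>, Z \<omega>) > 0" "pmf PYZ (Y \<omega>, Z \<omega>) > 0"
      "pmf PZ (Z \<omega>) > 0"
      by (auto simp: P3_def PXZ_def PYZ_def PZ_def intro!: pmf_positive)
    then show "log b (pmf P3 (X \<omega>, Y \<omega>, Z \<omega>) / (pmf PXZ (X \<omega>, Z \<omega>) * (pmf PYZ (Y \<omega>, Z \<omega>) / pmf PZ (Z \<omega>))))
      = - log b (pmf PXZ (X \<omega>, Z \<omega>))
      + - log b (pmf PYZ (Y \<omega>, Z \<omega>)) - - log b (pmf P3 (X \<omega>, Y \<omega>, Z \<omega>)) - - log b (pmf PZ (Z \<omega>))"
      by (simp add: log_divide log_mult less_le)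
  qed
  also have "\<dots> = ent Q (\<lambda>\<omega>. (X \<omega>, Z \<omega>)) + ent Q (\<lambda>\<omega>. (Y \<omega>, Z \<omega>))
     - ent Q (\<lambda>\<omega>. (X \<omega>, Y \<omega>, Z \<omega>)) - ent Q Z"
    unfolding ent_expectation P3_def PXZ_def PYZ_def PZ_def using fin
    by (subst Bochner_Integration.integral_diff; simp?)+
  finally show ?thesis .
qed

end

subsection \<open>Single-letter tuples as convex combinations\<close>

text \<open>Conditional laws given the first component. At values \<open>a\<close> of probability 0
  the kernel is a point mass at some value that does occur, so that the support bound holds for
  every \<open>a\<close>.\<close>

lemma pmf_disintegration:
  fixes J :: "('a \<times> 'c) pmf"
  obtains K where "J = map_pmf fst J \<bind> (\<lambda>a. map_pmf (Pair a) (K a))"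
    "\<And>a. set_pmf (K a) \<subseteq> snd ` set_pmf J"
proof -
  obtain z where z: "z \<in> set_pmf J" using set_pmf_not_empty[of J] by blast
  define K where "K a = (if a \<in> fst ` set_pmf J then map_pmf snd (cond_pmf J (fst -` {a}))
     else return_pmf (snd z))" for a
  have ne: "set_pmf J \<inter> fst -` {a} \<noteq> {}" if "a \<in> fst ` set_pmf J" for a using that by auto
  have "J = map_pmf fst J \<bind> (\<lambda>a. map_pmf (Pair a) (K a))"
  proof (rule pmf_eqI)
    fix w :: "'a \<times> 'c" obtain a c where w: "w = (a, c)" by force
    show "pmf J w = pmf (map_pmf fst J \<bind> (\<lambda>a. map_pmf (Pair a) (K a))) w"
    proof (cases "a \<in> fst ` set_pmf J")
      case False
      then have "w \<notin> set_pmf J" "w \<notin> set_pmf (map_pmf fst J \<bind> (\<lambda>a. map_pmf (Pair a) (K a)))"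
        by (auto simp: w image_iff)
      then show ?thesis unfolding set_pmf_iff by simp
    next
      case True
      have m: "pmf (map_pmf fst J) a = measure_pmf.prob J (fst -` {a})"
        by (simp add: pmf_map)
      have pos: "measure_pmf.prob J (fst -` {a}) > 0"
        using ne[OF True] by (simp add: measure_pmf_posI m[symmetric] pmf_positive True)
      have "pmf (K a) c = measure_pmf.prob (cond_pmf J (fst -` {a})) (snd -` {c})"
        using True by (simp add: K_def pmf_map)
      also have "\<dots> = measure_pmf.prob (cond_pmf J (fst -` {a})) {(a, c)}"
        by (rule measure_pmf.finite_measure_eq_AE)
           (auto simp: AE_measure_pmf_iff set_cond_pmf[OF ne[OF True]])
      also have "\<dots> = pmf J (a, c) / measure_pmf.prob J (fst -` {a})"
        by (simp add: measure_pmf_single pmf_cond[OF ne[OF True]])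
      finally show ?thesis using pos by (simp add: w pmf_bind_Pair m)
    qed
  qed
  moreover have "set_pmf (K a) \<subseteq> snd ` set_pmf J" for a
    using z by (auto simp: K_def set_cond_pmf[OF ne])
  ultimately show ?thesis by (rule that)
qed

text \<open>The type of \<open>u\<close> is left open because the auxiliary variable of a block code
  is a number together with two lists, while the regions use natural numbers.\<close>

definition joint :: "('x \<times> 'y) pmf \<Rightarrow> ('x \<Rightarrow> 'u pmf) \<Rightarrow> ('u \<Rightarrow> 'y \<Rightarrow> 'h pmf) \<Rightarrow> ('x \<times> 'y \<times> 'u \<times> 'h) pmf"
  where "joint P PU PH = P \<bind> (\<lambda>(x, y). PU x \<bind> (\<lambda>u. map_pmf (\<lambda>h. (x, y, u, h)) (PH u y)))"

lemma joint_in_eq: "joint_in P PU PH = joint P PU PH"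
  by (simp add: joint_in_def joint_def map_pmf_def)

lemma joint_out_copy:
  "joint_out P PU (\<lambda>u y. map_pmf (Pair u) (PH u y)) = map_pmf (\<lambda>(x, y, u, h). (x, y, u, u, h)) (joint P PU PH)"
  by (auto simp: joint_out_def joint_def map_pmf_def bind_assoc_pmf bind_return_pmf
      intro!: bind_pmf_cong split: prod.split)

lemma finite_set_joint:
  fixes P :: "('x::finite \<times> 'y::finite) pmf" and PH :: "'u \<Rightarrow> 'y \<Rightarrow> 'h::finite pmf"
  assumes "\<And>x. finite (set_pmf (PU x))"
  shows "finite (set_pmf (joint P PU PH))"
  using assms by (auto simp: joint_def split: prod.split)

section \<open>Tuples for one value of \<open>U\<close> and their averages\<close>

context entropy_base
begin

text \<open>Laws live in a Euclidean space here, where convex hulls and compactness are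
  available.\<close>

definition vec_pmf :: "'a::finite pmf \<Rightarrow> real ^ 'a" where
  "vec_pmf p = (\<chi> a. pmf p a)"

text \<open>The components are \<open>P\<^sub>X\<close>, \<open>H(X|Y)\<close>, the mean distortion and \<open>H(Xh|Y)\<close>, conditioned on one value
  of \<open>U\<close>. \<open>P\<^sub>X\<close> is recorded so that an average over \<open>u\<close> can be turned back into a kernel \<open>P(u|x)\<close>.\<close>

definition point :: "('x::finite \<Rightarrow> 'y pmf) \<Rightarrow> ('x \<Rightarrow> 'y \<Rightarrow> 'h \<Rightarrow> real) \<Rightarrow> 'x pmf \<Rightarrow> ('y \<Rightarrow> 'h pmf)
    \<Rightarrow> (real ^ 'x) \<times> real \<times> real \<times> real" where
  "point C e q W = (vec_pmf q,
     H (q \<bind> (\<lambda>x. map_pmf (Pair x) (C x))) - H (q \<bind> C),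
     measure_pmf.expectation (q \<bind> (\<lambda>x. map_pmf (Pair x) (C x)))
       (\<lambda>(x, y). measure_pmf.expectation (W y) (e x y)),
     measure_pmf.expectation (q \<bind> C) (\<lambda>y. H (W y)))"

definition points :: "('x::finite \<Rightarrow> 'y pmf) \<Rightarrow> ('x \<Rightarrow> 'y \<Rightarrow> 'h \<Rightarrow> real)
    \<Rightarrow> ((real ^ 'x) \<times> real \<times> real \<times> real) set" where
  "points C e = {point C e q W | q W. True}"

text \<open>Counterpart of \<open>point\<close> for a whole joint law: after
  \<open>P\<^sub>X\<close> come \<open>H(X|U,Y)\<close>, the mean distortion and
  \<open>H(Xh|U,Y)\<close>.\<close>

definition rates :: "('x::finite \<times> 'y) pmf \<Rightarrow> ('x \<Rightarrow> 'y \<Rightarrow> 'h \<Rightarrow> real) \<Rightarrow> ('x \<times> 'y \<times> 'u \<times> 'h) pmf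
    \<Rightarrow> (real ^ 'x) \<times> real \<times> real \<times> real" where
  "rates P e Q = (vec_pmf (map_pmf fst P),
     ent Q (\<lambda>(x, y, u, h). (x, u, y)) - ent Q (\<lambda>(x, y, u, h). (u, y)),
     measure_pmf.expectation Q (\<lambda>(x, y, u, h). e x y h),
     ent Q (\<lambda>(x, y, u, h). (h, u, y)) - ent Q (\<lambda>(x, y, u, h). (u, y)))"

lemma pmf_bind_finite:
  fixes p :: "'a::finite pmf"
  shows "pmf (p \<bind> K) z = (\<Sum>a\<in>UNIV. pmf p a * pmf (K a) z)"
  unfolding pmf_bind by (subst expectation_finite_sum[of UNIV]) auto

text \<open>The letter \<open>h\<close> is drawn from a law that depends on \<open>u\<close> and
  \<open>y\<close> only, so conditioning on \<open>x\<close> as well changes nothing. Equality of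
  the two differences gives \<open>I(X;U,Xh|Y) = I(X;U|Y)\<close>, which is what the choice
  \<open>V = U\<close> achieves.\<close>

lemma ent_joint_H:
  fixes P :: "('x::finite \<times> 'y::finite) pmf" and PH :: "'u \<Rightarrow> 'y \<Rightarrow> 'h::finite pmf"
  assumes fin: "\<And>x. finite (set_pmf (PU x))"
  defines "Q \<equiv> joint P PU PH"
  shows "ent Q (\<lambda>(x, y, u, h). (h, u, y)) - ent Q (\<lambda>(x, y, u, h). (u, y))
      = measure_pmf.expectation Q (\<lambda>(x, y, u, h). H (PH u y))"
    and "ent Q (\<lambda>(x, y, u, h). (x, u, h, y)) - ent Q (\<lambda>(x, y, u, h). (x, u, y))
      = measure_pmf.expectation Q (\<lambda>(x, y, u, h). H (PH u y))"
proof -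
  define B where "B = P \<bind> (\<lambda>(x, y). map_pmf (\<lambda>u. (x, y, u)) (PU x))"
  have finB: "finite (set_pmf B)" using fin by (auto simp: B_def)
  have QB: "Q = B \<bind> (\<lambda>(x, y, u). map_pmf (\<lambda>h. (x, y, u, h)) (PH u y))"
    by (auto simp: Q_def joint_def B_def bind_assoc_pmf bind_map_pmf intro!: bind_pmf_cong)
  have ex: "measure_pmf.expectation Q (\<lambda>(x, y, u, h). H (PH u y))
     = measure_pmf.expectation B (\<lambda>(x, y, u). H (PH u y))"
    unfolding QB using finB
    by (subst expectation_bind_finite) (auto intro!: Bochner_Integration.integral_cong)
  define B1 where "B1 = map_pmf (\<lambda>(x, y, u). (u, y)) B"
  have "ent Q (\<lambda>(x, y, u, h). (h, u, y)) = ent Q (\<lambda>(x, y, u, h). ((u, y), h))"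
    by (rule ent_cong_inj) auto
  also have "\<dots> = H (B1 \<bind> (\<lambda>c. map_pmf (Pair c) (case c of (u, y) \<Rightarrow> PH u y)))"
    unfolding ent_def QB B1_def
    by (simp add: map_bind_pmf bind_map_pmf pmf.map_comp o_def split_beta')
  also have "\<dots> = H B1 + measure_pmf.expectation B1 (\<lambda>(u, y). H (PH u y))"
    by (subst H_bind_Pair) (use finB in \<open>auto simp: B1_def split_beta'\<close>)
  also have "H B1 = ent Q (\<lambda>(x, y, u, h). (u, y))"
    unfolding ent_def QB B1_def
    by (simp add: map_bind_pmf bind_map_pmf pmf.map_comp o_def split_beta' map_pmf_const)
       (simp add: map_pmf_def)
  also have "measure_pmf.expectation B1 (\<lambda>(u, y). H (PH u y)) = measure_pmf.expectation B (\<lambda>(x, y, u). H (PH u y))"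
    by (simp add: B1_def split_beta')
  finally show "ent Q (\<lambda>(x, y, u, h). (h, u, y)) - ent Q (\<lambda>(x, y, u, h). (u, y))
      = measure_pmf.expectation Q (\<lambda>(x, y, u, h). H (PH u y))" using ex by simp
  have "ent Q (\<lambda>(x, y, u, h). (x, u, h, y)) = ent Q (\<lambda>(x, y, u, h). ((x, y, u), h))"
    by (rule ent_cong_inj) auto
  also have "\<dots> = H (B \<bind> (\<lambda>c. map_pmf (Pair c) (case c of (x, y, u) \<Rightarrow> PH u y)))"
    unfolding ent_def QB
    by (simp add: map_bind_pmf bind_map_pmf pmf.map_comp o_def split_beta')
  also have "\<dots> = H B + measure_pmf.expectation B (\<lambda>(x, y, u). H (PH u y))"
    by (subst H_bind_Pair) (use finB in \<open>auto simp: split_beta'\<close>)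
  also have "H B = ent Q (\<lambda>(x, y, u, h). (x, y, u))"
    unfolding ent_def QB
    by (simp add: map_bind_pmf bind_map_pmf pmf.map_comp o_def split_beta' map_pmf_const bind_return_pmf')
  also have "\<dots> = ent Q (\<lambda>(x, y, u, h). (x, u, y))"
    by (rule ent_cong_inj) auto
  finally show "ent Q (\<lambda>(x, y, u, h). (x, u, h, y)) - ent Q (\<lambda>(x, y, u, h). (x, u, y))
      = measure_pmf.expectation Q (\<lambda>(x, y, u, h). H (PH u y))" using ex by simp
qed

section \<open>Reversing the test channel\<close>

context
  fixes P :: "('x::finite \<times> 'y::finite) pmf" and C :: "'x \<Rightarrow> 'y pmf"
    and e :: "'x \<Rightarrow> 'y \<Rightarrow> 'h::finite \<Rightarrow> real"
  assumes P_eq: "P = map_pmf fst P \<bind> (\<lambda>x. map_pmf (Pair x) (C x))"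
begin

text \<open>Bayes' rule. As \<open>u\<close> depends on \<open>x\<close> alone, the draws of
  \<open>y\<close> and \<open>u\<close> commute; the pair of \<open>u\<close> and \<open>x\<close>
  can then be drawn in the opposite order without touching the channel \<open>C\<close> from
  \<open>x\<close> to \<open>y\<close>.\<close>

lemma joint_reverse:
  assumes J: "map_pmf fst P \<bind> (\<lambda>x. map_pmf (\<lambda>u. (u, x)) (PU x)) = pu \<bind> (\<lambda>u. map_pmf (Pair u) (q u))"
  shows "joint P PU PH = pu \<bind> (\<lambda>u. q u \<bind> (\<lambda>x. C x \<bind> (\<lambda>y. map_pmf (\<lambda>h. (x, y, u, h)) (PH u y))))"
proof -
  have "joint P PU PH = map_pmf fst P \<bind> (\<lambda>x. C x \<bind> (\<lambda>y. PU x \<bind> (\<lambda>u. map_pmf (\<lambda>h. (x, y, u, h)) (PH u y))))"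
    unfolding joint_def by (subst P_eq) (simp add: bind_assoc_pmf bind_map_pmf map_pmf_comp)
  also have "\<dots> = map_pmf fst P \<bind> (\<lambda>x. PU x \<bind> (\<lambda>u. C x \<bind> (\<lambda>y. map_pmf (\<lambda>h. (x, y, u, h)) (PH u y))))"
    by (intro bind_pmf_cong refl bind_commute_pmf)
  also have "\<dots> = (map_pmf fst P \<bind> (\<lambda>x. map_pmf (\<lambda>u. (u, x)) (PU x))) \<bind>
      (\<lambda>(u, x). C x \<bind> (\<lambda>y. map_pmf (\<lambda>h. (x, y, u, h)) (PH u y)))"
    by (simp add: bind_assoc_pmf bind_map_pmf)
  also have "\<dots> = pu \<bind> (\<lambda>u. q u \<bind> (\<lambda>x. C x \<bind> (\<lambda>y. map_pmf (\<lambda>h. (x, y, u, h)) (PH u y))))"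
    unfolding J by (simp add: bind_assoc_pmf bind_map_pmf)
  finally show ?thesis .
qed

text \<open>By the chain rule the entropies of \<open>(u, x, y)\<close> and \<open>(u, y)\<close>
  are \<open>H pu\<close> plus averages over \<open>u\<close>, and \<open>H pu\<close> cancels in
  the difference. With \<open>P(x|u)\<close> as parameter the tuple is thus linear in the law of
  \<open>U\<close>.\<close>

lemma rates_reverse:
  fixes q :: "'u \<Rightarrow> 'x pmf" and PH :: "'u \<Rightarrow> 'y \<Rightarrow> 'h pmf"
  assumes J: "map_pmf fst P \<bind> (\<lambda>x. map_pmf (\<lambda>u. (u, x)) (PU x)) = pu \<bind> (\<lambda>u. map_pmf (Pair u) (q u))"
    and fin: "\<And>x. finite (set_pmf (PU x))"
  shows "rates P e (joint P PU PH) = (\<Sum>u\<in>set_pmf pu. pmf pu u *\<^sub>R point C e (q u) (PH u))"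
proof -
  define Q where "Q = joint P PU PH"
  note Q_eq = joint_reverse[OF J, of PH, folded Q_def]
  have "map_pmf fst (map_pmf fst P \<bind> (\<lambda>x. map_pmf (\<lambda>u. (u, x)) (PU x))) = pu"
    unfolding J by (simp add: map_bind_pmf pmf.map_comp o_def map_pmf_const bind_return_pmf')
  then have "set_pmf pu = (\<Union>x\<in>fst ` set_pmf P. set_pmf (PU x))" by (force simp: image_iff)
  then have finpu: "finite (set_pmf pu)" using fin by simp
  have PX: "map_pmf fst P = pu \<bind> q"
  proof -
    have "map_pmf snd (map_pmf fst P \<bind> (\<lambda>x. map_pmf (\<lambda>u. (u, x)) (PU x))) = map_pmf fst P"
      by (simp add: map_bind_pmf pmf.map_comp o_def map_pmf_const bind_return_pmf')
    then show ?thesis unfolding J by (simp add: map_bind_pmf pmf.map_comp o_def)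
  qed
  have sum_eq: "(\<Sum>u\<in>set_pmf pu. pmf pu u * g u) = measure_pmf.expectation pu g" for g
    using finpu by (simp add: expectation_finite_sum)
  have 1: "vec_pmf (map_pmf fst P) = (\<Sum>u\<in>set_pmf pu. pmf pu u *\<^sub>R vec_pmf (q u))"
    unfolding PX by (simp add: vec_eq_iff vec_pmf_def pmf_bind sum_eq)
  have U: "ent Q (\<lambda>(x, y, u, h). (u, x, y)) = H pu + measure_pmf.expectation pu
     (\<lambda>u. H (q u \<bind> (\<lambda>x. map_pmf (Pair x) (C x))))"
  proof -
    have "ent Q (\<lambda>(x, y, u, h). (u, x, y)) = 
      H (pu \<bind> (\<lambda>u. map_pmf (Pair u) (q u \<bind> (\<lambda>x. map_pmf (Pair x) (C x)))))"
      unfolding ent_def Q_eq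
      by (simp add: map_bind_pmf pmf.map_comp o_def map_pmf_const) (simp add: map_pmf_def)
    then show ?thesis by (simp add: H_bind_Pair finpu)
  qed
  have V: "ent Q (\<lambda>(x, y, u, h). (u, y)) = H pu + measure_pmf.expectation pu (\<lambda>u. H (q u \<bind> C))"
  proof -
    have "ent Q (\<lambda>(x, y, u, h). (u, y)) = H (pu \<bind> (\<lambda>u. map_pmf (Pair u) (q u \<bind> C)))"
      unfolding ent_def Q_eq
      by (simp add: map_bind_pmf pmf.map_comp o_def map_pmf_const) (simp add: map_pmf_def)
    then show ?thesis by (simp add: H_bind_Pair finpu)
  qed
  have "ent Q (\<lambda>(x, y, u, h). (x, u, y)) = ent Q (\<lambda>(x, y, u, h). (u, x, y))"
    by (rule ent_cong_inj) auto
  with U V finpu have 2: "ent Q (\<lambda>(x, y, u, h). (x, u, y)) - ent Q (\<lambda>(x, y, u, h). (u, y))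
    = measure_pmf.expectation pu (\<lambda>u. H (q u \<bind> (\<lambda>x. map_pmf (Pair x) (C x))) - H (q u \<bind> C))"
    by simp
  have 3: "measure_pmf.expectation Q (\<lambda>(x, y, u, h). e x y h) = measure_pmf.expectation pu
     (\<lambda>u. measure_pmf.expectation (q u \<bind> (\<lambda>x. map_pmf (Pair x) (C x)))
       (\<lambda>(x, y). measure_pmf.expectation (PH u y) (e x y)))"
    unfolding Q_eq using finpu by (simp add: expectation_bind_finite)
  have 4: "ent Q (\<lambda>(x, y, u, h). (h, u, y)) - ent Q (\<lambda>(x, y, u, h). (u, y))
    = measure_pmf.expectation pu (\<lambda>u. measure_pmf.expectation (q u \<bind> C) (\<lambda>y. H (PH u y)))"
    unfolding Q_def ent_joint_H(1)[OF fin] unfolding Q_def[symmetric] Q_eq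
    using finpu by (simp add: expectation_bind_finite)
  show ?thesis
    unfolding Q_def[symmetric] rates_def 1 2 3 4 point_def
    by (simp add: prod_eq_iff fst_sum snd_sum sum_eq)
qed

lemma rates_in_hull:
  fixes PH :: "'u \<Rightarrow> 'y \<Rightarrow> 'h pmf"
  assumes fin: "\<And>x. finite (set_pmf (PU x))"
  shows "rates P e (joint P PU PH) \<in> convex hull points C e"
proof -
  define J where "J = map_pmf fst P \<bind> (\<lambda>x. map_pmf (\<lambda>u. (u, x)) (PU x))"
  have finJ: "finite (set_pmf J)" using fin by (auto simp: J_def)
  obtain q where q: "J = map_pmf fst J \<bind> (\<lambda>u. map_pmf (Pair u) (q u))"
    using pmf_disintegration by metis
  have "(\<Sum>u\<in>set_pmf (map_pmf fst J). pmf (map_pmf fst J) u *\<^sub>R point C e (q u) (PH u)) \<in> convex hull points C e"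
    by (rule convex_sum[OF _ convex_convex_hull])
       (use finJ in \<open>auto intro!: hull_inc sum_pmf_eq_1 simp: points_def\<close>)
  then show ?thesis
    using rates_reverse[OF q[unfolded J_def] fin, of PH] by (simp add: J_def)
qed

text \<open>The weights of a convex combination serve as the law of \<open>U\<close> on
  \<open>{1..k}\<close>, its points supply \<open>P(x|u)\<close> and \<open>P(xh|u,y)\<close>. The
  condition on the first component says that the \<open>P(x|u)\<close> average to
  \<open>P\<^sub>X\<close>, so disintegrating in the other direction yields a kernel
  \<open>P(u|x)\<close> for the given source.\<close>

lemma hull_imp_rates:
  assumes z: "z \<in> convex hull points C e" and PX: "fst z = vec_pmf (map_pmf fst P)"
  obtains k :: nat and PU PH where "\<And>x. set_pmf (PU x) \<subseteq> {1..k}" "rates P e (joint P PU PH) = z"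
proof -
  obtain k u w where k: "\<forall>i\<in>{1::nat..k}. 0 \<le> u i \<and> w i \<in> points C e" "sum u {1..k} = (1::real)"
    "(\<Sum>i=1..k. u i *\<^sub>R w i) = z"
    using z unfolding convex_hull_indexed by auto
  have "\<forall>i. \<exists>q W. i \<in> {1..k} \<longrightarrow> w i = point C e q W" using k(1) by (force simp: points_def)
  then obtain q W where qW: "\<And>i. i \<in> {1..k} \<Longrightarrow> w i = point C e (q i) (W i)" by metis
  define pu where "pu = embed_pmf (\<lambda>i. if i \<in> {1..k} then u i else 0)"
  have pmf_pu: "pmf pu i = (if i \<in> {1..k} then u i else 0)" for i
    unfolding pu_def
  proof (rule pmf_embed_pmf)
    show "0 \<le> (if i \<in> {1..k} then u i else 0)" for i using k(1) by auto
    have "(\<integral>\<^sup>+ i. ennreal (if i \<in> {1..k} then u i else 0) \<partial>count_space UNIV)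
       = (\<Sum>i\<in>{1..k}. ennreal (u i))"
      by (subst nn_integral_count_space'[of "{1..k}"]) auto
    also have "\<dots> = 1" using k by (subst sum_ennreal) auto
    finally show "(\<integral>\<^sup>+ i. ennreal (if i \<in> {1..k} then u i else 0) \<partial>count_space UNIV) = 1" .
  qed
  have set_pu: "set_pmf pu \<subseteq> {1..k}" by (auto simp: set_pmf_iff pmf_pu split: if_splits)
  define J where "J = pu \<bind> (\<lambda>i. map_pmf (\<lambda>x. (x, i)) (q i))"
  have sndJ: "snd ` set_pmf J \<subseteq> {1..k}" using set_pu by (auto simp: J_def)
  have fstJ: "map_pmf fst J = map_pmf fst P"
  proof (rule pmf_eqI)
    fix x
    have "pmf (map_pmf fst J) x = pmf (pu \<bind> q) x"
      by (simp add: J_def map_bind_pmf pmf.map_comp o_def)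
    also have "\<dots> = (\<Sum>i=1..k. u i * pmf (q i) x)"
      unfolding pmf_bind by (subst expectation_finite_sum[of "{1..k}"]) (use set_pu in \<open>auto simp: pmf_pu\<close>)
    also have "\<dots> = (\<Sum>i=1..k. u i *\<^sub>R fst (w i)) $ x"
      by (simp add: qW point_def vec_pmf_def)
    also have "\<dots> = fst z $ x" unfolding k(3)[symmetric] by (simp add: fst_sum)
    finally show "pmf (map_pmf fst J) x = pmf (map_pmf fst P) x" by (simp add: PX vec_pmf_def)
  qed
  obtain PU where PU: "J = map_pmf fst J \<bind> (\<lambda>x. map_pmf (Pair x) (PU x))"
    "\<And>x. set_pmf (PU x) \<subseteq> snd ` set_pmf J"
    using pmf_disintegration by metis
  have fin: "finite (set_pmf (PU x))" for x using PU(2)[of x] sndJ finite_subset by (metis finite_atLeastAtMost)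
  have "map_pmf fst P \<bind> (\<lambda>x. map_pmf (\<lambda>u. (u, x)) (PU x)) = map_pmf prod.swap J"
    by (subst PU(1)) (simp add: fstJ map_bind_pmf pmf.map_comp o_def)
  also have "\<dots> = pu \<bind> (\<lambda>u. map_pmf (Pair u) (q u))"
    by (simp add: J_def map_bind_pmf pmf.map_comp o_def)
  finally have "rates P e (joint P PU W) = (\<Sum>i\<in>set_pmf pu. pmf pu i *\<^sub>R point C e (q i) (W i))"
    by (rule rates_reverse) (rule fin)
  also have "\<dots> = (\<Sum>i=1..k. pmf pu i *\<^sub>R point C e (q i) (W i))"
    by (rule sum.mono_neutral_left) (use set_pu in \<open>auto simp: set_pmf_iff\<close>)
  also have "\<dots> = z" unfolding k(3)[symmetric] by (rule sum.cong) (auto simp: pmf_pu qW)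
  finally show ?thesis using that PU(2) sndJ by blast
qed

end
end

section \<open>Compactness of the set of tuples\<close>

definition prob_simplex :: "(real ^ 'a::finite) set" where
  "prob_simplex = {v. (\<forall>i. 0 \<le> v $ i) \<and> (\<Sum>i\<in>UNIV. v $ i) = 1}"

lemma compact_simplex: "compact (prob_simplex :: (real ^ 'a::finite) set)"
proof (rule compact_eq_bounded_closed[THEN iffD2], rule conjI)
  show "bounded (prob_simplex :: (real ^ 'a) set)"
  proof (rule boundedI)
    fix v :: "real ^ 'a" assume "v \<in> prob_simplex"
    then have "(\<Sum>i\<in>UNIV. \<bar>v $ i\<bar>) = 1" by (simp add: prob_simplex_def)
    then show "norm v \<le> 1" using norm_le_l1_cart[of v] by simp
  qed
  have "prob_simplex = (\<Inter>i. {v :: real ^ 'a. 0 \<le> v $ i}) \<inter> {v. (\<Sum>i\<in>UNIV. v $ i) = 1}"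
    by (auto simp: prob_simplex_def)
  also have "closed \<dots>"
    by (intro closed_Int closed_INT ballI closed_Collect_le closed_Collect_eq continuous_intros)
  finally show "closed (prob_simplex :: (real ^ 'a) set)" .
qed

lemma compact_simplex_family:
  "compact {w :: real ^ 'a::finite ^ 'c::finite. \<forall>y. w $ y \<in> prob_simplex}"
proof (rule compact_eq_bounded_closed[THEN iffD2], rule conjI)
  show "bounded {w :: real ^ 'a ^ 'c. \<forall>y. w $ y \<in> prob_simplex}"
  proof (rule boundedI)
    fix w :: "real ^ 'a ^ 'c" assume "w \<in> {w. \<forall>y. w $ y \<in> prob_simplex}"
    then have "norm (w $ y) \<le> 1" for y
      using norm_le_l1_cart[of "w $ y"] by (auto simp: prob_simplex_def)
    then have "(\<Sum>y\<in>UNIV. norm (w $ y)) \<le> (\<Sum>y\<in>(UNIV :: 'c set). 1)" by (intro sum_mono) auto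
    moreover have "norm w \<le> (\<Sum>y\<in>UNIV. norm (w $ y))"
      unfolding norm_vec_def by (rule L2_set_le_sum) auto
    ultimately show "norm w \<le> real CARD('c)" by simp
  qed
  have "{w :: real ^ 'a ^ 'c. \<forall>y. w $ y \<in> prob_simplex} = (\<Inter>y. (\<lambda>w. w $ y) -` prob_simplex)" by auto
  also have "closed \<dots>"
    by (intro closed_INT ballI continuous_closed_vimage compact_imp_closed compact_simplex)
       (auto intro!: continuous_intros)
  finally show "closed {w :: real ^ 'a ^ 'c. \<forall>y. w $ y \<in> prob_simplex}" .
qed

lemma simplex_imp_pmf:
  assumes "v \<in> prob_simplex"
  obtains p where "\<And>a. pmf p a = v $ a"
proof
  fix a
  show "pmf (embed_pmf (\<lambda>a. v $ a)) a = v $ a"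
    by (rule pmf_embed_pmf)
       (use assms in \<open>auto simp: prob_simplex_def nn_integral_count_space_finite sum_ennreal\<close>)
qed

context entropy_base
begin

definition \<eta> :: "real \<Rightarrow> real" where "\<eta> t = t * (- log b t)"

text \<open>Only the point 0 needs an argument: the factor \<open>t\<close> makes the value 0 there,
  and \<open>t * ln t\<close> tends to 0 from the right. Hence entropies are continuous up to the
  boundary of the simplex.\<close>

lemma continuous_on_eta: "continuous_on {0..} \<eta>"
proof -
  have "((\<lambda>t::real. t * ln t) \<longlongrightarrow> 0) (at_right 0)" by real_asymp
  then have 0: "((\<lambda>t. t * ln t) \<longlongrightarrow> 0) (at (0::real) within {0..})"
    by (simp add: at_within_Ici_at_right)
  have "continuous_on {0..} (\<lambda>t::real. t * ln t)"
    unfolding continuous_on_eq_continuous_within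
  proof
    fix t :: real assume "t \<in> {0..}"
    then consider "t = 0" | "t > 0" by fastforce
    then show "continuous (at t within {0..}) (\<lambda>t. t * ln t)"
    proof cases
      case 1
      then show ?thesis using 0 by (simp add: continuous_within)
    next
      case 2
      then show ?thesis by (auto intro!: continuous_intros)
    qed
  qed
  then have "continuous_on {0..} (\<lambda>t::real. - (t * ln t) / ln b)" 
    by (intro continuous_on_divide continuous_on_minus continuous_on_const)
       (use ln_gt_zero[OF b_gt_1] in auto)
  then show ?thesis by (simp add: \<eta>_def log_def cong: continuous_on_cong)
qed

lemma continuous_on_eta_comp:
  assumes "continuous_on S f" "\<And>x. x \<in> S \<Longrightarrow> 0 \<le> f x"
  shows "continuous_on S (\<lambda>x. \<eta> (f x))"
  by (rule continuous_on_compose2[OF continuous_on_eta assms(1)]) (use assms(2) in auto)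

lemma H_eq_sum_eta:
  fixes p :: "'a::finite pmf"
  shows "H p = (\<Sum>a\<in>UNIV. \<eta> (pmf p a))"
  unfolding H_def by (subst expectation_finite_sum[of UNIV]) (auto simp: \<eta>_def)

text \<open>In coordinates the tuple is an explicit function \<open>\<phi>\<close> of the
  probabilities in \<open>q\<close> and \<open>W\<close>, continuous on a product of simplices; the
  set is therefore a continuous image of a compact set.\<close>

lemma compact_points:
  fixes P :: "('x::finite \<times> 'y::finite) pmf" and C :: "'x \<Rightarrow> 'y pmf"
    and e :: "'x \<Rightarrow> 'y \<Rightarrow> 'h::finite \<Rightarrow> real"
  shows "compact (points C e)"
proof -
  define S :: "((real ^ 'x) \<times> (real ^ 'h ^ 'y)) set" where "S = prob_simplex \<times> {w. \<forall>y. w $ y \<in> prob_simplex}"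
  define \<phi> :: "(real ^ 'x) \<times> (real ^ 'h ^ 'y) \<Rightarrow> (real ^ 'x) \<times> real \<times> real \<times> real" where
    "\<phi> = (\<lambda>z. (fst z,
      (\<Sum>(x, y)\<in>UNIV. \<eta> (fst z $ x * pmf (C x) y)) - (\<Sum>y\<in>UNIV. \<eta> (\<Sum>x\<in>UNIV. fst z $ x * pmf (C x) y)),
      (\<Sum>(x, y)\<in>UNIV. fst z $ x * pmf (C x) y * (\<Sum>h\<in>UNIV. snd z $ y $ h * e x y h)),
      (\<Sum>y\<in>UNIV. (\<Sum>x\<in>UNIV. fst z $ x * pmf (C x) y) * (\<Sum>h\<in>UNIV. \<eta> (snd z $ y $ h)))))"
  have cont: "continuous_on S \<phi>"
    unfolding \<phi>_def split_beta'
    by (intro continuous_intros continuous_on_eta_comp)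
       (auto simp: S_def prob_simplex_def intro!: sum_nonneg mult_nonneg_nonneg)
  have pt: "point C e q W = \<phi> (vec_pmf q, \<chi> y. vec_pmf (W y))" for q W
  proof -
    define B where "B = q \<bind> (\<lambda>x. map_pmf (Pair x) (C x))"
    have B: "pmf B z = pmf q (fst z) * pmf (C (fst z)) (snd z)" for z
      using pmf_bind_Pair[of q C "fst z" "snd z"] by (simp add: B_def)
    have exB: "measure_pmf.expectation B g = (\<Sum>z\<in>UNIV. pmf q (fst z) * pmf (C (fst z)) (snd z) * g z)" for g
      by (simp add: expectation_finite_sum[of UNIV] B)
    have ex: "measure_pmf.expectation p g = (\<Sum>a\<in>UNIV. pmf p a * g a)" for p :: "'d::finite pmf" and g
      by (simp add: expectation_finite_sum[of UNIV])
    have "H B = (\<Sum>z\<in>UNIV. \<eta> (pmf q (fst z) * pmf (C (fst z)) (snd z)))"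
      by (simp add: H_eq_sum_eta B)
    then show ?thesis
      unfolding point_def B_def[symmetric] exB \<phi>_def
      by (simp add: H_eq_sum_eta pmf_bind_finite vec_pmf_def ex split_beta')
  qed
  have "points C e = \<phi> ` S"
  proof (intro equalityI subsetI)
    fix z assume "z \<in> points C e"
    then obtain q W where z: "z = point C e q W" by (auto simp: points_def)
    have "(vec_pmf q, \<chi> y. vec_pmf (W y)) \<in> S"
      by (auto simp: S_def prob_simplex_def vec_pmf_def sum_pmf_eq_1)
    then show "z \<in> \<phi> ` S" using z pt by blast
  next
    fix z assume "z \<in> \<phi> ` S"
    then obtain v w where z: "z = \<phi> (v, w)" "v \<in> prob_simplex" "\<And>y. w $ y \<in> prob_simplex" by (auto simp: S_def)
    obtain q where q: "\<And>a. pmf q a = v $ a" using simplex_imp_pmf[OF z(2)] by blast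
    have "\<forall>y. \<exists>p. \<forall>a. pmf p a = w $ y $ a" using simplex_imp_pmf[OF z(3)] by metis
    then obtain W where W: "\<And>y a. pmf (W y) a = w $ y $ a" by metis
    have "(vec_pmf q, \<chi> y. vec_pmf (W y)) = (v, w)" by (simp add: vec_pmf_def q W vec_eq_iff)
    then have "z = point C e q W" by (simp add: z pt)
    then show "z \<in> points C e" by (auto simp: points_def)
  qed
  moreover have "compact S" unfolding S_def by (intro compact_Times compact_simplex compact_simplex_family)
  ultimately show ?thesis using compact_continuous_image[OF cont] by simp
qed

end

subsection \<open>The converse\<close>

lemma map_replicate_pmf: "map_pmf (map f) (replicate_pmf n p) = replicate_pmf n (map_pmf f p)"
proof (induction n)
  case (Suc n)
  have "map_pmf (map f) (replicate_pmf (Suc n) p)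
      = p \<bind> (\<lambda>x. map_pmf ((#) (f x)) (map_pmf (map f) (replicate_pmf n p)))"
    by (simp add: map_bind_pmf pmf.map_comp o_def) (simp add: map_pmf_def bind_assoc_pmf bind_return_pmf)
  also have "\<dots> = replicate_pmf (Suc n) (map_pmf f p)"
    unfolding Suc by (simp add: bind_map_pmf) (simp add: map_pmf_def)
  finally show ?case .
qed simp

lemma finite_set_replicate_pmf:
  "finite (set_pmf p) \<Longrightarrow> finite (set_pmf (replicate_pmf n p))"
  by (rule finite_subset[OF _ finite_lists_length_eq[of "set_pmf p" n]]) (auto simp: set_replicate_pmf)

lemma list_update_nth_eqD: "ys[i := c] = ys'[i := c] \<Longrightarrow> ys ! i = ys' ! i \<Longrightarrow> ys = ys'"
  by (metis list_update_id list_update_overwrite)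

text \<open>\<open>Y\<close> without \<open>Y\<^sub>i\<close> is encoded by overwriting position
  \<open>i\<close> with a fixed letter \<open>c\<close>. Together with \<open>Y\<^sub>i\<close> this
  recovers all of \<open>Y\<close>, so \<open>(U\<^sub>i, Y\<^sub>i)\<close> carries the same
  information as the earlier source letters, \<open>W\<close> and \<open>Y\<close>.\<close>

lemma split_at_eq_iff:
  "((w, take i xs, ys[i := c]), ys ! i) = ((w', take i xs', ys'[i := c]), ys' ! i)
    \<longleftrightarrow> (take i xs, w, ys) = (take i xs', w', ys')"
  by (auto dest: list_update_nth_eqD)

lemma finite_lists_of_length: "finite {xs :: 'a::finite list. length xs = n}"
  using finite_lists_length_eq[of "UNIV :: 'a set" n] by simp

lemma take_Suc_eq_iff:
  "i < length xs \<Longrightarrow> i < length xs' \<Longrightarrow>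
    take (Suc i) xs = take (Suc i) xs' \<longleftrightarrow> take i xs = take i xs' \<and> xs ! i = xs' ! i"
  by (simp add: take_Suc_conv_app_nth)

lemma length_replicate_pmf: "xs \<in> set_pmf (replicate_pmf n p) \<Longrightarrow> length xs = n"
  by (simp add: set_replicate_pmf)

section \<open>Single-letter form of a block code\<close>

context entropy_base
begin

lemma H_replicate_pmf:
  assumes "finite (set_pmf p)"
  shows "H (replicate_pmf n p) = n * H p"
proof (induction n)
  case 0
  then show ?case by (simp add: H_def)
next
  case (Suc n)
  have "replicate_pmf (Suc n) p = map_pmf (\<lambda>(x, xs). x # xs) (p \<bind> (\<lambda>x. map_pmf (Pair x) (replicate_pmf n p)))"
    by (simp add: map_bind_pmf pmf.map_comp o_def) (simp add: map_pmf_def)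
  also have "H \<dots> = H (p \<bind> (\<lambda>x. map_pmf (Pair x) (replicate_pmf n p)))"
    by (rule H_map_inj) (auto simp: inj_on_def)
  also have "\<dots> = H p + H (replicate_pmf n p)"
    using assms by (simp add: H_bind_Pair finite_set_replicate_pmf)
  finally show ?case using Suc by (simp add: algebra_simps)
qed

lemma ent_mono:
  assumes "finite (set_pmf Q)"
  shows "ent Q C \<le> ent Q (\<lambda>\<omega>. (A \<omega>, C \<omega>))"
  unfolding ent_expectation
proof (rule expectation_mono_finite[OF assms])
  fix \<omega> assume w: "\<omega> \<in> set_pmf Q"
  have "0 < pmf (map_pmf (\<lambda>\<omega>. (A \<omega>, C \<omega>)) Q) (A \<omega>, C \<omega>)" using w by (auto intro!: pmf_positive)
  moreover have "pmf (map_pmf (\<lambda>\<omega>. (A \<omega>, C \<omega>)) Q) (A \<omega>, C \<omega>) \<le> pmf (map_pmf C Q) (C \<omega>)"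
    using sum_pmf_pair_le[of "{A \<omega>}" A C Q "C \<omega>"] by simp
  ultimately show "- log b (pmf (map_pmf C Q) (C \<omega>))
      \<le> - log b (pmf (map_pmf (\<lambda>\<omega>. (A \<omega>, C \<omega>)) Q) (A \<omega>, C \<omega>))"
    using b_gt_1 by simp
qed

lemma ent_kernel:
  assumes fin: "finite (set_pmf B)" "\<And>c. c \<in> set_pmf B \<Longrightarrow> finite (set_pmf (L (s c)))"
    and Q: "Q = B \<bind> (\<lambda>c. map_pmf (Pair c) (L (s c)))"
  shows "ent Q (\<lambda>(c, a). (a, s c)) - ent Q (\<lambda>(c, a). s c) = measure_pmf.expectation B (\<lambda>c. H (L (s c)))"
proof -
  have "ent Q (\<lambda>(c, a). (a, s c)) = ent Q (\<lambda>(c, a). (s c, a))"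
    by (rule ent_cong_inj) auto
  also have "\<dots> = H (map_pmf s B \<bind> (\<lambda>t. map_pmf (Pair t) (L t)))"
    unfolding ent_def Q by (simp add: map_bind_pmf bind_map_pmf pmf.map_comp o_def)
  also have "\<dots> = H (map_pmf s B) + measure_pmf.expectation B (\<lambda>c. H (L (s c)))"
    using fin by (subst H_bind_Pair) auto
  also have "map_pmf s B = map_pmf (\<lambda>(c, a). s c) Q"
    unfolding Q by (simp add: map_bind_pmf pmf.map_comp o_def map_pmf_const) (simp add: map_pmf_def)
  finally show ?thesis by (simp add: ent_def)
qed

text \<open>The pairs at other positions are independent of \<open>(X\<^sub>i, Y\<^sub>i)\<close>,
  so \<open>U\<^sub>i\<close> depends on this pair through \<open>X\<^sub>i\<close> only, by way of
  the encoder. The decoder in turn uses \<open>W\<close> and \<open>Y\<close>, and both can be read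
  off from \<open>U\<^sub>i\<close> and \<open>Y\<^sub>i\<close> by undoing the overwriting with
  \<open>y0\<close>. These are the two Markov conditions built into \<open>joint\<close>.\<close>

lemma code_letter_law:
  fixes P :: "('x::finite \<times> 'y::finite) pmf" and g :: "nat \<Rightarrow> 'y list \<Rightarrow> 'h::finite list pmf"
    and f :: "'x list \<Rightarrow> nat" and y0 :: 'y
  assumes i: "i < n"
  defines "PU \<equiv> \<lambda>x. replicate_pmf i P \<bind> (\<lambda>as. map_pmf (\<lambda>cs. (f (map fst as @ x # map fst cs), map fst as,
      map snd as @ y0 # map snd cs)) (replicate_pmf (n - Suc i) P))"
    and "PH \<equiv> \<lambda>(w, as, ys) y. map_pmf (\<lambda>hs. hs ! i) (g w (ys[i := y]))"
  shows "map_pmf (\<lambda>(xs, ys, hs). (xs ! i, ys ! i, (f xs, take i xs, ys[i := y0]), hs ! i)) (code_joint P n f g)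
    = joint P PU PH"
proof -
  define m where "m = n - Suc i"
  have n: "n = i + Suc m" using i by (simp add: m_def)
  have "map_pmf (\<lambda>(xs, ys, hs). (xs ! i, ys ! i, (f xs, take i xs, ys[i := y0]), hs ! i)) (code_joint P n f g)
    = replicate_pmf n P \<bind> (\<lambda>xys. map_pmf (\<lambda>h. (map fst xys ! i, map snd xys ! i,
        (f (map fst xys), take i (map fst xys), (map snd xys)[i := y0]), h))
        (map_pmf (\<lambda>hs. hs ! i) (g (f (map fst xys)) (map snd xys))))"
    by (simp add: code_joint_def map_bind_pmf pmf.map_comp o_def flip: map_pmf_def)
  also have "\<dots> = replicate_pmf i P \<bind> (\<lambda>as. P \<bind> (\<lambda>(x, y). replicate_pmf m P \<bind> (\<lambda>cs.
      map_pmf (\<lambda>h. (x, y, (f (map fst as @ x # map fst cs), map fst as, map snd as @ y0 # map snd cs), h))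
        (PH (f (map fst as @ x # map fst cs), map fst as, map snd as @ y0 # map snd cs) y))))"
    unfolding n replicate_pmf_distrib replicate_pmf.simps bind_assoc_pmf bind_return_pmf
    by (intro bind_pmf_cong refl)
       (auto simp: PH_def nth_append length_replicate_pmf list_update_append split: prod.split)
  \<comment> \<open>Drawing the letters before position \<open>i\<close> commutes with drawing the
    pair at \<open>i\<close>; this brings the source pair to the front, as in
    \<open>joint\<close>.\<close>
  also have "\<dots> = P \<bind> (\<lambda>(x, y). replicate_pmf i P \<bind> (\<lambda>as. replicate_pmf m P \<bind> (\<lambda>cs.
      map_pmf (\<lambda>h. (x, y, (f (map fst as @ x # map fst cs), map fst as, map snd as @ y0 # map snd cs), h))
        (PH (f (map fst as @ x # map fst cs), map fst as, map snd as @ y0 # map snd cs) y))))"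
    by (subst bind_commute_pmf) (simp add: split_beta')
  also have "\<dots> = joint P PU PH"
    unfolding joint_def PU_def m_def[symmetric] by (simp add: bind_assoc_pmf bind_map_pmf)
  finally show ?thesis .
qed

lemma finite_set_code_joint:
  fixes P :: "('x::finite \<times> 'y::finite) pmf" and g :: "nat \<Rightarrow> 'y list \<Rightarrow> 'h::finite list pmf"
  assumes "is_code n W f g"
  shows "finite (set_pmf (code_joint P n f g))"
    and "\<And>xs ys hs. (xs, ys, hs) \<in> set_pmf (code_joint P n f g) \<Longrightarrow> length xs = n \<and> length ys = n \<and> length hs = n \<and> f xs \<in> W"
proof -
  show *: "length xs = n \<and> length ys = n \<and> length hs = n \<and> f xs \<in> W"
    if "(xs, ys, hs) \<in> set_pmf (code_joint P n f g)" for xs ys hs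
  proof -
    from that obtain xys where xys: "xys \<in> set_pmf (replicate_pmf n P)" "xs = map fst xys" "ys = map snd xys"
       "hs \<in> set_pmf (g (f xs) ys)" by (auto simp: code_joint_def)
    then have "length xs = n" "length ys = n" by (auto dest: length_replicate_pmf)
    with xys(4) assms show ?thesis unfolding is_code_def by blast
  qed
  have "set_pmf (code_joint P n f g) \<subseteq> {xs. length xs = n} \<times> {ys. length ys = n} \<times> {hs. length hs = n}"
    using * by auto
  moreover have "finite ({xs::'x list. length xs = n} \<times> {ys::'y list. length ys = n} \<times> {hs::'h list. length hs = n})"
    by (intro finite_cartesian_product finite_lists_of_length)
  ultimately show "finite (set_pmf (code_joint P n f g))" by (rule finite_subset)
qed

lemma code_joint_source:
  fixes P :: "('x::finite \<times> 'y::finite) pmf"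
  shows "ent (code_joint P n f g) (\<lambda>(xs, ys, hs). (xs, ys)) = n * H P"
    and "ent (code_joint P n f g) (\<lambda>(xs, ys, hs). ys) = n * H (map_pmf snd P)"
proof -
  have "map_pmf (\<lambda>(xs, ys, hs). (xs, ys)) (code_joint P n f g)
     = map_pmf (\<lambda>xys. (map fst xys, map snd xys)) (replicate_pmf n P)"
    by (simp add: code_joint_def map_bind_pmf pmf.map_comp o_def map_pmf_const flip: map_pmf_def)
  moreover have "inj (\<lambda>xys :: ('x \<times> 'y) list. (map fst xys, map snd xys))"
    by (rule injI) (metis Pair_inject zip_map_fst_snd)
  ultimately show "ent (code_joint P n f g) (\<lambda>(xs, ys, hs). (xs, ys)) = n * H P"
    by (simp add: ent_def H_map_inj inj_on_subset H_replicate_pmf)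
  have "map_pmf (\<lambda>(xs, ys, hs). ys) (code_joint P n f g) = map_pmf (map snd) (replicate_pmf n P)"
    by (simp add: code_joint_def map_bind_pmf pmf.map_comp o_def map_pmf_const flip: map_pmf_def)
  then show "ent (code_joint P n f g) (\<lambda>(xs, ys, hs). ys) = n * H (map_pmf snd P)"
    by (simp add: ent_def map_replicate_pmf H_replicate_pmf)
qed

text \<open>The right-hand side does not mention \<open>s\<close>: for every statistic of
  \<open>(X, Y)\<close> that fixes the decoder's law, the conditional entropy of \<open>Xh\<close>
  is the same mean. The statistics \<open>(W, Y)\<close> and \<open>(X, Y)\<close> give
  \<open>H(Xh|W,Y) = H(Xh|X,Y)\<close>.\<close>

lemma ent_code_kernel:
  fixes P :: "('x::finite \<times> 'y::finite) pmf" and g :: "nat \<Rightarrow> 'y list \<Rightarrow> 'h::finite list pmf"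
  assumes code: "is_code n W f g"
    and s: "\<And>xs ys. g (f xs) ys = L (s xs ys)"
  shows "ent (code_joint P n f g) (\<lambda>(xs, ys, hs). (hs, s xs ys)) - ent (code_joint P n f g) (\<lambda>(xs, ys, hs). s xs ys)
     = measure_pmf.expectation (replicate_pmf n P) (\<lambda>xys. H (g (f (map fst xys)) (map snd xys)))"
proof -
  define B where "B = map_pmf (\<lambda>xys. (map fst xys, map snd xys)) (replicate_pmf n P)"
  define R where "R = B \<bind> (\<lambda>c. map_pmf (Pair c) (L ((case c of (xs, ys) \<Rightarrow> s xs ys))))"
  have cj: "code_joint P n f g = map_pmf (\<lambda>((xs, ys), hs). (xs, ys, hs)) R"
    by (simp add: code_joint_def R_def B_def map_bind_pmf bind_map_pmf pmf.map_comp o_def s flip: map_pmf_def)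
  have finB: "finite (set_pmf B)" by (simp add: B_def finite_set_replicate_pmf)
  have "ent R (\<lambda>(c, a). (a, (case c of (xs, ys) \<Rightarrow> s xs ys))) - ent R (\<lambda>(c, a). (case c of (xs, ys) \<Rightarrow> s xs ys))
     = measure_pmf.expectation B (\<lambda>c. H (L ((case c of (xs, ys) \<Rightarrow> s xs ys))))"
  proof (rule ent_kernel[where s = "\<lambda>(xs, ys). s xs ys", OF finB _ R_def])
    fix c assume c: "c \<in> set_pmf B"
    then obtain xys where xys: "xys \<in> set_pmf (replicate_pmf n P)" "c = (map fst xys, map snd xys)"
      by (auto simp: B_def)
    have "set_pmf (g (f (map fst xys)) (map snd xys)) \<subseteq> {hs. length hs = n}"
      using code length_replicate_pmf[OF xys(1)] unfolding is_code_def by auto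
    then have "finite (set_pmf (g (f (map fst xys)) (map snd xys)))"
      by (rule finite_subset) (rule finite_lists_of_length)
    then show "finite (set_pmf (L (case c of (xs, ys) \<Rightarrow> s xs ys)))" by (simp add: xys s)
  qed
  then show ?thesis
    unfolding cj ent_map_pmf by (simp add: B_def s split_beta')
qed

lemma ent_cong_inj3:
  assumes "\<And>x y z x' y' z'. (x, y, z) \<in> set_pmf Q \<Longrightarrow> (x', y', z') \<in> set_pmf Q \<Longrightarrow>
    A x y z = A x' y' z' \<longleftrightarrow> B x y z = B x' y' z'"
  shows "ent Q (\<lambda>(x, y, z). A x y z) = ent Q (\<lambda>(x, y, z). B x y z)"
  by (rule ent_cong_inj) (use assms in auto)

text \<open>The values \<open>a\<close> and \<open>h\<close> are the letter averages of
  \<open>H(X\<^sub>i|U\<^sub>i,Y\<^sub>i)\<close> and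
  \<open>H(Xh\<^sub>i|U\<^sub>i,Y\<^sub>i)\<close>, and \<open>HXY\<close> is \<open>H(X|Y)\<close>
  for one letter. Then \<open>n * (HXY - a)\<close> is exactly \<open>H(W|Y)\<close>: it is at most
  the logarithm of the number of messages, and it is also what the helper's message contributes to
  the equivocation.\<close>

lemma code_point:
  fixes P :: "('x::finite \<times> 'y::finite) pmf" and g :: "nat \<Rightarrow> 'y list \<Rightarrow> 'h::finite list pmf"
    and e :: "'x \<Rightarrow> 'y \<Rightarrow> 'h \<Rightarrow> real"
  assumes P_eq: "P = map_pmf fst P \<bind> (\<lambda>x. map_pmf (Pair x) (C x))"
    and code: "is_code n W f g" and n: "n > 0"
  defines "Q \<equiv> code_joint P n f g" and "HXY \<equiv> H P - H (map_pmf snd P)"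
  obtains a c h where "(vec_pmf (map_pmf fst P), a, c, h) \<in> convex hull (points C e)"
    "n * (HXY - a) \<le> log b (card W)"
    "c = measure_pmf.expectation Q (\<lambda>(xs, ys, hs). (1 / real n) * (\<Sum>i<n. e (xs ! i) (ys ! i) (hs ! i)))"
    "ent Q (\<lambda>(xs, ys, hs). (hs, ys)) - ent Q (\<lambda>(xs, ys, hs). ys) \<le> n * (h + HXY - a)"
proof -
  fix y0 :: 'y
  note finQ = finite_set_code_joint(1)[OF code, of P, folded Q_def]
  note lenQ = finite_set_code_joint(2)[OF code, of _ _ _ P, folded Q_def]
  define r where "r i = rates P e (map_pmf (\<lambda>(xs, ys, hs). (xs ! i, ys ! i, (f xs, take i xs, ys[i := y0]), hs ! i)) Q)" for i
  define z where "z = (\<Sum>i<n. (1 / real n) *\<^sub>R r i)"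
  have r: "r i \<in> convex hull (points C e)" if "i < n" for i
    unfolding r_def Q_def code_letter_law[OF that]
    by (rule rates_in_hull[OF P_eq]) (simp add: finite_set_replicate_pmf)
  have z: "z \<in> convex hull (points C e)"
    unfolding z_def by (rule convex_sum[OF _ convex_convex_hull]) (use n r in auto)
  \<comment> \<open>\<open>c0 i\<close> is the joint entropy of the first \<open>i\<close> source
    letters, \<open>W\<close> and \<open>Y\<close>. Its increments are the terms
    \<open>H(X\<^sub>i|U\<^sub>i,Y\<^sub>i)\<close>, so their sum telescopes from
    \<open>H(W,Y)\<close> to \<open>H(X,Y)\<close>.\<close>
  define c0 where "c0 = (\<lambda>i. ent Q (\<lambda>(xs, ys, hs). (take i xs, f xs, ys)))"
  have UY: "ent Q (\<lambda>(xs, ys, hs). ((f xs, take i xs, ys[i := y0]), ys ! i)) = c0 i" if "i < n" for i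
    unfolding c0_def by (rule ent_cong_inj3) (rule split_at_eq_iff)
  have XUY: "ent Q (\<lambda>(xs, ys, hs). (xs ! i, (f xs, take i xs, ys[i := y0]), ys ! i)) = c0 (Suc i)" if "i < n" for i
    unfolding c0_def
  proof (rule ent_cong_inj3)
    fix xs ys hs xs' ys' hs'
    assume "(xs, ys, hs) \<in> set_pmf Q" "(xs', ys', hs') \<in> set_pmf Q"
    with that have "i < length xs" "i < length xs'" by (auto dest!: lenQ)
    from take_Suc_eq_iff[OF this] split_at_eq_iff[of "f xs" i xs ys y0 "f xs'" xs' ys']
    show "(xs ! i, (f xs, take i xs, ys[i := y0]), ys ! i) = (xs' ! i, (f xs', take i xs', ys'[i := y0]), ys' ! i)
      \<longleftrightarrow> (take (Suc i) xs, f xs, ys) = (take (Suc i) xs', f xs', ys')" by blast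
  qed
  have wy: "c0 n = n * H P"
  proof -
    have "c0 n = ent Q (\<lambda>(xs, ys, hs). (xs, ys))"
      unfolding c0_def by (rule ent_cong_inj3) (drule lenQ, drule lenQ, force)
    then show ?thesis by (simp add: Q_def code_joint_source)
  qed
  have z_eq: "z = (vec_pmf (map_pmf fst P), (\<Sum>i<n. (c0 (Suc i) - c0 i) / n),
     (\<Sum>i<n. measure_pmf.expectation Q (\<lambda>(xs, ys, hs). e (xs ! i) (ys ! i) (hs ! i)) / n),
     (\<Sum>i<n. (ent Q (\<lambda>(xs, ys, hs). (hs ! i, (f xs, take i xs, ys[i := y0]), ys ! i)) - c0 i) / n))"
  proof -
    have "r i = (vec_pmf (map_pmf fst P), c0 (Suc i) - c0 i,
       measure_pmf.expectation Q (\<lambda>(xs, ys, hs). e (xs ! i) (ys ! i) (hs ! i)),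
       ent Q (\<lambda>(xs, ys, hs). (hs ! i, (f xs, take i xs, ys[i := y0]), ys ! i)) - c0 i)" if "i < n" for i
      using UY[OF that] XUY[OF that] unfolding r_def rates_def ent_map_pmf integral_map_pmf
      by (simp add: split_beta')
    then show ?thesis using n unfolding z_def
      by (simp add: prod_eq_iff fst_sum snd_sum sum_constant_scaleR del: sum_constant)
  qed
  define a where "a = (\<Sum>i<n. (c0 (Suc i) - c0 i) / n)"
  have na: "n * a = n * H P - c0 0"
    using n by (simp add: a_def sum_divide_distrib[symmetric] sum_lessThan_telescope wy)
  have nHXY: "n * HXY = n * H P - ent Q (\<lambda>(xs, ys, hs). ys)"
    by (simp add: HXY_def Q_def code_joint_source right_diff_distrib)
  have c00: "c0 0 = ent Q (\<lambda>(xs, ys, hs). (f xs, ys))"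
    unfolding c0_def by (rule ent_cong_inj) auto
  have 1: "n * (HXY - a) = ent Q (\<lambda>(xs, ys, hs). (f xs, ys)) - ent Q (\<lambda>(xs, ys, hs). ys)"
    using na nHXY c00 by (simp add: right_diff_distrib)
  also have "\<dots> \<le> log b (card W)"
  proof -
    have "(\<lambda>(xs, ys, hs). f xs) ` set_pmf Q \<subseteq> W"
    proof (rule image_subsetI)
      fix \<omega> assume "\<omega> \<in> set_pmf Q"
      then show "(case \<omega> of (xs, ys, hs) \<Rightarrow> f xs) \<in> W"
        using lenQ by (cases \<omega>) simp
    qed
    then show ?thesis
      using ent_cond_le_log_card[OF finQ, of W "\<lambda>(xs, ys, hs). f xs" "\<lambda>(xs, ys, hs). ys"] code
      by (simp add: is_code_def split_beta')
  qed
  finally have rate: "n * (HXY - a) \<le> log b (card W)" .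
  define h where "h = (\<Sum>i<n. (ent Q (\<lambda>(xs, ys, hs). (hs ! i, (f xs, take i xs, ys[i := y0]), ys ! i)) - c0 i) / n)"
  \<comment> \<open>Adding \<open>W\<close> can only increase the entropy; afterwards
    \<open>H(Xh|W,Y)\<close> is exchanged for \<open>H(Xh|X,Y)\<close>, which leaves the term
    \<open>c0 0 = H(W,Y)\<close>.\<close>
  have "ent Q (\<lambda>(xs, ys, hs). (hs, ys)) \<le> ent Q (\<lambda>(xs, ys, hs). (f xs, hs, ys))"
    using ent_mono[OF finQ, of "\<lambda>(xs, ys, hs). (hs, ys)" "\<lambda>(xs, ys, hs). f xs"] by (simp add: split_beta')
  also have "\<dots> = ent Q (\<lambda>(xs, ys, hs). (hs, f xs, ys))"
    by (rule ent_cong_inj) auto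
  also have "\<dots> = ent Q (\<lambda>(xs, ys, hs). (hs, xs, ys)) - ent Q (\<lambda>(xs, ys, hs). (xs, ys)) + c0 0"
    using ent_code_kernel[OF code, of "\<lambda>(w, ys). g w ys" "\<lambda>xs ys. (f xs, ys)" P]
      ent_code_kernel[OF code, of "\<lambda>(xs, ys). g (f xs) ys" "\<lambda>xs ys. (xs, ys)" P]
    by (simp add: c00 Q_def)
  also have "ent Q (\<lambda>(xs, ys, hs). (hs, xs, ys)) - ent Q (\<lambda>(xs, ys, hs). (xs, ys)) \<le> n * h"
  proof -
    \<comment> \<open>\<open>k\<close> expands \<open>H(Xh|X,Y)\<close> letter by letter. In each
      increment functions of \<open>X\<close> are inserted for free, then the earlier letters of
      \<open>Xh\<close> and the full \<open>X\<close> are discarded; what remains as condition is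
      the information in \<open>(U\<^sub>i, Y\<^sub>i)\<close>.\<close>
    define k where "k i = ent Q (\<lambda>(xs, ys, hs). (take i hs, xs, ys))" for i
    have "ent Q (\<lambda>(xs, ys, hs). (hs, xs, ys)) = k n"
      unfolding k_def by (rule ent_cong_inj3) (drule lenQ, drule lenQ, force)
    moreover have "ent Q (\<lambda>(xs, ys, hs). (xs, ys)) = k 0"
      unfolding k_def by (rule ent_cong_inj) auto
    ultimately have "ent Q (\<lambda>(xs, ys, hs). (hs, xs, ys)) - ent Q (\<lambda>(xs, ys, hs). (xs, ys)) = (\<Sum>i<n. k (Suc i) - k i)"
      by (simp add: sum_lessThan_telescope)
    also have "\<dots> \<le> (\<Sum>i<n. ent Q (\<lambda>(xs, ys, hs). (hs ! i, (f xs, take i xs, ys[i := y0]), ys ! i)) - c0 i)"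
    proof (rule sum_mono)
      fix i assume i: "i \<in> {..<n}"
      have "k (Suc i) = ent Q (\<lambda>(xs, ys, hs). (hs ! i, (take i xs, f xs, ys), (take i hs, xs)))"
        unfolding k_def
      proof (rule ent_cong_inj3)
        fix xs ys hs xs' ys' hs'
        assume "(xs, ys, hs) \<in> set_pmf Q" "(xs', ys', hs') \<in> set_pmf Q"
        with i have "i < length hs" "i < length hs'" by (auto dest!: lenQ)
        from take_Suc_eq_iff[OF this]
        show "(take (Suc i) hs, xs, ys) = (take (Suc i) hs', xs', ys') \<longleftrightarrow>
          (hs ! i, (take i xs, f xs, ys), take i hs, xs) = (hs' ! i, (take i xs', f xs', ys'), take i hs', xs')" by auto
      qed
      moreover have "k i = ent Q (\<lambda>(xs, ys, hs). ((take i xs, f xs, ys), (take i hs, xs)))"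
        unfolding k_def by (rule ent_cong_inj) auto
      moreover have "ent Q (\<lambda>(xs, ys, hs). (hs ! i, (f xs, take i xs, ys[i := y0]), ys ! i))
         = ent Q (\<lambda>(xs, ys, hs). (hs ! i, (take i xs, f xs, ys)))"
      proof (rule ent_cong_inj3)
        fix xs ys hs xs' ys' hs'
        show "(hs ! i, (f xs, take i xs, ys[i := y0]), ys ! i) = (hs' ! i, (f xs', take i xs', ys'[i := y0]), ys' ! i)
          \<longleftrightarrow> (hs ! i, (take i xs, f xs, ys)) = (hs' ! i, (take i xs', f xs', ys'))"
          using split_at_eq_iff[of "f xs" i xs ys y0 "f xs'" xs' ys'] by simp
      qed
      ultimately show "k (Suc i) - k i \<le> ent Q (\<lambda>(xs, ys, hs). (hs ! i, (f xs, take i xs, ys[i := y0]), ys ! i)) - c0 i"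
        using ent_submodular[OF finQ, of "\<lambda>(xs, ys, hs). hs ! i" "\<lambda>(xs, ys, hs). (take i xs, f xs, ys)"
          "\<lambda>(xs, ys, hs). (take i hs, xs)"]
        by (simp add: c0_def split_beta')
    qed
    also have "\<dots> = n * h" using n by (simp add: h_def sum_divide_distrib[symmetric])
    finally show ?thesis .
  qed
  finally have "ent Q (\<lambda>(xs, ys, hs). (hs, ys)) - ent Q (\<lambda>(xs, ys, hs). ys) \<le> n * h + n * (HXY - a)"
    using 1 c00 by simp
  then have equiv: "ent Q (\<lambda>(xs, ys, hs). (hs, ys)) - ent Q (\<lambda>(xs, ys, hs). ys) \<le> n * (h + HXY - a)"
    by (simp add: algebra_simps)
  have dist: "(\<Sum>i<n. measure_pmf.expectation Q (\<lambda>(xs, ys, hs). e (xs ! i) (ys ! i) (hs ! i)) / n)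
     = measure_pmf.expectation Q (\<lambda>(xs, ys, hs). (1 / real n) * (\<Sum>i<n. e (xs ! i) (ys ! i) (hs ! i)))"
    using finQ by (simp add: split_beta' Bochner_Integration.integral_sum sum_divide_distrib[symmetric])
  show ?thesis
    by (rule that[OF _ rate dist equiv]) (use z z_eq in \<open>simp add: a_def h_def dist\<close>)
qed

text \<open>Relaxing the constraints by \<open>1 / (k + 1)\<close> gives nested nonempty compact
  subsets of the hull, and a point in all of them satisfies the constraints without slack. The hull
  is compact because the dimension is finite and the set of points is compact.\<close>

lemma hull_closed_limit:
  fixes P :: "('x::finite \<times> 'y::finite) pmf" and C :: "'x \<Rightarrow> 'y pmf"
    and e :: "'x \<Rightarrow> 'y \<Rightarrow> 'h::finite \<Rightarrow> real"
  assumes "\<And>\<delta>. \<delta> > 0 \<Longrightarrow> \<exists>a c h. (v, a, c, h) \<in> convex hull (points C e) \<and>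
     K - a \<le> R + \<delta> \<and> c \<le> D + \<delta> \<and> \<Delta> - \<delta> \<le> h + K - a"
  obtains a c h where "(v, a, c, h) \<in> convex hull (points C e)" "K - a \<le> R" "c \<le> D" "\<Delta> \<le> h + K - a"
proof -
  define S where "S k = convex hull (points C e) \<inter>
    {z. fst z = v \<and> K - fst (snd z) \<le> R + 1 / real (Suc k) \<and> fst (snd (snd z)) \<le> D + 1 / real (Suc k)
      \<and> \<Delta> - 1 / real (Suc k) \<le> snd (snd (snd z)) + K - fst (snd z)}" for k
  have "S k \<noteq> {}" for k
    using assms[of "1 / real (Suc k)"] by (force simp: S_def)
  moreover have "compact (S k)" for k
    unfolding S_def
    by (intro compact_Int_closed compact_convex_hull compact_points)
       (auto intro!: closed_Collect_conj closed_Collect_eq closed_Collect_le continuous_intros)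
  moreover have "S l \<subseteq> S k" if "k \<le> l" for k l
  proof -
    have "1 / real (Suc l) \<le> 1 / real (Suc k)" using that by (simp add: frac_le)
    then show ?thesis by (auto simp: S_def)
  qed
  ultimately have "\<Inter>(range S) \<noteq> {}"
    by (intro compact_nest) auto
  then obtain z where z: "\<And>k. z \<in> S k" by blast
  obtain a c h where zz: "z = (v, a, c, h)" using z[of 0] by (cases z) (auto simp: S_def)
  have lim: "(\<lambda>k. 1 / real (Suc k)) \<longlonglongrightarrow> 0" by (rule LIMSEQ_Suc[OF lim_1_over_n])
  have "K - a \<le> R"
    using LIMSEQ_le_const[OF tendsto_add[OF tendsto_const[of R] lim], of "K - a"] z by (auto simp: S_def zz)
  moreover have "c \<le> D"
    using LIMSEQ_le_const[OF tendsto_add[OF tendsto_const[of D] lim], of c] z by (auto simp: S_def zz)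
  moreover have "\<Delta> \<le> h + K - a"
    using LIMSEQ_le_const[OF tendsto_add[OF tendsto_const[of "h + K - a"] lim], of \<Delta>] z
    by (auto simp: S_def zz algebra_simps)
  ultimately show ?thesis using that z[of 0] by (simp add: S_def zz)
qed

lemma ent_joint_source:
  "ent (joint P PU PH) (\<lambda>(x, y, u, h). (x, y)) = H P"
  "ent (joint P PU PH) (\<lambda>(x, y, u, h). y) = H (map_pmf snd P)"
proof -
  have *: "map_pmf (\<lambda>(x, y, u, h). (x, y)) (joint P PU PH) = P"
    by (simp add: joint_def map_bind_pmf pmf.map_comp o_def split_beta' map_pmf_const bind_return_pmf')
  show "ent (joint P PU PH) (\<lambda>(x, y, u, h). (x, y)) = H P" by (simp add: ent_def *)
  have "map_pmf (\<lambda>(x, y, u, h). y) (joint P PU PH) = map_pmf snd (map_pmf (\<lambda>(x, y, u, h). (x, y)) (joint P PU PH))"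
    by (simp add: pmf.map_comp o_def split_beta')
  then show "ent (joint P PU PH) (\<lambda>(x, y, u, h). y) = H (map_pmf snd P)" by (simp add: ent_def *)
qed

section \<open>The outer bound\<close>

theorem R_help_subset_R_out:
  fixes P :: "('x::finite \<times> 'y::finite) pmf"
    and F :: "'x \<Rightarrow> 'y \<Rightarrow> 'f"
    and d :: "'f \<Rightarrow> 'h::finite \<Rightarrow> real"
  shows "R_help b P F d \<subseteq> R_out b P F d"
proof
  fix t assume t: "t \<in> R_help b P F d"
  obtain R D \<Delta> where tt: "t = (R, D, \<Delta>)" by (cases t) auto
  from t have nn: "0 \<le> R" "0 \<le> D" "0 \<le> \<Delta>" and ach: "achievable b P F d R D \<Delta>"
    by (auto simp: tt R_help_def)
  obtain C where C: "P = map_pmf fst P \<bind> (\<lambda>x. map_pmf (Pair x) (C x))"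
    using pmf_disintegration by metis
  define e where "e = (\<lambda>x y. d (F x y))"
  define K where "K = H P - H (map_pmf snd P)"
  have "\<exists>a c h. (vec_pmf (map_pmf fst P), a, c, h) \<in> convex hull (points C e) \<and>
     K - a \<le> R + \<delta> \<and> c \<le> D + \<delta> \<and> \<Delta> - \<delta> \<le> h + K - a" if "\<delta> > 0" for \<delta>
  proof -
    from ach that obtain N where N: "\<And>n. n \<ge> N \<Longrightarrow> \<exists>W f g.
        is_code n W f g \<and>
        (1 / real n) * log b (real (card W)) \<le> R + \<delta> \<and>
        measure_pmf.expectation (code_joint P n f g)
          (\<lambda>(xs, ys, hs). block_distortion F d n xs ys hs) \<le> D + \<delta> \<and>
        (1 / real n) * cond_entropy b (code_joint P n f g)
          (\<lambda>(xs, ys, hs). hs) (\<lambda>(xs, ys, hs). ys) \<ge> \<Delta> - \<delta>"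
      unfolding achievable_def eventually_sequentially by blast
    \<comment> \<open>A single block length per \<open>\<delta>\<close> is enough;
      \<open>Suc N\<close> lies beyond the threshold and is not 0.\<close>
    define n where "n = Suc N"
    have n: "n > 0" by (simp add: n_def)
    from N[of n] obtain W f g where code: "is_code n W f g"
      and 1: "(1 / real n) * log b (real (card W)) \<le> R + \<delta>"
      and 2: "measure_pmf.expectation (code_joint P n f g)
          (\<lambda>(xs, ys, hs). block_distortion F d n xs ys hs) \<le> D + \<delta>"
      and 3: "(1 / real n) * cond_entropy b (code_joint P n f g)
          (\<lambda>(xs, ys, hs). hs) (\<lambda>(xs, ys, hs). ys) \<ge> \<Delta> - \<delta>"
      by (auto simp: n_def)
    from code_point[OF C code n, of e] obtain a c h where
      z: "(vec_pmf (map_pmf fst P), a, c, h) \<in> convex hull (points C e)"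
      and a: "n * (K - a) \<le> log b (card W)"
      and c: "c = measure_pmf.expectation (code_joint P n f g)
         (\<lambda>(xs, ys, hs). (1 / real n) * (\<Sum>i<n. e (xs ! i) (ys ! i) (hs ! i)))"
      and h: "ent (code_joint P n f g) (\<lambda>(xs, ys, hs). (hs, ys)) - ent (code_joint P n f g) (\<lambda>(xs, ys, hs). ys)
         \<le> n * (h + K - a)"
      unfolding K_def by blast
    have "cond_entropy b (code_joint P n f g) (\<lambda>(xs, ys, hs). hs) (\<lambda>(xs, ys, hs). ys) \<le> n * (h + K - a)"
      using h by (simp add: cond_entropy_eq_ent[OF finite_set_code_joint(1)[OF code]] split_beta')
    then have "(1 / real n) * cond_entropy b (code_joint P n f g) (\<lambda>(xs, ys, hs). hs) (\<lambda>(xs, ys, hs). ys) \<le> h + K - a"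
      using n by (simp add: field_simps)
    moreover have "K - a \<le> (1 / real n) * log b (real (card W))" using a n by (simp add: field_simps)
    moreover have "c \<le> D + \<delta>" using 2 c by (simp add: block_distortion_def e_def)
    ultimately show ?thesis using z 1 3 by force
  qed
  from hull_closed_limit[OF this] obtain a c h where
    z: "(vec_pmf (map_pmf fst P), a, c, h) \<in> convex hull (points C e)" and ach: "K - a \<le> R" "c \<le> D" "\<Delta> \<le> h + K - a"
    by blast
  obtain k :: nat and PU PH where PU: "\<And>x. set_pmf (PU x) \<subseteq> {1..k}"
    and rt: "rates P e (joint P PU PH) = (vec_pmf (map_pmf fst P), a, c, h)"
    by (rule hull_imp_rates[OF C z]) (simp, blast)
  define Q where "Q = joint P PU PH"
  \<comment> \<open>The kernel returns \<open>u\<close> as its \<open>v\<close> component as well: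
    this is the choice \<open>V = U\<close>.\<close>
  define Q' where "Q' = joint_out P PU (\<lambda>u y. map_pmf (Pair u) (PH u y))"
  have Q': "Q' = map_pmf (\<lambda>(x, y, u, h). (x, y, u, u, h)) Q"
    unfolding Q'_def Q_def by (rule joint_out_copy)
  have finPU: "finite (set_pmf (PU x))" for x using PU[of x] finite_subset by blast
  have finQ: "finite (set_pmf Q)" unfolding Q_def by (rule finite_set_joint[OF finPU])
  then have finQ': "finite (set_pmf Q')" by (simp add: Q')
  have rt: "ent Q (\<lambda>(x, y, u, h). (x, u, y)) - ent Q (\<lambda>(x, y, u, h). (u, y)) = a"
    "measure_pmf.expectation Q (\<lambda>(x, y, u, h). e x y h) = c"
    "ent Q (\<lambda>(x, y, u, h). (h, u, y)) - ent Q (\<lambda>(x, y, u, h). (u, y)) = h"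
    using rt by (simp_all add: rates_def Q_def)
  note src = ent_joint_source[of P PU PH, folded Q_def]
  note kern = ent_joint_H[where P = P and PU = PU and PH = PH, OF finPU, folded Q_def]
  have "cond_mutual_info b Q' (\<lambda>(x, y, u, v, h). x) (\<lambda>(x, y, u, v, h). u) (\<lambda>(x, y, u, v, h). y) = K - a"
    using src rt(1)
    by (subst cond_mutual_info_eq_ent[OF finQ']) (simp add: Q' ent_map_pmf split_beta' K_def)
  moreover have "measure_pmf.expectation Q' (\<lambda>\<omega>. d (F ((\<lambda>(x, y, u, v, h). x) \<omega>) ((\<lambda>(x, y, u, v, h). y) \<omega>))
      ((\<lambda>(x, y, u, v, h). h) \<omega>)) = c"
    unfolding Q' using rt(2) by (simp add: e_def split_beta')
  moreover have "cond_entropy b Q' (\<lambda>(x, y, u, v, h). h)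
      (\<lambda>\<omega>. ((\<lambda>(x, y, u, v, h). u) \<omega>, (\<lambda>(x, y, u, v, h). y) \<omega>)) = h"
    using rt(3) by (subst cond_entropy_eq_ent[OF finQ']) (simp add: Q' ent_map_pmf split_beta')
  \<comment> \<open>\<open>I(X;U,Xh|Y)\<close> collapses to \<open>I(X;U|Y)\<close>, since given
    \<open>(U, Y)\<close> the letter \<open>Xh\<close> tells nothing more about
    \<open>X\<close>.\<close>
  moreover have "cond_mutual_info b Q' (\<lambda>(x, y, u, v, h). x)
      (\<lambda>\<omega>. ((\<lambda>(x, y, u, v, h). v) \<omega>, (\<lambda>(x, y, u, v, h). h) \<omega>)) (\<lambda>(x, y, u, v, h). y) = K - a"
  proof -
    have "ent Q (\<lambda>(x, y, u, h). ((u, h), y)) = ent Q (\<lambda>(x, y, u, h). (h, u, y))"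
      by (rule ent_cong_inj) auto
    moreover have "ent Q (\<lambda>(x, y, u, h). (x, (u, h), y)) = ent Q (\<lambda>(x, y, u, h). (x, u, h, y))"
      by (rule ent_cong_inj) auto
    ultimately show ?thesis
      using src rt(1) kern
      by (subst cond_mutual_info_eq_ent[OF finQ']) (simp add: Q' ent_map_pmf split_beta' K_def)
  qed
  ultimately have main: "let X = (\<lambda>(x, y, u, v, h). x);
               Y = (\<lambda>(x, y, u, v, h). y);
               U = (\<lambda>(x, y, u, v, h). u);
               V = (\<lambda>(x, y, u, v, h). v);
               H = (\<lambda>(x, y, u, v, h). h)
           in R \<ge> cond_mutual_info b Q' X U Y \<and>
              D \<ge> measure_pmf.expectation Q' (\<lambda>\<omega>. d (F (X \<omega>) (Y \<omega>)) (H \<omega>)) \<and>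
              \<Delta> \<le> cond_entropy b Q' H (\<lambda>\<omega>. (U \<omega>, Y \<omega>))
                   + cond_mutual_info b Q' X (\<lambda>\<omega>. (V \<omega>, H \<omega>)) Y"
    using ach by (simp add: Let_def)
  have "\<exists>\<U> \<V> PU PVH.
          finite \<U> \<and> finite \<V> \<and> (\<forall>x. set_pmf (PU x) \<subseteq> \<U>) \<and>
          (\<forall>u\<in>\<U>. \<forall>y. set_pmf (PVH u y) \<subseteq> \<V> \<times> UNIV) \<and>
          (let Q = joint_out P PU PVH;
               X = (\<lambda>(x, y, u, v, h). x);
               Y = (\<lambda>(x, y, u, v, h). y);
               U = (\<lambda>(x, y, u, v, h). u);
               V = (\<lambda>(x, y, u, v, h). v);
               H = (\<lambda>(x, y, u, v, h). h)
           in R \<ge> cond_mutual_info b Q X U Y \<and>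
              D \<ge> measure_pmf.expectation Q (\<lambda>\<omega>. d (F (X \<omega>) (Y \<omega>)) (H \<omega>)) \<and>
              \<Delta> \<le> cond_entropy b Q H (\<lambda>\<omega>. (U \<omega>, Y \<omega>))
                   + cond_mutual_info b Q X (\<lambda>\<omega>. (V \<omega>, H \<omega>)) Y)"
  proof (intro exI conjI)
    show "finite {1..k}" "finite {1..k}" by auto
    show "\<forall>x. set_pmf (PU x) \<subseteq> {1..k}" using PU by blast
    show "\<forall>u\<in>{1..k}. \<forall>y. set_pmf (map_pmf (Pair u) (PH u y)) \<subseteq> {1..k} \<times> UNIV" by auto
  qed (use main in \<open>simp only: Q'_def Let_def\<close>)
  then show "t \<in> R_out b P F d"
    unfolding R_out_def tt using nn by blast
qed

end

subsection \<open>Random binning\<close>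

lemma prob_eq_expectation:
  "measure_pmf.prob p {x. Q x} = measure_pmf.expectation p (\<lambda>x. of_bool (Q x))"
proof -
  have "(\<lambda>x. of_bool (Q x) :: real) = indicator {x. Q x}" by (auto simp: indicator_def)
  then show ?thesis by simp
qed

lemma prob_Compl: "measure_pmf.prob p (- A) = 1 - measure_pmf.prob p A"
  using measure_pmf.prob_compl[of A p] by (simp add: Compl_eq_Diff_UNIV)

lemma prob_not: "measure_pmf.prob p {x. \<not> Q x} = 1 - measure_pmf.prob p {x. Q x}"
  using prob_Compl[of p "{x. Q x}"] by (simp only: Collect_neg_eq)

lemma expectation_add_finite:
  fixes g h :: "'a \<Rightarrow> real"
  assumes "finite (set_pmf p)"
  shows "measure_pmf.expectation p (\<lambda>x. g x + h x) = measure_pmf.expectation p g + measure_pmf.expectation p h"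
  using assms by simp

lemma expectation_swap_finite:
  fixes h :: "'a \<Rightarrow> 'b \<Rightarrow> real"
  assumes "finite (set_pmf p)" "finite (set_pmf q)"
  shows "measure_pmf.expectation p (\<lambda>x. measure_pmf.expectation q (h x))
    = measure_pmf.expectation q (\<lambda>y. measure_pmf.expectation p (\<lambda>x. h x y))"
  using assms
  by (simp add: expectation_finite_sum[where p = p, OF _ order_refl]
      expectation_finite_sum[where p = q, OF _ order_refl] sum_distrib_left sum.swap[of _ "set_pmf p"] mult.left_commute)

lemma exists_le_expectation:
  fixes h :: "'a \<Rightarrow> real"
  assumes fin: "finite (set_pmf p)" and le: "measure_pmf.expectation p h \<le> t"
  shows "\<exists>x\<in>set_pmf p. h x \<le> t"
proof (rule ccontr)
  assume "\<not> ?thesis"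
  then have less: "t < h x" if "x \<in> set_pmf p" for x using that by force
  have "t = (\<Sum>x\<in>set_pmf p. pmf p x * t)"
    using sum_pmf_eq_1[OF fin order_refl] by (simp flip: sum_distrib_right)
  also have "\<dots> < (\<Sum>x\<in>set_pmf p. pmf p x * h x)"
    by (rule sum_strict_mono) (use fin less set_pmf_not_empty[of p] in \<open>auto simp: pmf_positive_iff\<close>)
  also have "\<dots> \<le> t" using le fin by (simp add: expectation_finite_sum)
  finally show False by simp
qed

lemma prob_Pi_pmf_eq:
  fixes i j M K :: nat
  assumes "i < M" "j < M" "i \<noteq> j" "K > 0"
  shows "measure_pmf.prob (Pi_pmf {..<M} d (\<lambda>_. pmf_of_set {..<K})) {B. B i = B j} = 1 / K"
proof -
  let ?PB = "Pi_pmf {..<M} d (\<lambda>_. pmf_of_set {..<K})"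
  define S where "S w = Pi {..<M} (\<lambda>k. if k = i \<or> k = j then {w} else UNIV)" for w :: nat
  have S: "S w = {B. B i = w \<and> B j = w}" for w
  proof (intro set_eqI iffI)
    fix B assume "B \<in> S w"
    then have "B i \<in> (if i = i \<or> i = j then {w} else UNIV)" "B j \<in> (if j = i \<or> j = j then {w} else UNIV)"
      unfolding S_def using assms by (blast intro: Pi_mem)+
    then show "B \<in> {B. B i = w \<and> B j = w}" by simp
  next
    fix B assume "B \<in> {B. B i = w \<and> B j = w}"
    then show "B \<in> S w" unfolding S_def by (intro Pi_I) auto
  qed
  have "measure_pmf.prob ?PB {B. B i = B j} = measure_pmf.prob ?PB (\<Union>w\<in>{..<K}. S w)"
  proof (rule measure_pmf.finite_measure_eq_AE)
    have "B i < K" if "B \<in> set_pmf ?PB" for B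
    proof -
      have "B \<in> PiE_dflt {..<M} d (set_pmf \<circ> (\<lambda>_. pmf_of_set {..<K}))"
        using that set_Pi_pmf_subset'[OF finite_lessThan, of M d "\<lambda>_. pmf_of_set {..<K}"] by blast
      then have "B i \<in> set_pmf (pmf_of_set {..<K})" using assms by (simp add: PiE_dflt_def)
      moreover have "{..<K} \<noteq> {}" using assms by auto
      ultimately show ?thesis by simp
    qed
    then show "AE B in ?PB. (B \<in> {B. B i = B j}) = (B \<in> (\<Union>w\<in>{..<K}. S w))"
      unfolding S AE_measure_pmf_iff by auto
  qed auto
  also have "\<dots> = (\<Sum>w<K. measure_pmf.prob ?PB (S w))"
    by (rule measure_pmf.finite_measure_finite_Union) (auto simp: disjoint_family_on_def S)
  also have "\<dots> = (\<Sum>w<K. (1 / K) ^ 2)"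
  proof (rule sum.cong[OF refl])
    fix w assume w: "w \<in> {..<K}"
    have "measure_pmf.prob ?PB (S w)
      = (\<Prod>k<M. measure_pmf.prob (pmf_of_set {..<K}) (if k = i \<or> k = j then {w} else UNIV))"
      unfolding S_def
      using measure_Pi_pmf_Pi[of "{..<M}" d "\<lambda>_. pmf_of_set {..<K}" "\<lambda>k. if k = i \<or> k = j then {w} else UNIV"]
      by simp
    also have "\<dots> = (\<Prod>k<M. if k \<in> {i, j} then 1 / K else 1)"
    proof -
      have "{..<K} \<noteq> {}" using w by auto
      then have "pmf (pmf_of_set {..<K}) w = 1 / K" using w by simp
      then show ?thesis by (intro prod.cong) (auto simp: measure_pmf_single)
    qed
    also have "\<dots> = (1 / K) ^ 2"
    proof -
      have "{..<M} \<inter> {k. k \<in> {i, j}} = {i, j}" using assms by auto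
      then show ?thesis using assms by (simp add: prod.If_cases power2_eq_square)
    qed
    finally show "measure_pmf.prob ?PB (S w) = (1 / K) ^ 2" .
  qed
  also have "\<dots> = 1 / K" using assms by (simp add: power2_eq_square)
  finally show ?thesis .
qed

text \<open>In the application \<open>t\<close> is the probability of the admissible codewords under
  \<open>P(u|x)\<close>, \<open>a\<close> their probability under the codebook law, and
  \<open>\<alpha>\<close> bounds the ratio of the two laws. \<open>M\<close> draws all miss with
  probability at most \<open>exp (- (M / \<alpha>) * t)\<close>, and the chord of the convex
  \<open>exp\<close> splits this into the probability \<open>1 - t\<close> of an inadmissible
  \<open>u\<close> and a small remainder.\<close>

lemma power_covering_bound:
  fixes a t \<alpha> :: real
  assumes "0 \<le> t" "t \<le> 1" "t \<le> \<alpha> * a" "a \<le> 1" "0 < \<alpha>"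
  shows "(1 - a) ^ M \<le> 1 - t + exp (- (M / \<alpha>))"
proof -
  have "1 - a \<le> exp (- a)" using exp_ge_add_one_self[of "- a"] by simp
  then have "(1 - a) ^ M \<le> exp (- a) ^ M" using assms by (intro power_mono) auto
  also have "\<dots> = exp (- (M * a))" by (simp flip: exp_of_nat_mult)
  also have "\<dots> \<le> exp (- (M / \<alpha>) * t)"
  proof -
    have "M * (t / \<alpha>) \<le> M * a" using assms by (intro mult_left_mono) (auto simp: field_simps)
    then show ?thesis by simp
  qed
  also have "\<dots> = exp ((1 - t) *\<^sub>R 0 + t *\<^sub>R (- (M / \<alpha>)))" by simp
  also have "\<dots> \<le> (1 - t) * exp 0 + t * exp (- (M / \<alpha>))"
    by (rule convex_onD[OF exp_convex]) (use assms in auto)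
  also have "\<dots> \<le> 1 - t + 1 * exp (- (M / \<alpha>))"
    using assms by (simp add: mult_left_le_one_le)
  finally show ?thesis by simp
qed

lemma finite_set_Pi_pmf:
  assumes "finite A" "\<And>x. x \<in> A \<Longrightarrow> finite (set_pmf (p x))"
  shows "finite (set_pmf (Pi_pmf A d p))"
  by (rule finite_subset[OF set_Pi_pmf_subset'[OF assms(1)]], rule finite_PiE_dflt)
     (use assms in auto)

abbreviation ind :: "bool \<Rightarrow> real" where "ind \<equiv> of_bool"

text \<open>A codeword \<open>u\<close> is admissible for \<open>x\<close> if a fresh \<open>Y\<close> is jointly good with \<open>(x, u)\<close> with
  probability at least \<open>1 - s\<close>. By Markov's inequality this costs \<open>\<eta> / s\<close>, and it
  replaces the Markov lemma of the usual joint-typicality argument.\<close>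

lemma random_binning:
  fixes P :: "('x \<times> 'y) pmf" and PU :: "'x \<Rightarrow> 'u pmf" and M K :: nat and \<alpha> \<gamma> s :: real
  assumes finP: "finite (set_pmf P)" and finPU: "\<And>x. finite (set_pmf (PU x))"
  defines "J \<equiv> P \<bind> (\<lambda>(x, y). map_pmf (\<lambda>u. (x, y, u)) (PU x))"
  defines "pu \<equiv> map_pmf (\<lambda>(x, y, u). u) J" and "puy \<equiv> map_pmf (\<lambda>(x, y, u). (u, y)) J"
  assumes cover: "\<And>x y u. (x, y, u) \<in> G \<Longrightarrow> pmf (PU x) u \<le> \<alpha> * pmf pu u"
    and pack: "\<And>x y u. (x, y, u) \<in> G \<Longrightarrow> pmf pu u * pmf (map_pmf snd P) y \<le> \<gamma> * pmf puy (u, y)"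
    and pos: "0 < \<alpha>" "0 \<le> \<gamma>" "0 < M" "0 < K" "0 < s" "s < 1"
  obtains f \<phi> where "\<And>x. f x < K"
    "measure_pmf.prob P {(x, y). (x, y, \<phi> (f x) y) \<notin> G}
      \<le> measure_pmf.prob J (- G) / s + s + exp (- (M / \<alpha>)) + M * \<gamma> / K"
proof -
  obtain C where P_eq: "P = map_pmf fst P \<bind> (\<lambda>x. map_pmf (Pair x) (C x))"
    and setC: "\<And>x. set_pmf (C x) \<subseteq> snd ` set_pmf P"
    using pmf_disintegration by metis
  define PX where "PX = map_pmf fst P"
  have finC: "finite (set_pmf (C x))" for x using setC[of x] finP by (meson finite_imageI finite_subset)
  have finPX: "finite (set_pmf PX)" using finP by (simp add: PX_def)
  have finJ: "finite (set_pmf J)" using finP finPU by (auto simp: J_def split_beta')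
  have finpu: "finite (set_pmf pu)" using finJ by (simp add: pu_def)
  have EP: "measure_pmf.expectation P g = measure_pmf.expectation PX
      (\<lambda>x. measure_pmf.expectation (C x) (\<lambda>y. g (x, y)))" for g :: "'x \<times> 'y \<Rightarrow> real"
    using finPX finC by (subst P_eq) (simp add: expectation_bind_finite PX_def[symmetric])
  have EJ: "measure_pmf.expectation J g = measure_pmf.expectation P
      (\<lambda>(x, y). measure_pmf.expectation (PU x) (\<lambda>u. g (x, y, u)))" for g :: "'x \<times> 'y \<times> 'u \<Rightarrow> real"
    unfolding J_def using finP finPU
    by (subst expectation_bind_finite) (auto intro!: Bochner_Integration.integral_cong)
  define A where "A x = {u. measure_pmf.prob (C x) {y. (x, y, u) \<in> G} \<ge> 1 - s}" for x
  \<comment> \<open>The decoder tests only this likelihood inequality. By \<open>pack\<close> every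
    good triple passes, and for independent \<open>u\<close> and \<open>y\<close> it holds with
    probability at most \<open>\<gamma>\<close>.\<close>
  define T where "T y = {u. pmf pu u * pmf (map_pmf snd P) y \<le> \<gamma> * pmf puy (u, y)}" for y
  \<comment> \<open>The default index 0, for codebooks without an admissible codeword, keeps the
    encoder's index below \<open>M\<close>.\<close>
  define enc where "enc c x = (if \<exists>j<M. c j \<in> A x then LEAST j. j < M \<and> c j \<in> A x else 0)"
    for c :: "nat \<Rightarrow> 'u" and x
  have enc_less: "enc c x < M" for c x
    using LeastI_ex[of "\<lambda>j. j < M \<and> c j \<in> A x"] pos by (auto simp: enc_def)
  have enc_A: "c (enc c x) \<in> A x" if "\<exists>j<M. c j \<in> A x" for c x
    using LeastI_ex[of "\<lambda>j. j < M \<and> c j \<in> A x"] that by (simp add: enc_def)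
  define dec where "dec c B w y = c (SOME j. j < M \<and> B j = w \<and> c j \<in> T y)"
    for c :: "nat \<Rightarrow> 'u" and B :: "nat \<Rightarrow> nat" and w y
  \<comment> \<open>Three ways to fail: no admissible codeword, a chosen codeword that is not
    jointly good with \<open>y\<close>, and a competitor in the same bin that passes the decoder's
    test. If none occurs, the chosen index is the only candidate for the \<open>SOME\<close> in
    \<open>dec\<close>.\<close>
  define E1 where "E1 c x \<longleftrightarrow> (\<forall>j<M. c j \<notin> A x)" for c x
  define E2 where "E2 c x y \<longleftrightarrow> \<not> E1 c x \<and> (x, y, c (enc c x)) \<notin> G" for c x y
  define E3 where "E3 c B x y \<longleftrightarrow> (\<exists>j<M. j \<noteq> enc c x \<and> B j = B (enc c x) \<and> c j \<in> T y)" for c and B :: "nat \<Rightarrow> nat" and x y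
  define bad where "bad c B x y \<longleftrightarrow> (x, y, dec c B (B (enc c x)) y) \<notin> G" for c B x y
  have bad: "E1 c x \<or> E2 c x y \<or> E3 c B x y" if "bad c B x y" for c B x y
  proof (rule ccontr)
    assume n: "\<not> ?thesis"
    then have g: "(x, y, c (enc c x)) \<in> G" by (auto simp: E2_def)
    then have "c (enc c x) \<in> T y" using pack by (simp add: T_def)
    then have "enc c x < M \<and> B (enc c x) = B (enc c x) \<and> c (enc c x) \<in> T y" using enc_less by simp
    from someI[of "\<lambda>j. j < M \<and> B j = B (enc c x) \<and> c j \<in> T y", OF this] n
    have "(SOME j. j < M \<and> B j = B (enc c x) \<and> c j \<in> T y) = enc c x"
      by (auto simp: E3_def)
    then show False using that g by (simp add: bad_def dec_def)
  qed
  define Pc where "Pc = Pi_pmf {..<M} undefined (\<lambda>_. pu)"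
  define PB where "PB = Pi_pmf {..<M} (0 :: nat) (\<lambda>_. pmf_of_set {..<K})"
  have Kne: "{..<K} \<noteq> {}" using pos by auto
  have finPc: "finite (set_pmf Pc)" unfolding Pc_def by (rule finite_set_Pi_pmf) (use finpu in auto)
  have finPB: "finite (set_pmf PB)" unfolding PB_def by (rule finite_set_Pi_pmf) (use Kne in auto)
  define \<eta> where "\<eta> = measure_pmf.prob J (- G)"

  have admissible: "measure_pmf.expectation PX (\<lambda>x. 1 - measure_pmf.prob (PU x) (A x)) \<le> \<eta> / s"
  proof -
    have "s * measure_pmf.expectation PX (\<lambda>x. 1 - measure_pmf.prob (PU x) (A x))
      = measure_pmf.expectation PX (\<lambda>x. measure_pmf.expectation (PU x) (\<lambda>u. s * ind (u \<notin> A x)))"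
    proof -
      have "1 - measure_pmf.prob (PU x) (A x) = measure_pmf.expectation (PU x) (\<lambda>u. ind (u \<notin> A x))" for x
        using prob_not[of "PU x" "\<lambda>u. u \<in> A x"] by (simp only: prob_eq_expectation[symmetric] Collect_mem_eq)
      then show ?thesis by simp
    qed
    also have "\<dots> \<le> measure_pmf.expectation PX (\<lambda>x. measure_pmf.expectation (PU x)
        (\<lambda>u. measure_pmf.expectation (C x) (\<lambda>y. ind ((x, y, u) \<notin> G))))"
    proof (intro expectation_mono_finite finPX finPU)
      fix x u
      have "measure_pmf.prob (C x) {y. (x, y, u) \<notin> G} = 1 - measure_pmf.prob (C x) {y. (x, y, u) \<in> G}"
        by (rule prob_not)
      then show "s * ind (u \<notin> A x) \<le> measure_pmf.expectation (C x) (\<lambda>y. ind ((x, y, u) \<notin> G))"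
        using pos unfolding prob_eq_expectation[symmetric] by (auto simp: A_def)
    qed
    also have "\<dots> = measure_pmf.expectation PX (\<lambda>x. measure_pmf.expectation (C x)
        (\<lambda>y. measure_pmf.expectation (PU x) (\<lambda>u. ind ((x, y, u) \<notin> G))))"
      by (intro expectation_cong_set_pmf expectation_swap_finite finPU finC)
    also have "\<dots> = measure_pmf.expectation J (\<lambda>z. ind (z \<notin> G))"
      by (simp add: EJ EP)
    also have "\<dots> = \<eta>" unfolding \<eta>_def Compl_eq by (rule prob_eq_expectation[symmetric])
    finally show ?thesis using pos by (simp add: field_simps)
  qed

  have T1: "measure_pmf.expectation Pc (\<lambda>c. measure_pmf.expectation P (\<lambda>(x, y). ind (E1 c x)))
     \<le> \<eta> / s + exp (- (M / \<alpha>))"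
  proof -
    have "measure_pmf.expectation Pc (\<lambda>c. measure_pmf.expectation P (\<lambda>(x, y). ind (E1 c x)))
      = measure_pmf.expectation PX (\<lambda>x. measure_pmf.expectation Pc (\<lambda>c. ind (E1 c x)))"
      using expectation_swap_finite[OF finPc finPX, of "\<lambda>c x. ind (E1 c x)"]
      by (simp add: split_beta' PX_def)
    also have "\<dots> \<le> measure_pmf.expectation PX (\<lambda>x. (1 - measure_pmf.prob (PU x) (A x)) + exp (- (M / \<alpha>)))"
    proof (rule expectation_mono_finite[OF finPX])
      fix x assume x: "x \<in> set_pmf PX"
      have "{c. E1 c x} = Pi {..<M} (\<lambda>_. - A x)" by (auto simp: E1_def Pi_def)
      then have "measure_pmf.expectation Pc (\<lambda>c. ind (E1 c x)) = measure_pmf.prob pu (- A x) ^ M"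
        unfolding prob_eq_expectation[symmetric] by (simp add: Pc_def measure_Pi_pmf_Pi)
      also have "\<dots> = (1 - measure_pmf.prob pu (A x)) ^ M"
        by (simp only: prob_Compl)
      also have "\<dots> \<le> 1 - measure_pmf.prob (PU x) (A x) + exp (- (M / \<alpha>))"
      proof (rule power_covering_bound)
        \<comment> \<open>For an admissible \<open>u\<close> the good \<open>y\<close> have
          probability at least \<open>1 - s > 0\<close>, so some \<open>y\<close> makes the triple
          good and \<open>cover\<close> applies.\<close>
        have A: "pmf (PU x) u \<le> \<alpha> * pmf pu u" if "u \<in> A x" for u
        proof -
          have "0 < measure_pmf.prob (C x) {y. (x, y, u) \<in> G}" using that pos by (simp add: A_def)
          then have "{y. (x, y, u) \<in> G} \<noteq> {}" by (metis less_irrefl measure_empty)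
          then show ?thesis using cover by auto
        qed
        let ?S = "A x \<inter> set_pmf (PU x)"
        have fS: "finite ?S" using finPU[of x] by simp
        have "measure_pmf.prob (PU x) (A x) = measure_pmf.prob (PU x) ?S"
          by (simp add: measure_Int_set_pmf)
        also have "\<dots> = (\<Sum>u\<in>?S. pmf (PU x) u)" using fS by (rule measure_measure_pmf_finite)
        also have "\<dots> \<le> (\<Sum>u\<in>?S. \<alpha> * pmf pu u)" by (rule sum_mono) (use A in auto)
        also have "\<dots> = \<alpha> * measure_pmf.prob pu ?S" using fS by (simp add: measure_measure_pmf_finite sum_distrib_left)
        also have "\<dots> \<le> \<alpha> * measure_pmf.prob pu (A x)"
          using pos by (intro mult_left_mono measure_pmf.finite_measure_mono) auto
        finally show "measure_pmf.prob (PU x) (A x) \<le> \<alpha> * measure_pmf.prob pu (A x)" .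
      qed (use pos in auto)
      finally show "measure_pmf.expectation Pc (\<lambda>c. ind (E1 c x))
         \<le> 1 - measure_pmf.prob (PU x) (A x) + exp (- (M / \<alpha>))" .
    qed
    also have "\<dots> \<le> \<eta> / s + exp (- (M / \<alpha>))"
      using admissible finPX by (subst Bochner_Integration.integral_add) auto
    finally show ?thesis .
  qed

  \<comment> \<open>No average over codebooks is involved: admissibility of the chosen codeword
    bounds this failure for every \<open>c\<close>.\<close>
  have T2: "measure_pmf.expectation P (\<lambda>(x, y). ind (E2 c x y)) \<le> s" for c
  proof -
    have "measure_pmf.expectation P (\<lambda>(x, y). ind (E2 c x y))
        = measure_pmf.expectation PX (\<lambda>x. measure_pmf.expectation (C x) (\<lambda>y. ind (E2 c x y)))"
      by (subst EP) simp
    also have "\<dots> \<le> measure_pmf.expectation PX (\<lambda>x. s)"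
    proof (rule expectation_mono_finite[OF finPX])
      fix x
      have "measure_pmf.prob (C x) {y. (x, y, u) \<notin> G} \<le> s" if "u \<in> A x" for u
        using prob_not[of "C x" "\<lambda>y. (x, y, u) \<in> G"] that by (simp add: A_def)
      then show "measure_pmf.expectation (C x) (\<lambda>y. ind (E2 c x y)) \<le> s"
        using enc_A[of c x] pos unfolding prob_eq_expectation[symmetric] E2_def E1_def
        by (cases "\<exists>j<M. c j \<in> A x") auto
    qed
    finally show ?thesis by simp
  qed

  have T3: "measure_pmf.expectation Pc (\<lambda>c. measure_pmf.expectation PB
      (\<lambda>B. measure_pmf.expectation P (\<lambda>(x, y). ind (E3 c B x y)))) \<le> M * \<gamma> / K"
  proof -
    have "measure_pmf.expectation Pc (\<lambda>c. measure_pmf.expectation PB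
      (\<lambda>B. measure_pmf.expectation P (\<lambda>(x, y). ind (E3 c B x y))))
      = measure_pmf.expectation Pc (\<lambda>c. measure_pmf.expectation P
          (\<lambda>(x, y). measure_pmf.expectation PB (\<lambda>B. ind (E3 c B x y))))"
      using expectation_swap_finite[OF finPB finP, of "\<lambda>B z. ind (E3 c B (fst z) (snd z))" for c]
      by (simp add: split_beta')
    also have "\<dots> \<le> measure_pmf.expectation Pc (\<lambda>c. measure_pmf.expectation P
          (\<lambda>(x, y). \<Sum>j<M. ind (c j \<in> T y) * (1 / K)))"
      unfolding split_beta'
    proof (intro expectation_mono_finite finPc finP)
      fix c and z :: "'x \<times> 'y"
      obtain x y where z: "z = (x, y)" by force
      have "measure_pmf.prob PB {B. E3 c B x y}
        \<le> measure_pmf.prob PB (\<Union>j\<in>{j. j < M \<and> j \<noteq> enc c x \<and> c j \<in> T y}. {B. B j = B (enc c x)})"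
        by (rule measure_pmf.finite_measure_mono) (auto simp: E3_def)
      also have "\<dots> \<le> (\<Sum>j\<in>{j. j < M \<and> j \<noteq> enc c x \<and> c j \<in> T y}. measure_pmf.prob PB {B. B j = B (enc c x)})"
        by (rule measure_pmf.finite_measure_subadditive_finite) auto
      also have "\<dots> = (\<Sum>j\<in>{j. j < M \<and> j \<noteq> enc c x \<and> c j \<in> T y}. 1 / K)"
        unfolding PB_def using enc_less pos by (intro sum.cong) (auto simp: prob_Pi_pmf_eq)
      \<comment> \<open>Including \<open>j = enc c x\<close> again removes the dependence on the
        encoder's choice. Each \<open>c j\<close> is then a draw from \<open>pu\<close> independent
        of \<open>y\<close>.\<close>
      also have "\<dots> \<le> (\<Sum>j\<in>{j \<in> {..<M}. c j \<in> T y}. 1 / K)"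
        by (rule sum_mono2) auto
      also have "\<dots> = (\<Sum>j<M. ind (c j \<in> T y) * (1 / K))"
        by (subst sum.inter_filter) (auto intro!: sum.cong)
      finally show "measure_pmf.expectation PB (\<lambda>B. ind (E3 c B (fst z) (snd z)))
        \<le> (\<Sum>j<M. ind (c j \<in> T (snd z)) * (1 / K))"
        unfolding z prob_eq_expectation[symmetric] by simp
    qed
    also have "\<dots> = measure_pmf.expectation P (\<lambda>(x, y). measure_pmf.expectation Pc
          (\<lambda>c. \<Sum>j<M. ind (c j \<in> T y) * (1 / K)))"
      using expectation_swap_finite[OF finPc finP, of "\<lambda>c z. \<Sum>j<M. ind (c j \<in> T (snd z)) * (1 / K)"]
      by (simp only: split_beta')
    also have "\<dots> = measure_pmf.expectation P (\<lambda>(x, y). M / K * measure_pmf.prob pu (T y))"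
    proof (intro Bochner_Integration.integral_cong refl, clarsimp simp del: sum_of_bool_mult_eq)
      fix y
      have "measure_pmf.expectation Pc (\<lambda>c. ind (c j \<in> T y)) = measure_pmf.prob pu (T y)" if "j < M" for j
      proof -
        have "measure_pmf.expectation (map_pmf (\<lambda>c. c j) Pc) (\<lambda>u. ind (u \<in> T y))
            = measure_pmf.expectation Pc (\<lambda>c. ind (c j \<in> T y))"
          by (rule integral_map_pmf)
        moreover have "map_pmf (\<lambda>c. c j) Pc = pu" using that by (simp add: Pc_def Pi_pmf_component)
        ultimately have "measure_pmf.expectation pu (\<lambda>u. ind (u \<in> T y))
            = measure_pmf.expectation Pc (\<lambda>c. ind (c j \<in> T y))" by (simp only:)
        then show ?thesis unfolding prob_eq_expectation[symmetric] by simp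
      qed
      then show "measure_pmf.expectation Pc (\<lambda>c. \<Sum>j<M. ind (c j \<in> T y) / K) = M * measure_pmf.prob pu (T y) / K"
        using finPc by (subst Bochner_Integration.integral_sum) (auto simp: sum_divide_distrib)
    qed
    also have "\<dots> = M / K * measure_pmf.expectation (map_pmf snd P) (\<lambda>y. measure_pmf.prob pu (T y))"
      by (simp add: split_beta')
    also have "\<dots> \<le> M / K * \<gamma>"
    proof (rule mult_left_mono)
      define S where "S = set_pmf pu" define Y where "Y = set_pmf (map_pmf snd P)"
      have fin: "finite S" "finite Y" using finpu finP by (auto simp: S_def Y_def)
      have "measure_pmf.expectation (map_pmf snd P) (\<lambda>y. measure_pmf.prob pu (T y))
        = (\<Sum>y\<in>Y. \<Sum>u\<in>S. pmf pu u * pmf (map_pmf snd P) y * ind (u \<in> T y))"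
      proof -
        have "measure_pmf.prob pu (T y) = (\<Sum>u\<in>S. pmf pu u * ind (u \<in> T y))" for y
          using prob_eq_expectation[of pu "\<lambda>u. u \<in> T y"] finpu by (simp add: expectation_finite_sum S_def)
        note pu_T = this
        have "measure_pmf.expectation (map_pmf snd P) (\<lambda>y. measure_pmf.prob pu (T y))
          = (\<Sum>y\<in>Y. pmf (map_pmf snd P) y * measure_pmf.prob pu (T y))"
          by (rule expectation_finite_sum) (use fin in \<open>auto simp: Y_def\<close>)
        then show ?thesis by (simp only: pu_T sum_distrib_left mult_ac)
      qed
      \<comment> \<open>Change of measure: on \<open>T y\<close> the product law is at most
        \<open>\<gamma>\<close> times the joint law, whose total mass is 1.\<close>
      also have "\<dots> \<le> (\<Sum>y\<in>Y. \<Sum>u\<in>S. \<gamma> * pmf puy (u, y))"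
      proof (intro sum_mono)
        fix y u
        show "pmf pu u * pmf (map_pmf snd P) y * ind (u \<in> T y) \<le> \<gamma> * pmf puy (u, y)"
          using pos by (auto simp: T_def)
      qed
      also have "\<dots> = \<gamma> * (\<Sum>z\<in>S \<times> Y. pmf puy z)"
        by (subst sum.swap) (simp only: sum.cartesian_product sum_distrib_left split_beta' prod.collapse)
      also have "(\<Sum>z\<in>S \<times> Y. pmf puy z) = 1"
      proof (rule sum_pmf_eq_1)
        have "map_pmf fst puy = pu" by (simp add: puy_def pu_def pmf.map_comp o_def split_beta')
        moreover have "map_pmf snd puy = map_pmf snd P"
          by (simp add: puy_def J_def map_bind_pmf pmf.map_comp o_def split_beta' map_pmf_const) (simp add: map_pmf_def)
        ultimately have "S = fst ` set_pmf puy" "Y = snd ` set_pmf puy"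
          unfolding S_def Y_def by (metis set_map_pmf)+
        then show "set_pmf puy \<subseteq> S \<times> Y" by force
      qed (use fin in auto)
      finally show "measure_pmf.expectation (map_pmf snd P) (\<lambda>y. measure_pmf.prob pu (T y)) \<le> \<gamma>" by simp
    qed auto
    finally show ?thesis by simp
  qed

  have "measure_pmf.expectation Pc (\<lambda>c. measure_pmf.expectation PB
      (\<lambda>B. measure_pmf.expectation P (\<lambda>(x, y). ind (bad c B x y))))
    \<le> measure_pmf.expectation Pc (\<lambda>c. measure_pmf.expectation PB
      (\<lambda>B. measure_pmf.expectation P (\<lambda>(x, y). ind (E1 c x)) + s
         + measure_pmf.expectation P (\<lambda>(x, y). ind (E3 c B x y))))"
  proof (intro expectation_mono_finite finPc finPB)
    fix c B
    have "measure_pmf.expectation P (\<lambda>(x, y). ind (bad c B x y))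
      \<le> measure_pmf.expectation P (\<lambda>z. (case z of (x, y) \<Rightarrow> ind (E1 c x))
         + (case z of (x, y) \<Rightarrow> ind (E2 c x y)) + (case z of (x, y) \<Rightarrow> ind (E3 c B x y)))"
    proof (rule expectation_mono_finite[OF finP])
      fix z :: "'x \<times> 'y" obtain x y where z: "z = (x, y)" by force
      show "(case z of (x, y) \<Rightarrow> ind (bad c B x y)) \<le> (case z of (x, y) \<Rightarrow> ind (E1 c x))
         + (case z of (x, y) \<Rightarrow> ind (E2 c x y)) + (case z of (x, y) \<Rightarrow> ind (E3 c B x y))"
        unfolding z using bad[of c B x y] by (cases "bad c B x y") (auto simp: of_bool_def)
    qed
    also have "\<dots> = measure_pmf.expectation P (\<lambda>(x, y). ind (E1 c x))
       + measure_pmf.expectation P (\<lambda>(x, y). ind (E2 c x y))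
       + measure_pmf.expectation P (\<lambda>(x, y). ind (E3 c B x y))"
      by (simp only: expectation_add_finite[OF finP])
    finally show "measure_pmf.expectation P (\<lambda>(x, y). ind (bad c B x y))
      \<le> measure_pmf.expectation P (\<lambda>(x, y). ind (E1 c x)) + s
         + measure_pmf.expectation P (\<lambda>(x, y). ind (E3 c B x y))"
      using T2[of c] by linarith
  qed
  also have "\<dots> = measure_pmf.expectation Pc (\<lambda>c. measure_pmf.expectation P (\<lambda>(x, y). ind (E1 c x))) + s
      + measure_pmf.expectation Pc (\<lambda>c. measure_pmf.expectation PB
          (\<lambda>B. measure_pmf.expectation P (\<lambda>(x, y). ind (E3 c B x y))))"
    by (simp only: expectation_add_finite[OF finPB] expectation_add_finite[OF finPc]) simp
  also have "\<dots> \<le> \<eta> / s + s + exp (- (M / \<alpha>)) + M * \<gamma> / K" using T1 T3 by simp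
  finally have "measure_pmf.expectation Pc (\<lambda>c. measure_pmf.expectation PB
      (\<lambda>B. measure_pmf.expectation P (\<lambda>(x, y). ind (bad c B x y)))) \<le> \<eta> / s + s + exp (- (M / \<alpha>)) + M * \<gamma> / K" .
  from exists_le_expectation[OF finPc this] obtain c where
    "measure_pmf.expectation PB (\<lambda>B. measure_pmf.expectation P (\<lambda>(x, y). ind (bad c B x y)))
      \<le> \<eta> / s + s + exp (- (M / \<alpha>)) + M * \<gamma> / K" by blast
  from exists_le_expectation[OF finPB this] obtain B where B: "B \<in> set_pmf PB"
    "measure_pmf.expectation P (\<lambda>(x, y). ind (bad c B x y)) \<le> \<eta> / s + s + exp (- (M / \<alpha>)) + M * \<gamma> / K"
    by blast
  show ?thesis
  proof (rule that[of "\<lambda>x. B (enc c x)" "dec c B"])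
    fix x
    have "B (enc c x) \<in> set_pmf (pmf_of_set {..<K})"
      using set_Pi_pmf_subset'[of "{..<M}" 0 "\<lambda>_. pmf_of_set {..<K}"] B(1) enc_less[of c x]
      by (auto simp: PB_def PiE_dflt_def)
    then show "B (enc c x) < K" using Kne by simp
  next
    have "measure_pmf.prob P {z. case z of (x, y) \<Rightarrow> bad c B x y}
       = measure_pmf.expectation P (\<lambda>z. ind (case z of (x, y) \<Rightarrow> bad c B x y))"
      by (rule prob_eq_expectation)
    also have "\<dots> = measure_pmf.expectation P (\<lambda>(x, y). ind (bad c B x y))"
      by (simp add: split_beta')
    finally show "measure_pmf.prob P {(x, y). (x, y, dec c B (B (enc c x)) y) \<notin> G}
      \<le> measure_pmf.prob J (- G) / s + s + exp (- (M / \<alpha>)) + M * \<gamma> / K"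
      using B(2) by (simp add: bad_def \<eta>_def)
  qed
qed

subsection \<open>Block codes from binning\<close>

text \<open>Independent letters with individual laws. It describes both the block kernel from
  \<open>x\<close> to \<open>u\<close> and the output of a decoder that draws each letter from its
  own \<open>P(xh|u,y)\<close>.\<close>

primrec seq_pmf :: "'a pmf list \<Rightarrow> 'a list pmf" where
  "seq_pmf [] = return_pmf []"
| "seq_pmf (p # ps) = p \<bind> (\<lambda>a. map_pmf ((#) a) (seq_pmf ps))"

lemma seq_pmf_replicate: "seq_pmf (replicate n p) = replicate_pmf n p"
  by (induction n) (simp_all add: map_pmf_def)

lemma finite_set_seq_pmf: "(\<And>p. p \<in> set ps \<Longrightarrow> finite (set_pmf p)) \<Longrightarrow> finite (set_pmf (seq_pmf ps))"
  by (induction ps) auto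

lemma length_seq_pmf: "as \<in> set_pmf (seq_pmf ps) \<Longrightarrow> length as = length ps"
  by (induction ps arbitrary: as) auto

lemma seq_pmf_Cons_pair: "seq_pmf (p # ps) = map_pmf (\<lambda>(a, as). a # as) (p \<bind> (\<lambda>a. map_pmf (Pair a) (seq_pmf ps)))"
  by (simp add: map_bind_pmf pmf.map_comp o_def)

lemma pmf_seq_pmf_map:
  fixes t :: "'z \<Rightarrow> 'a"
  shows "pmf (seq_pmf (map p zs)) (map t zs) = (\<Prod>z\<leftarrow>zs. pmf (p z) (t z))"
proof (induction zs)
  case (Cons z zs)
  have "inj (\<lambda>(a, as). a # as :: 'a list)" by (auto simp: inj_on_def)
  from pmf_map_inj'[OF this, of _ "(t z, map t zs)"]
  show ?case unfolding list.map seq_pmf_Cons_pair by (simp add: pmf_bind_Pair Cons)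
qed simp

lemma pmf_replicate_pmf_map: "pmf (replicate_pmf (length zs) p) (map t zs) = (\<Prod>z\<leftarrow>zs. pmf p (t z))"
  using pmf_seq_pmf_map[of "\<lambda>_. p" zs t] by (simp add: map_replicate_const seq_pmf_replicate)

lemma prod_list_map_mult:
  fixes f g :: "'a \<Rightarrow> real"
  shows "(\<Prod>z\<leftarrow>zs. f z * g z) = (\<Prod>z\<leftarrow>zs. f z) * (\<Prod>z\<leftarrow>zs. g z)"
  by (induction zs) simp_all

lemma replicate_pmf_bind_Pair:
  "replicate_pmf n (P \<bind> (\<lambda>a. map_pmf (Pair a) (K a))) = replicate_pmf n P \<bind> (\<lambda>as. map_pmf (zip as) (seq_pmf (map K as)))"
proof (induction n)
  case (Suc n)
  have "replicate_pmf (Suc n) (P \<bind> (\<lambda>a. map_pmf (Pair a) (K a)))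
     = P \<bind> (\<lambda>a. K a \<bind> (\<lambda>c. replicate_pmf n P \<bind> (\<lambda>as. seq_pmf (map K as) \<bind> (\<lambda>cs. return_pmf ((a, c) # zip as cs)))))"
    unfolding replicate_pmf.simps Suc by (simp add: map_pmf_def bind_assoc_pmf bind_return_pmf)
  also have "\<dots> = P \<bind> (\<lambda>a. replicate_pmf n P \<bind> (\<lambda>as. K a \<bind> (\<lambda>c. seq_pmf (map K as) \<bind> (\<lambda>cs. return_pmf ((a, c) # zip as cs)))))"
    by (intro bind_pmf_cong refl bind_commute_pmf)
  also have "\<dots> = replicate_pmf (Suc n) P \<bind> (\<lambda>as. map_pmf (zip as) (seq_pmf (map K as)))"
    by (simp add: map_pmf_def bind_assoc_pmf bind_return_pmf)
  finally show ?case .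
qed (simp add: bind_return_pmf)

section \<open>Law of large numbers for independent letters\<close>

lemma expectation_sum_list_sq:
  fixes \<psi> :: "'a \<Rightarrow> real"
  assumes fin: "finite (set_pmf p)" and 0: "measure_pmf.expectation p \<psi> = 0"
  shows "measure_pmf.expectation (replicate_pmf n p) (\<lambda>zs. (\<Sum>z\<leftarrow>zs. \<psi> z)\<^sup>2)
     = n * measure_pmf.expectation p (\<lambda>z. (\<psi> z)\<^sup>2)"
proof (induction n)
  case (Suc n)
  let ?R = "replicate_pmf n p" let ?S = "\<lambda>zs. \<Sum>z\<leftarrow>zs. \<psi> z"
  have finR: "finite (set_pmf ?R)" using fin by (rule finite_set_replicate_pmf)
  have "measure_pmf.expectation (replicate_pmf (Suc n) p) (\<lambda>zs. (?S zs)\<^sup>2)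
    = measure_pmf.expectation p (\<lambda>z. measure_pmf.expectation ?R (\<lambda>zs. (\<psi> z + ?S zs)\<^sup>2))"
    using fin finR by (simp add: expectation_bind_finite flip: map_pmf_def)
  also have "\<dots> = measure_pmf.expectation p (\<lambda>z. (\<psi> z)\<^sup>2 + \<psi> z * (2 * measure_pmf.expectation ?R ?S)
      + measure_pmf.expectation ?R (\<lambda>zs. (?S zs)\<^sup>2))"
  proof (rule expectation_cong_set_pmf)
    fix z
    have "measure_pmf.expectation ?R (\<lambda>zs. (\<psi> z + ?S zs)\<^sup>2)
      = measure_pmf.expectation ?R (\<lambda>zs. (\<psi> z)\<^sup>2 + (\<psi> z * 2) * ?S zs + (?S zs)\<^sup>2)"
      by (simp add: power2_sum algebra_simps)
    also have "\<dots> = (\<psi> z)\<^sup>2 + (\<psi> z * 2) * measure_pmf.expectation ?R ?S + measure_pmf.expectation ?R (\<lambda>zs. (?S zs)\<^sup>2)"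
      by (simp only: expectation_add_finite[OF finR]) simp
    finally show "measure_pmf.expectation ?R (\<lambda>zs. (\<psi> z + ?S zs)\<^sup>2)
      = (\<psi> z)\<^sup>2 + \<psi> z * (2 * measure_pmf.expectation ?R ?S) + measure_pmf.expectation ?R (\<lambda>zs. (?S zs)\<^sup>2)"
      by simp
  qed
  also have "\<dots> = real (Suc n) * measure_pmf.expectation p (\<lambda>z. (\<psi> z)\<^sup>2)"
    by (simp only: expectation_add_finite[OF fin]) (simp add: 0 Suc algebra_simps)
  finally show ?case .
qed simp

text \<open>Chebyshev's inequality applied to the centred sum, with the event restricted to upward
  deviations as in the notion of a good sequence.\<close>

lemma weak_law_replicate_pmf:
  fixes \<psi> :: "'a \<Rightarrow> real"
  assumes fin: "finite (set_pmf p)" and \<epsilon>: "\<epsilon> > 0" and n: "n > 0"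
  shows "measure_pmf.prob (replicate_pmf n p) {zs. \<not> (\<Sum>z\<leftarrow>zs. \<psi> z) \<le> n * (measure_pmf.expectation p \<psi> + \<epsilon>)}
     \<le> measure_pmf.expectation p (\<lambda>z. (\<psi> z - measure_pmf.expectation p \<psi>)\<^sup>2) / (n * \<epsilon>\<^sup>2)"
proof -
  let ?R = "replicate_pmf n p"
  define \<mu> where "\<mu> = measure_pmf.expectation p \<psi>"
  define \<psi>' where "\<psi>' z = \<psi> z - \<mu>" for z
  have "(\<Sum>z\<leftarrow>zs. \<psi>' z) = (\<Sum>z\<leftarrow>zs. \<psi> z) - length zs * \<mu>" for zs
    by (induction zs) (simp_all add: \<psi>'_def algebra_simps)
  note S' = this
  have finR: "finite (set_pmf ?R)" using fin by (rule finite_set_replicate_pmf)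
  have "(n * \<epsilon>)\<^sup>2 * measure_pmf.prob ?R {zs. \<not> (\<Sum>z\<leftarrow>zs. \<psi> z) \<le> n * (\<mu> + \<epsilon>)}
    = measure_pmf.expectation ?R (\<lambda>zs. (n * \<epsilon>)\<^sup>2 * of_bool (\<not> (\<Sum>z\<leftarrow>zs. \<psi> z) \<le> n * (\<mu> + \<epsilon>)))"
    by (simp add: prob_eq_expectation)
  also have "\<dots> \<le> measure_pmf.expectation ?R (\<lambda>zs. (\<Sum>z\<leftarrow>zs. \<psi>' z)\<^sup>2)"
  proof (rule expectation_mono_finite[OF finR])
    fix zs assume "zs \<in> set_pmf ?R"
    then have "length zs = n" by (rule length_replicate_pmf)
    then have "(n * \<epsilon>)\<^sup>2 \<le> (\<Sum>z\<leftarrow>zs. \<psi>' z)\<^sup>2" if "\<not> (\<Sum>z\<leftarrow>zs. \<psi> z) \<le> n * (\<mu> + \<epsilon>)"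
      using that \<epsilon> by (intro power_mono) (auto simp: S' algebra_simps)
    then show "(n * \<epsilon>)\<^sup>2 * of_bool (\<not> (\<Sum>z\<leftarrow>zs. \<psi> z) \<le> n * (\<mu> + \<epsilon>)) \<le> (\<Sum>z\<leftarrow>zs. \<psi>' z)\<^sup>2"
      by (simp add: of_bool_def)
  qed
  also have "\<dots> = n * measure_pmf.expectation p (\<lambda>z. (\<psi>' z)\<^sup>2)"
  proof (rule expectation_sum_list_sq[OF fin])
    show "measure_pmf.expectation p \<psi>' = 0"
      unfolding \<psi>'_def using fin by (simp add: Bochner_Integration.integral_diff \<mu>_def)
  qed
  finally show ?thesis
    using n \<epsilon> by (simp add: \<psi>'_def \<mu>_def field_simps power2_eq_square)
qed

section \<open>Good sequences and the rate of the binning code\<close>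

context entropy_base
begin

lemma prod_list_eq_powr:
  assumes "\<And>z. z \<in> set zs \<Longrightarrow> 0 < f z \<and> 0 < g z"
  shows "(\<Prod>z\<leftarrow>zs. f z) = b powr (\<Sum>z\<leftarrow>zs. log b (f z / g z)) * (\<Prod>z\<leftarrow>zs. g z)"
  using assms
proof (induction zs)
  case (Cons z zs)
  then have IH: "(\<Prod>z\<leftarrow>zs. f z) = b powr (\<Sum>z\<leftarrow>zs. log b (f z / g z)) * (\<Prod>z\<leftarrow>zs. g z)" by simp
  have z: "0 < f z" "0 < g z" using Cons.prems[of z] by auto
  then have "b powr log b (f z / g z) = f z / g z" using b_gt_1 by simp
  then show ?case using z by (simp add: powr_add IH)
qed (use b_gt_1 in simp)

text \<open>Converts a bound on a sum of log-likelihood ratios into one on a ratio of product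
  probabilities; the constants \<open>\<alpha>\<close> and \<open>\<gamma>\<close> of the binning
  bound arise from it as powers of \<open>b\<close>.\<close>

lemma prod_list_le_powr:
  assumes pos: "\<And>z. z \<in> set zs \<Longrightarrow> 0 < f z \<and> 0 < g z" and le: "(\<Sum>z\<leftarrow>zs. log b (f z / g z)) \<le> t"
  shows "(\<Prod>z\<leftarrow>zs. f z) \<le> b powr t * (\<Prod>z\<leftarrow>zs. g z)"
proof -
  have "0 \<le> (\<Prod>z\<leftarrow>zs. g z)" using pos by (induction zs) (auto intro!: mult_nonneg_nonneg simp: less_imp_le)
  then have "b powr (\<Sum>z\<leftarrow>zs. log b (f z / g z)) * (\<Prod>z\<leftarrow>zs. g z) \<le> b powr t * (\<Prod>z\<leftarrow>zs. g z)"
    using le b_gt_1 by (intro mult_right_mono powr_mono) auto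
  then show ?thesis using prod_list_eq_powr[of zs f g] pos by simp
qed

text \<open>The means of \<open>i1\<close> and \<open>i2\<close> are \<open>I(X;U)\<close> and
  \<open>- I(U;Y)\<close>. As both functions belong to \<open>\<Psi>\<close>, every good sequence
  satisfies the covering and packing conditions of \<open>random_binning\<close>, with
  \<open>b\<close> to the power of \<open>n\<close> times these means plus \<open>\<epsilon>\<close>
  as constants. \<open>V\<close> collects the variances for the union bound over
  \<open>\<Psi>\<close>.\<close>

lemma coding_block:
  fixes P :: "('x \<times> 'y) pmf" and PU :: "'x \<Rightarrow> 'u pmf" and n M K :: nat and \<epsilon> s :: real
  assumes finP: "finite (set_pmf P)" and finPU: "\<And>x. finite (set_pmf (PU x))"
  defines "J \<equiv> P \<bind> (\<lambda>(x, y). map_pmf (\<lambda>u. (x, y, u)) (PU x))"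
  defines "pu \<equiv> map_pmf (\<lambda>(x, y, u). u) J" and "puy \<equiv> map_pmf (\<lambda>(x, y, u). (u, y)) J"
  defines "i1 \<equiv> \<lambda>(x, y, u). log b (pmf (PU x) u / pmf pu u)"
    and "i2 \<equiv> \<lambda>(x, y, u). log b (pmf pu u * pmf (map_pmf snd P) y / pmf puy (u, y))"
  assumes fin\<Psi>: "finite \<Psi>" and i12: "i1 \<in> \<Psi>" "i2 \<in> \<Psi>" and pos: "0 < \<epsilon>" "0 < n" "0 < M" "0 < K" "0 < s" "s < 1"
  defines "V \<equiv> \<Sum>\<psi>\<in>\<Psi>. measure_pmf.expectation J (\<lambda>z. (\<psi> z - measure_pmf.expectation J \<psi>)\<^sup>2)"
    and "good \<equiv> \<lambda>xys us. \<exists>zs. length zs = n \<and> xys = map (\<lambda>(x, y, u). (x, y)) zs \<and> us = map (\<lambda>(x, y, u). u) zs \<and>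
      (\<forall>\<psi>\<in>\<Psi>. (\<Sum>z\<leftarrow>zs. \<psi> z) \<le> n * (measure_pmf.expectation J \<psi> + \<epsilon>))"
  obtains f \<phi> where "\<And>xs. f xs < K"
    "measure_pmf.prob (replicate_pmf n P) {xys. \<not> good xys (\<phi> (f (map fst xys)) (map snd xys))}
      \<le> V / (n * \<epsilon>\<^sup>2) / s + s + exp (- (M / b powr (n * (measure_pmf.expectation J i1 + \<epsilon>))))
        + M * b powr (n * (measure_pmf.expectation J i2 + \<epsilon>)) / K"
proof -
  \<comment> \<open>Binning deals with a triple of sequences, the law of large numbers with a
    sequence of triples; \<open>unz\<close> translates.\<close>
  define unz where "unz zs = (map (\<lambda>(x, y, u). x) zs, map (\<lambda>(x, y, u). y) zs, map (\<lambda>(x, y, u). u) zs)"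
    for zs :: "('x \<times> 'y \<times> 'u) list"
  define Pn where "Pn = map_pmf (\<lambda>xys. (map fst xys, map snd xys)) (replicate_pmf n P)"
  define PUn where "PUn xs = seq_pmf (map PU xs)" for xs
  define Jn where "Jn = Pn \<bind> (\<lambda>(xs, ys). map_pmf (\<lambda>us. (xs, ys, us)) (PUn xs))"
  \<comment> \<open>Staying in the support of \<open>J\<close> makes all probabilities in the ratios
    positive, so that their logarithms can be turned back into ratios.\<close>
  define Gz where "Gz = {zs. length zs = n \<and> set zs \<subseteq> set_pmf J \<and>
      (\<forall>\<psi>\<in>\<Psi>. (\<Sum>z\<leftarrow>zs. \<psi> z) \<le> n * (measure_pmf.expectation J \<psi> + \<epsilon>))}"
  have finJ: "finite (set_pmf J)" using finP finPU by (auto simp: J_def split_beta')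
  have J_pair: "J = map_pmf (\<lambda>((x, y), u). (x, y, u)) (P \<bind> (\<lambda>a. map_pmf (Pair a) (PU (fst a))))"
    by (simp add: J_def map_bind_pmf pmf.map_comp o_def split_beta')
  have Jn: "Jn = map_pmf unz (replicate_pmf n J)"
  proof -
    have "map_pmf unz (replicate_pmf n J)
      = map_pmf (\<lambda>ws. unz (map (\<lambda>((x, y), u). (x, y, u)) ws)) (replicate_pmf n (P \<bind> (\<lambda>a. map_pmf (Pair a) (PU (fst a)))))"
      unfolding J_pair map_replicate_pmf[symmetric] by (simp add: pmf.map_comp o_def)
    also have "\<dots> = replicate_pmf n P \<bind> (\<lambda>as. map_pmf (\<lambda>us. unz (map (\<lambda>((x, y), u). (x, y, u)) (zip as us)))
        (seq_pmf (map (\<lambda>a. PU (fst a)) as)))"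
      unfolding replicate_pmf_bind_Pair by (simp add: map_bind_pmf pmf.map_comp o_def)
    also have "\<dots> = replicate_pmf n P \<bind> (\<lambda>as. map_pmf (\<lambda>us. (map fst as, map snd as, us)) (PUn (map fst as)))"
    proof (intro bind_pmf_cong refl)
      fix as
      show "map_pmf (\<lambda>us. unz (map (\<lambda>((x, y), u). (x, y, u)) (zip as us))) (seq_pmf (map (\<lambda>a. PU (fst a)) as))
        = map_pmf (\<lambda>us. (map fst as, map snd as, us)) (PUn (map fst as))"
      proof -
        have "unz (map (\<lambda>((x, y), u). (x, y, u)) (zip as us)) = (map fst as, map snd as, us)"
          if "length us = length as" for us
          using that by (induction us as rule: list_induct2) (auto simp: unz_def)
        then show ?thesis unfolding PUn_def map_map o_def
          by (intro map_pmf_cong refl) (auto dest!: length_seq_pmf)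
      qed
    qed
    also have "\<dots> = Jn" by (simp add: Jn_def Pn_def bind_map_pmf)
    finally show ?thesis by simp
  qed
  have pun: "map_pmf (\<lambda>(xs, ys, us). us) Jn = replicate_pmf n pu"
    by (simp add: Jn pu_def unz_def pmf.map_comp o_def map_replicate_pmf[symmetric])
  have pyn: "map_pmf snd Pn = replicate_pmf n (map_pmf snd P)"
    by (simp add: Pn_def pmf.map_comp o_def map_replicate_pmf)
  have puyn: "map_pmf (\<lambda>(xs, ys, us). (us, ys)) Jn
      = map_pmf (\<lambda>ws. (map fst ws, map snd ws)) (replicate_pmf n puy)"
    by (simp add: Jn puy_def unz_def pmf.map_comp o_def map_replicate_pmf[symmetric] split_beta')
  have posJ: "0 < pmf (PU x) u" "0 < pmf pu u" "0 < pmf (map_pmf snd P) y" "0 < pmf puy (u, y)"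
    if "(x, y, u) \<in> set_pmf J" for x y u
    using that by (auto simp: pmf_positive_iff J_def pu_def puy_def image_iff; force)+
  have finPUn: "finite (set_pmf (PUn xs))" for xs unfolding PUn_def using finPU by (intro finite_set_seq_pmf) auto
  have finPn: "finite (set_pmf Pn)" using finP by (simp add: Pn_def finite_set_replicate_pmf)
  obtain f \<phi> where f: "\<And>xs. f xs < K" and
    fail: "measure_pmf.prob Pn {(xs, ys). (xs, ys, \<phi> (f xs) ys) \<notin> unz ` Gz}
      \<le> measure_pmf.prob Jn (- unz ` Gz) / s + s + exp (- (M / b powr (n * (measure_pmf.expectation J i1 + \<epsilon>))))
        + M * b powr (n * (measure_pmf.expectation J i2 + \<epsilon>)) / K"
  proof (rule random_binning[where P = Pn and PU = PUn and G = "unz ` Gz" and M = M and K = K and s = s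
      and \<alpha> = "b powr (real n * (measure_pmf.expectation J i1 + \<epsilon>))"
      and \<gamma> = "b powr (real n * (measure_pmf.expectation J i2 + \<epsilon>))", OF finPn finPUn, folded Jn_def])
    show "0 < b powr (n * (measure_pmf.expectation J i1 + \<epsilon>))" using b_gt_1 by simp
    show "0 \<le> b powr (n * (measure_pmf.expectation J i2 + \<epsilon>))" by simp
  next
    fix xs ys us assume "(xs, ys, us) \<in> unz ` Gz"
    then obtain zs where zs: "zs \<in> Gz" and eq: "xs = map (\<lambda>(x, y, u). x) zs" "ys = map (\<lambda>(x, y, u). y) zs" "us = map (\<lambda>(x, y, u). u) zs"
      by (auto simp: unz_def)
    have supp: "z \<in> set_pmf J" if "z \<in> set zs" for z using that zs by (auto simp: Gz_def)
    have len: "length zs = n" using zs by (simp add: Gz_def)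
    have "(\<Prod>(x, y, u)\<leftarrow>zs. pmf (PU x) u) \<le> b powr (n * (measure_pmf.expectation J i1 + \<epsilon>)) * (\<Prod>(x, y, u)\<leftarrow>zs. pmf pu u)"
    proof (rule prod_list_le_powr)
      show "(\<Sum>z\<leftarrow>zs. log b ((case z of (x, y, u) \<Rightarrow> pmf (PU x) u) / (case z of (x, y, u) \<Rightarrow> pmf pu u)))
        \<le> n * (measure_pmf.expectation J i1 + \<epsilon>)"
        using zs i12(1) by (auto simp: Gz_def i1_def split_beta')
    qed (use posJ supp in fastforce)
    moreover have "pmf (PUn xs) us = (\<Prod>(x, y, u)\<leftarrow>zs. pmf (PU x) u)"
      using pmf_seq_pmf_map[of "\<lambda>(x, y, u). PU x" zs "\<lambda>(x, y, u). u"]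
      by (simp add: PUn_def eq o_def split_beta')
    moreover have "pmf (replicate_pmf n pu) us = (\<Prod>(x, y, u)\<leftarrow>zs. pmf pu u)"
      using pmf_replicate_pmf_map[of zs pu "\<lambda>(x, y, u). u"] by (simp add: eq len split_beta')
    ultimately show "pmf (PUn xs) us \<le> b powr (n * (measure_pmf.expectation J i1 + \<epsilon>))
        * pmf (map_pmf (\<lambda>(xs, ys, us). us) Jn) us"
      by (simp add: pun)
  next
    fix xs ys us assume "(xs, ys, us) \<in> unz ` Gz"
    then obtain zs where zs: "zs \<in> Gz" and eq: "xs = map (\<lambda>(x, y, u). x) zs" "ys = map (\<lambda>(x, y, u). y) zs" "us = map (\<lambda>(x, y, u). u) zs"
      by (auto simp: unz_def)
    have supp: "z \<in> set_pmf J" if "z \<in> set zs" for z using that zs by (auto simp: Gz_def)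
    have len: "length zs = n" using zs by (simp add: Gz_def)
    have "(\<Prod>(x, y, u)\<leftarrow>zs. pmf pu u * pmf (map_pmf snd P) y)
      \<le> b powr (n * (measure_pmf.expectation J i2 + \<epsilon>)) * (\<Prod>(x, y, u)\<leftarrow>zs. pmf puy (u, y))"
    proof (rule prod_list_le_powr)
      show "(\<Sum>z\<leftarrow>zs. log b ((case z of (x, y, u) \<Rightarrow> pmf pu u * pmf (map_pmf snd P) y) / (case z of (x, y, u) \<Rightarrow> pmf puy (u, y))))
        \<le> n * (measure_pmf.expectation J i2 + \<epsilon>)"
        using zs i12(2) by (auto simp: Gz_def i2_def split_beta')
    qed (use posJ supp in fastforce)
    moreover have "(\<Prod>(x, y, u)\<leftarrow>zs. pmf pu u * pmf (map_pmf snd P) y)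
      = pmf (replicate_pmf n pu) us * pmf (replicate_pmf n (map_pmf snd P)) ys"
      using pmf_replicate_pmf_map[of zs pu "\<lambda>(x, y, u). u"]
        pmf_replicate_pmf_map[of zs "map_pmf snd P" "\<lambda>(x, y, u). y"]
      by (simp add: eq len split_beta' prod_list_map_mult)
    moreover have "pmf (map_pmf (\<lambda>(xs, ys, us). (us, ys)) Jn) (us, ys) = (\<Prod>(x, y, u)\<leftarrow>zs. pmf puy (u, y))"
    proof -
      have "inj (\<lambda>ws :: ('u \<times> 'y) list. (map fst ws, map snd ws))"
        by (rule injI) (metis Pair_inject zip_map_fst_snd)
      from pmf_map_inj'[OF this, of "replicate_pmf n puy" "map (\<lambda>(x, y, u). (u, y)) zs"]
      show ?thesis unfolding puyn
        using pmf_replicate_pmf_map[of zs puy "\<lambda>(x, y, u). (u, y)"]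
        by (simp add: eq len o_def split_beta')
    qed
    ultimately show "pmf (map_pmf (\<lambda>(xs, ys, us). us) Jn) us * pmf (map_pmf snd Pn) ys
      \<le> b powr (n * (measure_pmf.expectation J i2 + \<epsilon>)) * pmf (map_pmf (\<lambda>(xs, ys, us). (us, ys)) Jn) (us, ys)"
      by (simp add: pun pyn)
  qed (use pos in auto)
  have "measure_pmf.prob Jn (- unz ` Gz) \<le> V / (n * \<epsilon>\<^sup>2)"
  proof -
    have "measure_pmf.prob Jn (- unz ` Gz) = measure_pmf.prob (replicate_pmf n J) {zs. unz zs \<notin> unz ` Gz}"
      by (simp add: Jn vimage_def)
    also have "\<dots> = measure_pmf.prob (replicate_pmf n J) ({zs. unz zs \<notin> unz ` Gz} \<inter> set_pmf (replicate_pmf n J))"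
      by (simp add: measure_Int_set_pmf)
    also have "\<dots> \<le> measure_pmf.prob (replicate_pmf n J) (\<Union>\<psi>\<in>\<Psi>. {zs. \<not> (\<Sum>z\<leftarrow>zs. \<psi> z) \<le> n * (measure_pmf.expectation J \<psi> + \<epsilon>)})"
      by (rule measure_pmf.finite_measure_mono) (auto simp: Gz_def set_replicate_pmf)
    also have "\<dots> \<le> (\<Sum>\<psi>\<in>\<Psi>. measure_pmf.prob (replicate_pmf n J) {zs. \<not> (\<Sum>z\<leftarrow>zs. \<psi> z) \<le> n * (measure_pmf.expectation J \<psi> + \<epsilon>)})"
      by (rule measure_pmf.finite_measure_subadditive_finite) (use fin\<Psi> in auto)
    also have "\<dots> \<le> (\<Sum>\<psi>\<in>\<Psi>. measure_pmf.expectation J (\<lambda>z. (\<psi> z - measure_pmf.expectation J \<psi>)\<^sup>2) / (n * \<epsilon>\<^sup>2))"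
      by (intro sum_mono weak_law_replicate_pmf finJ) (use pos in auto)
    finally show ?thesis by (simp add: V_def sum_divide_distrib)
  qed
  then have *: "measure_pmf.prob Jn (- unz ` Gz) / s \<le> V / (n * \<epsilon>\<^sup>2) / s"
    using pos by (intro divide_right_mono) auto
  have "measure_pmf.prob (replicate_pmf n P) {xys. \<not> good xys (\<phi> (f (map fst xys)) (map snd xys))}
    \<le> measure_pmf.prob (replicate_pmf n P) {xys. (map fst xys, map snd xys, \<phi> (f (map fst xys)) (map snd xys)) \<notin> unz ` Gz}"
  proof (rule measure_pmf.finite_measure_mono, rule subsetI, rule CollectI, rule notI)
    fix xys assume "xys \<in> {xys. \<not> good xys (\<phi> (f (map fst xys)) (map snd xys))}"
      and "(map fst xys, map snd xys, \<phi> (f (map fst xys)) (map snd xys)) \<in> unz ` Gz"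
    then obtain zs where zs: "zs \<in> Gz" "map fst xys = map (\<lambda>(x, y, u). x) zs" "map snd xys = map (\<lambda>(x, y, u). y) zs"
       "\<phi> (f (map fst xys)) (map snd xys) = map (\<lambda>(x, y, u). u) zs"
      by (auto simp: unz_def)
    have "xys = zip (map fst xys) (map snd xys)" by (simp add: zip_map_fst_snd)
    also have "\<dots> = map (\<lambda>(x, y, u). (x, y)) zs"
      unfolding zs(2,3) by (simp add: zip_map_map zip_same_conv_map split_beta')
    finally have "good xys (\<phi> (f (map fst xys)) (map snd xys))"
      using zs(1,4) unfolding good_def Gz_def by blast
    with \<open>xys \<in> _\<close> show False by blast
  qed simp
  also have "\<dots> = measure_pmf.prob Pn {(xs, ys). (xs, ys, \<phi> (f xs) ys) \<notin> unz ` Gz}"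
    by (simp add: Pn_def vimage_def)
  finally show ?thesis using fail * by (intro that[of f \<phi>] f) linarith
qed

text \<open>The sum \<open>I1 + I2\<close> is \<open>I(X;U) - I(U;Y)\<close>, which equals
  \<open>I(X;U|Y)\<close> because \<open>U\<close> and \<open>Y\<close> are independent given
  \<open>X\<close>. Covering dictates the number of codewords, packing how many of them may share a
  bin.\<close>

lemma wyner_ziv_coding:
  fixes P :: "('x \<times> 'y) pmf" and PU :: "'x \<Rightarrow> 'u pmf" and R \<epsilon> \<kappa> :: real
  assumes finP: "finite (set_pmf P)" and finPU: "\<And>x. finite (set_pmf (PU x))"
  defines "J \<equiv> P \<bind> (\<lambda>(x, y). map_pmf (\<lambda>u. (x, y, u)) (PU x))"
  defines "pu \<equiv> map_pmf (\<lambda>(x, y, u). u) J" and "puy \<equiv> map_pmf (\<lambda>(x, y, u). (u, y)) J"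
  defines "I1 \<equiv> measure_pmf.expectation J (\<lambda>(x, y, u). log b (pmf (PU x) u / pmf pu u))"
    and "I2 \<equiv> measure_pmf.expectation J (\<lambda>(x, y, u). log b (pmf pu u * pmf (map_pmf snd P) y / pmf puy (u, y)))"
  assumes fin\<Psi>: "finite \<Psi>" and I: "0 \<le> I1" "I1 + I2 \<le> R" "0 \<le> R" and pos: "0 < \<epsilon>" "0 < \<kappa>"
  defines "good \<equiv> \<lambda>n xys us. \<exists>zs. length zs = n \<and> xys = map (\<lambda>(x, y, u). (x, y)) zs \<and> us = map (\<lambda>(x, y, u). u) zs \<and>
      (\<forall>\<psi>\<in>\<Psi>. (\<Sum>z\<leftarrow>zs. \<psi> z) \<le> n * (measure_pmf.expectation J \<psi> + \<epsilon>))"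
  shows "\<forall>\<^sub>F n in sequentially. \<exists>K f \<phi>. 0 < K \<and> (\<forall>xs. f xs < K) \<and> log b (real K) \<le> n * (R + 4 * \<epsilon>) \<and>
    measure_pmf.prob (replicate_pmf n P) {xys. \<not> good n xys (\<phi> (f (map fst xys)) (map snd xys))} \<le> \<kappa>"
proof -
  define i1 where "i1 = (\<lambda>(x :: 'x, y :: 'y, u). log b (pmf (PU x) u / pmf pu u))"
  define i2 where "i2 = (\<lambda>(x :: 'x, y, u). log b (pmf pu u * pmf (map_pmf snd P) y / pmf puy (u, y)))"
  define \<Psi>' where "\<Psi>' = \<Psi> \<union> {i1, i2}"
  define V where "V = (\<Sum>\<psi>\<in>\<Psi>'. measure_pmf.expectation J (\<lambda>z. (\<psi> z - measure_pmf.expectation J \<psi>)\<^sup>2))"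
  \<comment> \<open>With \<open>s \<le> \<kappa> / 4\<close> and the vanishing terms below
    \<open>\<kappa> / 2\<close> the total stays below \<open>\<kappa>\<close>; the bound 1/2 ensures
    \<open>s < 1\<close>.\<close>
  define s where "s = min (\<kappa> / 4) (1 / 2)"
  have s: "0 < s" "s < 1" "s \<le> \<kappa> / 4" using pos by (auto simp: s_def)
  define q where "q = b powr (- \<epsilon>)"
  have q: "0 < q" "q < 1" using b_gt_1 pos by (auto simp: q_def powr_less_one)
  \<comment> \<open>The factor 5 adds one \<open>q ^ n\<close> from covering and four from packing,
    where the rounding of \<open>M\<close> and that of \<open>K\<close> cost a factor 2
    each.\<close>
  have "(\<lambda>n. V / (real n * \<epsilon>\<^sup>2) / s + 5 * q ^ n) \<longlonglongrightarrow> 0 + 5 * 0"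
  proof (intro tendsto_add tendsto_mult tendsto_const LIMSEQ_realpow_zero)
    have "(\<lambda>n. V / (\<epsilon>\<^sup>2 * s) * (1 / real n)) \<longlonglongrightarrow> V / (\<epsilon>\<^sup>2 * s) * 0"
      by (intro tendsto_mult tendsto_const lim_1_over_n)
    then show "(\<lambda>n. V / (real n * \<epsilon>\<^sup>2) / s) \<longlonglongrightarrow> 0" by (simp add: field_simps)
  qed (use q in auto)
  then have "\<forall>\<^sub>F n in sequentially. V / (real n * \<epsilon>\<^sup>2) / s + 5 * q ^ n < \<kappa> / 2"
    by (rule order_tendstoD(2)) (use pos in auto)
  then show ?thesis
    using eventually_gt_at_top[of 0]
  proof eventually_elim
    case (elim n)
    define B where "B t = b powr (n * t)" for t :: real
    have B_add: "B (t + t') = B t * B t'" for t t' by (simp add: B_def powr_add ring_distribs)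
    have B_pos: "0 < B t" for t using b_gt_1 by (simp add: B_def)
    have B_mono: "B t \<le> B t'" if "t \<le> t'" for t t' unfolding B_def using b_gt_1 that by (intro powr_mono mult_left_mono) auto
    have B_ge_1: "1 \<le> B t" if "0 \<le> t" for t using B_mono[OF that] b_gt_1 by (simp add: B_def)
    have Bq: "B (- \<epsilon>) = q ^ n"
      using b_gt_1 q by (simp add: B_def q_def powr_realpow[symmetric] powr_powr mult.commute)
    \<comment> \<open>The surplus \<open>2 * \<epsilon>\<close> exceeds the
      \<open>\<epsilon>\<close> in the covering constant, so the mean number of hits is at least
      \<open>B \<epsilon>\<close>. The packing exponent becomes
      \<open>I1 + I2 + 3 * \<epsilon>\<close>, and the \<open>4 * \<epsilon>\<close> in
      \<open>K\<close> beats it by one \<open>\<epsilon>\<close>, which is where \<open>q\<close>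
      comes from.\<close>
    define M where "M = nat \<lceil>B (I1 + 2 * \<epsilon>)\<rceil>"
    define K where "K = nat \<lfloor>B (R + 4 * \<epsilon>)\<rfloor>"
    have M1: "1 \<le> B (I1 + 2 * \<epsilon>)" using I pos by (intro B_ge_1) simp
    have K1: "1 \<le> B (R + 4 * \<epsilon>)" using I pos by (intro B_ge_1) simp
    have M: "B (I1 + 2 * \<epsilon>) \<le> real M" "real M \<le> 2 * B (I1 + 2 * \<epsilon>)" "0 < M" using M1 by (simp_all add: M_def; linarith)+
    have K: "real K \<le> B (R + 4 * \<epsilon>)" "B (R + 4 * \<epsilon>) \<le> 2 * real K" "0 < K"
    proof -
      have "1 \<le> \<lfloor>B (R + 4 * \<epsilon>)\<rfloor>" using K1 by (simp add: le_floor_iff)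
      then have "real K = of_int \<lfloor>B (R + 4 * \<epsilon>)\<rfloor>" "0 < K" "1 \<le> real K" by (simp_all add: K_def)
      then show "real K \<le> B (R + 4 * \<epsilon>)" "B (R + 4 * \<epsilon>) \<le> 2 * real K" "0 < K"
        using floor_correct[of "B (R + 4 * \<epsilon>)"] by linarith+
    qed
    obtain f \<phi> where f: "\<And>xs. f xs < K" and fail:
      "measure_pmf.prob (replicate_pmf n P) {xys. \<not> (\<exists>zs. length zs = n \<and> xys = map (\<lambda>(x, y, u). (x, y)) zs \<and>
         \<phi> (f (map fst xys)) (map snd xys) = map (\<lambda>(x, y, u). u) zs \<and>
        (\<forall>\<psi>\<in>\<Psi>'. (\<Sum>z\<leftarrow>zs. \<psi> z) \<le> n * (measure_pmf.expectation J \<psi> + \<epsilon>)))}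
      \<le> V / (n * \<epsilon>\<^sup>2) / s + s + exp (- (M / B (I1 + \<epsilon>))) + M * B (I2 + \<epsilon>) / K"
      unfolding V_def B_def I1_def I2_def i1_def[symmetric] i2_def[symmetric] J_def
      by (rule coding_block[where P = P and PU = PU and \<Psi> = \<Psi>' and \<epsilon> = \<epsilon> and n = n and M = M and K = K and s = s, OF finP finPU, folded J_def, folded pu_def puy_def, folded i1_def i2_def])
         (use fin\<Psi> pos elim M K s in \<open>auto simp: \<Psi>'_def J_def\<close>)
    have "exp (- (M / B (I1 + \<epsilon>))) \<le> q ^ n"
    proof -
      have "B \<epsilon> * B (I1 + \<epsilon>) = B (I1 + 2 * \<epsilon>)"
        by (subst B_add[symmetric], rule arg_cong[where f = B]) simp
      then have "B \<epsilon> * B (I1 + \<epsilon>) \<le> M" using M(1) by simp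
      then have "B \<epsilon> \<le> M / B (I1 + \<epsilon>)" using B_pos by (simp add: pos_le_divide_eq)
      also have "\<dots> \<le> exp (M / B (I1 + \<epsilon>))" using exp_ge_add_one_self[of "M / B (I1 + \<epsilon>)"] by linarith
      finally have "exp (- (M / B (I1 + \<epsilon>))) \<le> 1 / B \<epsilon>"
        using B_pos[of \<epsilon>] by (simp add: exp_minus inverse_eq_divide frac_le)
      also have "\<dots> = B (- \<epsilon>)" using B_add[of \<epsilon> "- \<epsilon>"] B_pos[of \<epsilon>] by (simp add: B_def field_simps)
      finally show ?thesis by (simp add: Bq)
    qed
    moreover have "M * B (I2 + \<epsilon>) / K \<le> 4 * q ^ n"
    proof -
      have "M * B (I2 + \<epsilon>) \<le> 2 * B (I1 + 2 * \<epsilon>) * B (I2 + \<epsilon>)"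
        using M(2) B_pos[of "I2 + \<epsilon>"] by (intro mult_right_mono) auto
      also have "\<dots> = 2 * B (I1 + I2 + 3 * \<epsilon>)"
        by (subst mult.assoc, subst B_add[symmetric], rule arg_cong[where f = "\<lambda>t. 2 * B t"]) simp
      also have "\<dots> \<le> 2 * B (- \<epsilon> + (R + 4 * \<epsilon>))" using I by (intro mult_left_mono B_mono) auto
      also have "\<dots> = 2 * q ^ n * B (R + 4 * \<epsilon>)" using B_add[of "- \<epsilon>" "R + 4 * \<epsilon>"] by (simp add: Bq)
      also have "\<dots> \<le> 2 * q ^ n * (2 * real K)" using K(2) q by (intro mult_left_mono) auto
      finally show ?thesis using K(3) by (simp add: field_simps)
    qed
    ultimately have total: "V / (n * \<epsilon>\<^sup>2) / s + s + exp (- (M / B (I1 + \<epsilon>))) + M * B (I2 + \<epsilon>) / K \<le> \<kappa>"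
      using elim(1) s(3) pos by linarith
    have "measure_pmf.prob (replicate_pmf n P) {xys. \<not> good n xys (\<phi> (f (map fst xys)) (map snd xys))}
      \<le> measure_pmf.prob (replicate_pmf n P) {xys. \<not> (\<exists>zs. length zs = n \<and> xys = map (\<lambda>(x, y, u). (x, y)) zs \<and>
         \<phi> (f (map fst xys)) (map snd xys) = map (\<lambda>(x, y, u). u) zs \<and>
        (\<forall>\<psi>\<in>\<Psi>'. (\<Sum>z\<leftarrow>zs. \<psi> z) \<le> n * (measure_pmf.expectation J \<psi> + \<epsilon>)))}"
      by (rule measure_pmf.finite_measure_mono) (auto simp: good_def \<Psi>'_def)
    then have "measure_pmf.prob (replicate_pmf n P) {xys. \<not> good n xys (\<phi> (f (map fst xys)) (map snd xys))} \<le> \<kappa>"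
      using fail total by linarith
    moreover have "log b (real K) \<le> n * (R + 4 * \<epsilon>)"
    proof -
      have "log b (real K) \<le> log b (B (R + 4 * \<epsilon>))" using K b_gt_1 by (simp add: log_le_cancel_iff B_pos)
      then show ?thesis using b_gt_1 by (simp add: B_def)
    qed
    ultimately show ?case using f K(3) by blast
  qed
qed

end

subsection \<open>Achievability\<close>

lemma pmf_seq_pmf_nth:
  assumes "length as = length ps"
  shows "pmf (seq_pmf ps) as = (\<Prod>i<length ps. pmf (ps ! i) (as ! i))"
  using assms
proof (induction as ps rule: list_induct2)
  case (Cons a as p ps)
  have "inj (\<lambda>(a, as). a # as :: 'a list)" by (auto simp: inj_on_def)
  from pmf_map_inj'[OF this, of _ "(a, as)"]
  have "pmf (seq_pmf (p # ps)) (a # as) = pmf p a * pmf (seq_pmf ps) as"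
    unfolding seq_pmf_Cons_pair by (simp add: pmf_bind_Pair)
  then show ?case by (simp add: Cons prod.lessThan_Suc_shift del: prod.lessThan_Suc)
qed simp

lemma expectation_seq_pmf_sum:
  fixes k :: "'z \<Rightarrow> 'a \<Rightarrow> real"
  assumes fin: "\<And>z. z \<in> set zs \<Longrightarrow> finite (set_pmf (p z))"
  shows "measure_pmf.expectation (seq_pmf (map p zs)) (\<lambda>as. \<Sum>i<length zs. k (zs ! i) (as ! i))
    = (\<Sum>z\<leftarrow>zs. measure_pmf.expectation (p z) (k z))"
  using fin
proof (induction zs)
  case (Cons z zs)
  let ?R = "seq_pmf (map p zs)"
  have finR: "finite (set_pmf ?R)" using Cons.prems by (intro finite_set_seq_pmf) auto
  have finz: "finite (set_pmf (p z))" using Cons.prems by auto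
  have "measure_pmf.expectation (seq_pmf (map p (z # zs))) (\<lambda>as. \<Sum>i<length (z # zs). k ((z # zs) ! i) (as ! i))
    = measure_pmf.expectation (p z) (\<lambda>a. measure_pmf.expectation ?R (\<lambda>as. k z a + (\<Sum>i<length zs. k (zs ! i) (as ! i))))"
    using finz finR by (simp add: expectation_bind_finite sum.lessThan_Suc_shift del: sum.lessThan_Suc)
  also have "\<dots> = measure_pmf.expectation (p z) (\<lambda>a. k z a + (\<Sum>z\<leftarrow>zs. measure_pmf.expectation (p z) (k z)))"
    using Cons by (simp add: expectation_add_finite[OF finR])
  also have "\<dots> = (\<Sum>z\<leftarrow>z # zs. measure_pmf.expectation (p z) (k z))"
    by (simp add: expectation_add_finite[OF finz])
  finally show ?case .
qed simp

section \<open>Distortion and equivocation of a letterwise decoder\<close>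

context entropy_base
begin

lemma H_seq_pmf:
  assumes "\<And>z. z \<in> set zs \<Longrightarrow> finite (set_pmf (p z))"
  shows "H (seq_pmf (map p zs)) = (\<Sum>z\<leftarrow>zs. H (p z))"
  using assms
proof (induction zs)
  case Nil
  then show ?case by (simp add: H_def)
next
  case (Cons z zs)
  have finR: "finite (set_pmf (seq_pmf (map p zs)))" using Cons.prems by (intro finite_set_seq_pmf) auto
  have "H (seq_pmf (map p (z # zs))) = H (p z \<bind> (\<lambda>a. map_pmf (Pair a) (seq_pmf (map p zs))))"
    unfolding list.map seq_pmf_Cons_pair by (rule H_map_inj) (auto simp: inj_on_def)
  also have "\<dots> = H (p z) + H (seq_pmf (map p zs))"
    using Cons.prems finR by (simp add: H_bind_Pair)
  finally show ?case using Cons by simp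
qed

lemma log_prod:
  assumes "finite I" "\<And>i. i \<in> I \<Longrightarrow> 0 < v i"
  shows "log b (\<Prod>i\<in>I. v i) = (\<Sum>i\<in>I. log b (v i))"
  using assms ln_prod[of I v] by (force simp: log_def sum_divide_distrib)

text \<open>The reconstruction \<open>dec\<close> may be right or wrong: \<open>S \<psi>\<close> is
  the mean of the sum of \<open>\<psi>\<close> over the letters of the source and of the codeword
  actually returned. \<open>V h y\<close> is a guess at the law of \<open>x\<close>; its positivity
  makes the logarithms legitimate for whatever letters occur.\<close>

lemma code_from_decoder:
  fixes P :: "('x::finite \<times> 'y::finite) pmf" and PH :: "'u \<Rightarrow> 'y \<Rightarrow> 'h::finite pmf"
    and dec :: "nat \<Rightarrow> 'y list \<Rightarrow> 'u list" and V :: "'h \<Rightarrow> 'y \<Rightarrow> 'x pmf"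
  assumes len: "\<And>w ys. length (dec w ys) = n" and f: "\<And>xs. f xs < K"
    and V: "\<And>x h y. 0 < pmf (V h y) x"
  defines "g \<equiv> \<lambda>w ys. seq_pmf (map2 PH (dec w ys) ys)"
    and "S \<equiv> \<lambda>\<psi> :: 'x \<times> 'y \<times> 'u \<Rightarrow> real. measure_pmf.expectation (replicate_pmf n P)
       (\<lambda>xys. \<Sum>((x, y), u)\<leftarrow>zip xys (dec (f (map fst xys)) (map snd xys)). \<psi> (x, y, u))"
  defines "Q \<equiv> code_joint P n f g"
  shows "is_code n {..<K} f g"
    and "measure_pmf.expectation Q (\<lambda>(xs, ys, hs). block_distortion F d n xs ys hs)
      = S (\<lambda>(x, y, u). measure_pmf.expectation (PH u y) (d (F x y))) / n"
    and "n * (H P - H (map_pmf snd P)) + S (\<lambda>(x, y, u). H (PH u y))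
        - S (\<lambda>(x, y, u). measure_pmf.expectation (PH u y) (\<lambda>h. - log b (pmf (V h y) x)))
      \<le> ent Q (\<lambda>(xs, ys, hs). (hs, ys)) - ent Q (\<lambda>(xs, ys, hs). ys)"
proof -
  show code: "is_code n {..<K} f g"
    using f by (auto simp: is_code_def g_def len dest!: length_seq_pmf)
  note finQ = finite_set_code_joint(1)[OF code, of P, folded Q_def]
  note lenQ = finite_set_code_joint(2)[OF code, of _ _ _ P, folded Q_def]
  define R where "R = replicate_pmf n P"
  have finR: "finite (set_pmf R)" by (simp add: R_def finite_set_replicate_pmf)
  define zs where "zs xys = map (\<lambda>((x, y), u). (x, y, u)) (zip xys (dec (f (map fst xys)) (map snd xys)))"
    for xys :: "('x \<times> 'y) list"
  have S_eq: "S \<psi> = measure_pmf.expectation R (\<lambda>xys. \<Sum>z\<leftarrow>zs xys. \<psi> z)" for \<psi>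
    by (simp add: S_def R_def zs_def o_def split_beta')
  have zs: "length (zs xys) = n" "\<And>i. i < n \<Longrightarrow> zs xys ! i = (fst (xys ! i), snd (xys ! i), dec (f (map fst xys)) (map snd xys) ! i)"
    and g_zs: "g (f (map fst xys)) (map snd xys) = seq_pmf (map (\<lambda>(x, y, u). PH u y) (zs xys))"
    if "xys \<in> set_pmf R" for xys
  proof -
    have l: "length xys = n" using that by (auto simp: R_def dest: length_replicate_pmf)
    then show "length (zs xys) = n" by (simp add: zs_def len)
    show "\<And>i. i < n \<Longrightarrow> zs xys ! i = (fst (xys ! i), snd (xys ! i), dec (f (map fst xys)) (map snd xys) ! i)"
      using l by (simp add: zs_def len split_beta')
    have "map2 PH (dec (f (map fst xys)) (map snd xys)) (map snd xys) = map (\<lambda>(x, y, u). PH u y) (zs xys)"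
      using l by (intro nth_equalityI) (simp_all add: zs_def len split_beta')
    then show "g (f (map fst xys)) (map snd xys) = seq_pmf (map (\<lambda>(x, y, u). PH u y) (zs xys))"
      by (simp add: g_def)
  qed
  have letterwise: "measure_pmf.expectation Q (\<lambda>(xs, ys, hs). \<Sum>i<n. k (xs ! i) (ys ! i) (hs ! i))
    = S (\<lambda>(x, y, u). measure_pmf.expectation (PH u y) (k x y))" for k :: "'x \<Rightarrow> 'y \<Rightarrow> 'h \<Rightarrow> real"
  proof -
    have "Q = R \<bind> (\<lambda>xys. map_pmf (\<lambda>hs. (map fst xys, map snd xys, hs)) (g (f (map fst xys)) (map snd xys)))"
      by (simp add: Q_def code_joint_def R_def map_pmf_def)
    then have "measure_pmf.expectation Q (\<lambda>(xs, ys, hs). \<Sum>i<n. k (xs ! i) (ys ! i) (hs ! i))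
      = measure_pmf.expectation R (\<lambda>xys. measure_pmf.expectation (g (f (map fst xys)) (map snd xys))
          (\<lambda>hs. \<Sum>i<n. k (map fst xys ! i) (map snd xys ! i) (hs ! i)))"
      using finR by (simp add: expectation_bind_finite g_def finite_set_seq_pmf)
    also have "\<dots> = measure_pmf.expectation R (\<lambda>xys. \<Sum>z\<leftarrow>zs xys. (\<lambda>(x, y, u). measure_pmf.expectation (PH u y) (k x y)) z)"
    proof (rule expectation_cong_set_pmf)
      fix xys assume xys: "xys \<in> set_pmf R"
      then have l: "length xys = n" by (auto simp: R_def dest: length_replicate_pmf)
      have "(\<lambda>hs. \<Sum>i<n. k (map fst xys ! i) (map snd xys ! i) (hs ! i))
        = (\<lambda>hs. \<Sum>i<length (zs xys). (\<lambda>(x, y, u). k x y) (zs xys ! i) (hs ! i))"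
        by (rule ext, rule sum.cong) (simp_all add: zs[OF xys] l)
      with expectation_seq_pmf_sum[of "zs xys" "\<lambda>(x, y, u). PH u y" "\<lambda>(x, y, u). k x y"]
      show "measure_pmf.expectation (g (f (map fst xys)) (map snd xys))
          (\<lambda>hs. \<Sum>i<n. k (map fst xys ! i) (map snd xys ! i) (hs ! i))
        = (\<Sum>z\<leftarrow>zs xys. (\<lambda>(x, y, u). measure_pmf.expectation (PH u y) (k x y)) z)"
        unfolding g_zs[OF xys] by (simp add: split_beta')
    qed
    finally show ?thesis by (simp add: S_eq)
  qed
  show "measure_pmf.expectation Q (\<lambda>(xs, ys, hs). block_distortion F d n xs ys hs)
      = S (\<lambda>(x, y, u). measure_pmf.expectation (PH u y) (d (F x y))) / n"
    using letterwise[of "\<lambda>x y. d (F x y)"] by (simp add: block_distortion_def split_beta')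
  \<comment> \<open>Given \<open>(X, Y)\<close> the returned codeword is fixed and the output
    letters are independent, so \<open>H(Xh|X,Y)\<close> is a sum over letters.\<close>
  have "ent Q (\<lambda>(xs, ys, hs). (hs, (xs, ys))) - ent Q (\<lambda>(xs, ys, hs). (xs, ys))
     = measure_pmf.expectation R (\<lambda>xys. H (g (f (map fst xys)) (map snd xys)))"
    unfolding Q_def R_def by (rule ent_code_kernel[OF code, of "\<lambda>(xs, ys). g (f xs) ys"]) simp
  also have "\<dots> = measure_pmf.expectation R (\<lambda>xys. \<Sum>z\<leftarrow>zs xys. (\<lambda>(x, y, u). H (PH u y)) z)"
    by (rule expectation_cong_set_pmf) (simp add: g_zs H_seq_pmf split_beta')
  finally have 1: "ent Q (\<lambda>(xs, ys, hs). (hs, xs, ys)) - ent Q (\<lambda>(xs, ys, hs). (xs, ys)) = S (\<lambda>(x, y, u). H (PH u y))"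
    by (simp add: S_eq)
  \<comment> \<open>Guess for \<open>P(X|Xh,Y)\<close> in \<open>gibbs\<close>: the product of the
    letter laws \<open>V\<close>, which makes the cross entropy a sum over letters.\<close>
  define r where "r xs c = (case c of (hs, ys) \<Rightarrow> pmf (seq_pmf (map2 V hs ys)) xs)" for xs c
  have r: "r xs (hs, ys) = (\<Prod>i<n. pmf (V (hs ! i) (ys ! i)) (xs ! i))"
    if "length xs = n" "length ys = n" "length hs = n" for xs hs ys
    using that by (simp add: r_def pmf_seq_pmf_nth)
  have "ent Q (\<lambda>\<omega>. ((\<lambda>(xs, ys, hs). xs) \<omega>, (\<lambda>(xs, ys, hs). (hs, ys)) \<omega>)) - ent Q (\<lambda>(xs, ys, hs). (hs, ys))
    \<le> measure_pmf.expectation Q (\<lambda>\<omega>. - log b (r ((\<lambda>(xs, ys, hs). xs) \<omega>) ((\<lambda>(xs, ys, hs). (hs, ys)) \<omega>)))"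
  proof (rule gibbs[OF finQ])
    fix \<omega> assume "\<omega> \<in> set_pmf Q"
    then show "0 < r ((\<lambda>(xs, ys, hs). xs) \<omega>) ((\<lambda>(xs, ys, hs). (hs, ys)) \<omega>)"
      using lenQ by (cases \<omega>) (auto simp: r V intro!: prod_pos)
  next
    fix c :: "'h list \<times> 'y list"
    let ?T = "{a. (a, c) \<in> (\<lambda>\<omega>. ((\<lambda>(xs, ys, hs). xs) \<omega>, (\<lambda>(xs, ys, hs). (hs, ys)) \<omega>)) ` set_pmf Q}"
    have "?T \<subseteq> (\<lambda>(xs, ys, hs). xs) ` set_pmf Q" by force
    then have "finite ?T" using finQ finite_subset by blast
    then have "(\<Sum>a\<in>?T. r a c) = measure_pmf.prob (seq_pmf (map2 V (fst c) (snd c))) ?T"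
      by (simp add: r_def split_beta' measure_measure_pmf_finite)
    then show "(\<Sum>a\<in>?T. r a c) \<le> 1" by simp
  qed
  also have "\<dots> = measure_pmf.expectation Q (\<lambda>(xs, ys, hs). \<Sum>i<n. - log b (pmf (V (hs ! i) (ys ! i)) (xs ! i)))"
  proof (rule expectation_cong_set_pmf)
    fix \<omega> assume "\<omega> \<in> set_pmf Q"
    then show "- log b (r ((\<lambda>(xs, ys, hs). xs) \<omega>) ((\<lambda>(xs, ys, hs). (hs, ys)) \<omega>))
      = (case \<omega> of (xs, ys, hs) \<Rightarrow> \<Sum>i<n. - log b (pmf (V (hs ! i) (ys ! i)) (xs ! i)))"
      using lenQ by (cases \<omega>) (simp add: r log_prod V sum_negf)
  qed
  also have "\<dots> = S (\<lambda>(x, y, u). measure_pmf.expectation (PH u y) (\<lambda>h. - log b (pmf (V h y) x)))"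
    by (rule letterwise)
  finally have 2: "ent Q (\<lambda>(xs, ys, hs). (xs, hs, ys)) - ent Q (\<lambda>(xs, ys, hs). (hs, ys))
     \<le> S (\<lambda>(x, y, u). measure_pmf.expectation (PH u y) (\<lambda>h. - log b (pmf (V h y) x)))"
    by (simp add: split_beta')
  have "ent Q (\<lambda>(xs, ys, hs). (xs, hs, ys)) = ent Q (\<lambda>(xs, ys, hs). (hs, xs, ys))"
    by (rule ent_cong_inj) auto
  then show "n * (H P - H (map_pmf snd P)) + S (\<lambda>(x, y, u). H (PH u y))
        - S (\<lambda>(x, y, u). measure_pmf.expectation (PH u y) (\<lambda>h. - log b (pmf (V h y) x)))
      \<le> ent Q (\<lambda>(xs, ys, hs). (hs, ys)) - ent Q (\<lambda>(xs, ys, hs). ys)"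
    using 1 2 code_joint_source[of P n f g, folded Q_def] by (simp add: right_diff_distrib)
qed

text \<open>Off \<open>Bad\<close> the sum is at most \<open>n * t\<close>; on \<open>Bad\<close> it
  is at most \<open>n * B\<close>, which exceeds \<open>n * t\<close> by no more than
  \<open>n * (2 * B)\<close> because \<open>t \<ge> - B\<close>.\<close>

lemma typical_decoder_expectation:
  fixes P :: "('x::finite \<times> 'y::finite) pmf" and dec :: "nat \<Rightarrow> 'y list \<Rightarrow> 'u list"
    and \<psi> :: "'x \<times> 'y \<times> 'u \<Rightarrow> real" and t B \<kappa> :: real
  assumes len: "\<And>w ys. length (dec w ys) = n" and B: "\<And>z. \<bar>\<psi> z\<bar> \<le> B"
    and good: "\<And>xys. xys \<in> set_pmf (replicate_pmf n P) \<Longrightarrow> xys \<notin> Bad \<Longrightarrow>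
      (\<Sum>((x, y), u)\<leftarrow>zip xys (dec (f (map fst xys)) (map snd xys)). \<psi> (x, y, u)) \<le> n * t"
    and Bad: "measure_pmf.prob (replicate_pmf n P) Bad \<le> \<kappa>" and t: "- B \<le> t"
  shows "measure_pmf.expectation (replicate_pmf n P)
       (\<lambda>xys. \<Sum>((x, y), u)\<leftarrow>zip xys (dec (f (map fst xys)) (map snd xys)). \<psi> (x, y, u)) \<le> n * (t + 2 * B * \<kappa>)"
proof -
  let ?R = "replicate_pmf n P"
  have finR: "finite (set_pmf ?R)" by (simp add: finite_set_replicate_pmf)
  have B0: "0 \<le> B" using B[of undefined] by linarith
  have sum_le: "(\<Sum>((x, y), u)\<leftarrow>ws. \<psi> (x, y, u)) \<le> length ws * B" for ws
  proof (induction ws)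
    case (Cons w ws)
    obtain x y u where w: "w = ((x, y), u)" by (cases w) auto
    show ?case using Cons B[of "(x, y, u)"] by (simp add: w algebra_simps)
  qed simp
  have "measure_pmf.expectation ?R
       (\<lambda>xys. \<Sum>((x, y), u)\<leftarrow>zip xys (dec (f (map fst xys)) (map snd xys)). \<psi> (x, y, u))
    \<le> measure_pmf.expectation ?R (\<lambda>xys. n * t + (n * (2 * B)) * of_bool (xys \<in> Bad))"
  proof (rule expectation_mono_finite[OF finR])
    fix xys assume xys: "xys \<in> set_pmf ?R"
    show "(\<Sum>((x, y), u)\<leftarrow>zip xys (dec (f (map fst xys)) (map snd xys)). \<psi> (x, y, u))
      \<le> n * t + (n * (2 * B)) * of_bool (xys \<in> Bad)"
    proof (cases "xys \<in> Bad")
      case True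
      have "(\<Sum>((x, y), u)\<leftarrow>zip xys (dec (f (map fst xys)) (map snd xys)). \<psi> (x, y, u)) \<le> n * B"
        using sum_le[of "zip xys (dec (f (map fst xys)) (map snd xys))"] length_replicate_pmf[OF xys] len by simp
      also have "\<dots> \<le> n * (t + 2 * B)" using t by (intro mult_left_mono) auto
      finally show ?thesis using True by (simp add: ring_distribs)
    qed (use good xys in auto)
  qed
  also have "\<dots> = n * t + n * (2 * B) * measure_pmf.prob ?R Bad"
    using prob_eq_expectation[of ?R "\<lambda>xys. xys \<in> Bad"] by (simp add: expectation_add_finite[OF finR])
  also have "\<dots> \<le> n * t + n * (2 * B) * \<kappa>" using Bad B0 by (intro add_left_mono mult_left_mono) auto
  finally show ?thesis by (simp add: algebra_simps)
qed

lemma H_nonneg: "finite (set_pmf p) \<Longrightarrow> 0 \<le> H p"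
  unfolding H_def
  by (rule order_trans[OF _ expectation_mono_finite[where g = "\<lambda>_. 0"]])
     (use b_gt_1 in \<open>auto simp: pmf_le_1 pmf_positive\<close>)

lemma H_le_log_card: "H (p :: 'a::finite pmf) \<le> log b CARD('a)"
proof -
  have "ent p (\<lambda>a. (a, ())) - ent p (\<lambda>_. ()) \<le> log b (card (UNIV :: 'a set))"
    by (rule ent_cond_le_log_card) auto
  moreover have "ent p (\<lambda>a. (a, ())) = H p"
    unfolding ent_def by (rule H_map_inj) (auto simp: inj_on_def)
  moreover have "ent p (\<lambda>_. ()) = 0" by (simp add: ent_def H_def map_pmf_const)
  ultimately show ?thesis by simp
qed

text \<open>These identities link the binning exponents to the single-letter rate: the two means are
  \<open>I(X;U)\<close> and \<open>- I(U;Y)\<close>, the inequality is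
  \<open>I(X;U) \<ge> 0\<close>, and the value of \<open>H J\<close> lets their sum be recognised as
  \<open>I(X;U|Y)\<close>.\<close>

lemma information_densities:
  fixes P :: "('x::finite \<times> 'y::finite) pmf" and PU :: "'x \<Rightarrow> 'u pmf"
  assumes finPU: "\<And>x. finite (set_pmf (PU x))"
  defines "J \<equiv> P \<bind> (\<lambda>(x, y). map_pmf (\<lambda>u. (x, y, u)) (PU x))"
  defines "pu \<equiv> map_pmf (\<lambda>(x, y, u). u) J" and "puy \<equiv> map_pmf (\<lambda>(x, y, u). (u, y)) J"
  shows "measure_pmf.expectation J (\<lambda>(x, y, u). log b (pmf (PU x) u / pmf pu u))
      = H pu - measure_pmf.expectation P (\<lambda>(x, y). H (PU x))" (is "?I1 = _")
    and "measure_pmf.expectation J (\<lambda>(x, y, u). log b (pmf pu u * pmf (map_pmf snd P) y / pmf puy (u, y)))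
      = H puy - H pu - H (map_pmf snd P)" (is "?I2 = _")
    and "measure_pmf.expectation P (\<lambda>(x, y). H (PU x)) \<le> H pu"
    and "H J = H P + measure_pmf.expectation P (\<lambda>(x, y). H (PU x))"
proof -
  have finJ: "finite (set_pmf J)" using finPU by (auto simp: J_def split_beta')
  have py: "map_pmf snd P = map_pmf (\<lambda>(x, y, u). y) J"
    by (simp add: J_def map_bind_pmf pmf.map_comp o_def split_beta' map_pmf_const) (simp add: map_pmf_def)
  have pos: "0 < pmf (PU x) u" "0 < pmf pu u" "0 < pmf (map_pmf snd P) y" "0 < pmf puy (u, y)"
    if "(x, y, u) \<in> set_pmf J" for x y u
    using that by (auto simp: pmf_positive_iff J_def pu_def puy_def image_iff; force)+
  have Hu: "measure_pmf.expectation J (\<lambda>(x, y, u). - log b (pmf pu u)) = H pu"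
    by (simp add: H_def pu_def split_beta')
  have Huy: "measure_pmf.expectation J (\<lambda>(x, y, u). - log b (pmf puy (u, y))) = H puy"
    by (simp add: H_def puy_def split_beta')
  have Hy: "measure_pmf.expectation J (\<lambda>(x, y, u). - log b (pmf (map_pmf snd P) y)) = H (map_pmf snd P)"
    unfolding H_def by (subst (2) py) (simp add: split_beta')
  have Hux: "measure_pmf.expectation J (\<lambda>(x, y, u). - log b (pmf (PU x) u)) = measure_pmf.expectation P (\<lambda>(x, y). H (PU x))"
    unfolding J_def using finPU by (subst expectation_bind_finite) (auto simp: H_def split_beta')
  have "?I1 = measure_pmf.expectation J (\<lambda>z. (\<lambda>(x, y, u). - log b (pmf pu u)) z - (\<lambda>(x, y, u). - log b (pmf (PU x) u)) z)"
  proof (rule expectation_cong_set_pmf)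
    fix z assume "z \<in> set_pmf J"
    moreover obtain x y u where "z = (x, y, u)" by (cases z) auto
    ultimately show "(case z of (x, y, u) \<Rightarrow> log b (pmf (PU x) u / pmf pu u))
      = (\<lambda>(x, y, u). - log b (pmf pu u)) z - (\<lambda>(x, y, u). - log b (pmf (PU x) u)) z"
      using pos[of x y u] by (simp add: log_divide_pos)
  qed
  also have "\<dots> = H pu - measure_pmf.expectation P (\<lambda>(x, y). H (PU x))"
    using finJ by (subst Bochner_Integration.integral_diff) (simp_all only: Hu Hux integrable_finite_pmf)
  finally show I1: "?I1 = H pu - measure_pmf.expectation P (\<lambda>(x, y). H (PU x))" .
  have "?I2 = measure_pmf.expectation J (\<lambda>z. (\<lambda>(x, y, u). - log b (pmf puy (u, y))) z
      - ((\<lambda>(x, y, u). - log b (pmf pu u)) z + (\<lambda>(x, y, u). - log b (pmf (map_pmf snd P) y)) z))"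
  proof (rule expectation_cong_set_pmf)
    fix z assume "z \<in> set_pmf J"
    moreover obtain x y u where "z = (x, y, u)" by (cases z) auto
    ultimately show "(case z of (x, y, u) \<Rightarrow> log b (pmf pu u * pmf (map_pmf snd P) y / pmf puy (u, y)))
      = (\<lambda>(x, y, u). - log b (pmf puy (u, y))) z
      - ((\<lambda>(x, y, u). - log b (pmf pu u)) z + (\<lambda>(x, y, u). - log b (pmf (map_pmf snd P) y)) z)"
      using pos[of x y u] by (simp add: log_divide_pos log_mult_pos)
  qed
  also have "\<dots> = H puy - (H pu + H (map_pmf snd P))"
    using finJ by (subst Bochner_Integration.integral_diff)
      (simp_all only: Hu Huy Hy integrable_finite_pmf expectation_add_finite[OF finJ])
  finally show "?I2 = H puy - H pu - H (map_pmf snd P)" by simp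
  have "J = map_pmf (\<lambda>((x, y), u). (x, y, u)) (P \<bind> (\<lambda>a. map_pmf (Pair a) (PU (fst a))))"
    by (simp add: J_def map_bind_pmf pmf.map_comp o_def split_beta')
  then have "H J = H (P \<bind> (\<lambda>a. map_pmf (Pair a) (PU (fst a))))"
    by (simp only:) (rule H_map_inj, auto simp: inj_on_def)
  also have "\<dots> = H P + measure_pmf.expectation P (\<lambda>(x, y). H (PU x))"
    using finPU by (subst H_bind_Pair) (auto simp: split_beta')
  finally show HJ: "H J = H P + measure_pmf.expectation P (\<lambda>(x, y). H (PU x))" .
  \<comment> \<open>Submodularity with the constant \<open>()\<close> in the middle is the
    inequality \<open>H(U|X,Y) \<le> H(U)\<close>.\<close>
  have "ent J (\<lambda>z. ((\<lambda>(x, y, u). u) z, (), (\<lambda>(x, y, u). (x, y)) z)) - ent J (\<lambda>z. ((), (\<lambda>(x, y, u). (x, y)) z))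
     \<le> ent J (\<lambda>z. ((\<lambda>(x, y, u). u) z, ())) - ent J (\<lambda>z. ())"
    by (rule ent_submodular[OF finJ])
  moreover have "ent J (\<lambda>z. ((\<lambda>(x, y, u). u) z, (), (\<lambda>(x, y, u). (x, y)) z)) = ent J (\<lambda>z. z)"
    by (rule ent_cong_inj) auto
  moreover have "ent J (\<lambda>z. ((), (\<lambda>(x, y, u). (x, y)) z)) = ent J (\<lambda>(x, y, u). (x, y))"
    by (rule ent_cong_inj) auto
  moreover have "map_pmf (\<lambda>(x, y, u). (x, y)) J = P"
    by (simp add: J_def map_bind_pmf pmf.map_comp o_def split_beta' map_pmf_const bind_return_pmf')
  moreover have "ent J (\<lambda>z. ((\<lambda>(x, y, u). u) z, ())) = ent J (\<lambda>(x, y, u). u)"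
    by (rule ent_cong_inj) auto
  moreover have "ent J (\<lambda>_. ()) = 0" by (simp add: ent_def H_def map_pmf_const)
  ultimately show "measure_pmf.expectation P (\<lambda>(x, y). H (PU x)) \<le> H pu"
    using HJ by (simp add: ent_def pu_def map_pmf_ident)
qed

text \<open>Mixing in a little of the uniform distribution bounds the logarithms, at the cost \<open>\<epsilon>\<close>
  in the cross entropy.\<close>

lemma smoothed_conditional:
  fixes Q :: "('x::finite \<times> 'c) pmf"
  assumes fin: "finite (set_pmf Q)" and \<epsilon>: "0 < \<epsilon>"
  obtains V :: "'c \<Rightarrow> 'x pmf" and L :: real where "\<And>c x. 0 < pmf (V c) x" "\<And>c x. - log b (pmf (V c) x) \<le> L"
    "measure_pmf.expectation Q (\<lambda>(x, c). - log b (pmf (V c) x)) \<le> H Q - H (map_pmf snd Q) + \<epsilon>"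
proof -
  \<comment> \<open>Chosen so that the true conditional law keeps the weight
    \<open>b powr (- \<epsilon>)\<close>, whose logarithm costs exactly
    \<open>\<epsilon>\<close>.\<close>
  define \<theta> where "\<theta> = 1 - b powr (- \<epsilon>)"
  have \<theta>: "0 < \<theta>" "\<theta> < 1" "1 - \<theta> = b powr (- \<epsilon>)" using b_gt_1 \<epsilon> by (auto simp: \<theta>_def powr_less_one)
  define Q' where "Q' = map_pmf prod.swap Q"
  obtain K where K: "Q' = map_pmf fst Q' \<bind> (\<lambda>c. map_pmf (Pair c) (K c))"
    using pmf_disintegration by metis
  define V where "V c = bernoulli_pmf \<theta> \<bind> (\<lambda>t. if t then pmf_of_set UNIV else K c)" for c
  have V: "pmf (V c) x = \<theta> / CARD('x) + (1 - \<theta>) * pmf (K c) x" for c x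
    unfolding V_def pmf_bind using \<theta> by (subst expectation_finite_sum[of UNIV]) (auto simp: UNIV_bool)
  have V_pos: "0 < \<theta> / CARD('x)" using \<theta> by simp
  have V_ge: "\<theta> / CARD('x) \<le> pmf (V c) x" "(1 - \<theta>) * pmf (K c) x \<le> pmf (V c) x" for c x
    using \<theta> by (auto simp: V)
  have pos: "0 < pmf (V c) x" for c x using V_ge(1)[of c x] V_pos by linarith
  have L: "- log b (pmf (V c) x) \<le> - log b (\<theta> / CARD('x))" for c x
    using V_ge(1)[of c x] V_pos pos b_gt_1 by simp
  have bound: "- log b (pmf (V c) x) \<le> (- log b (pmf Q (x, c)) + \<epsilon>) - - log b (pmf (map_pmf snd Q) c)"
    if xc: "(x, c) \<in> set_pmf Q" for x c
  proof -
    from xc have p: "0 < pmf Q (x, c)" "0 < pmf (map_pmf snd Q) c" by (auto simp: pmf_positive_iff image_iff; force)+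
    have "map_pmf fst Q' = map_pmf snd Q" by (simp add: Q'_def pmf.map_comp o_def)
    moreover have "pmf Q' (c, x) = pmf Q (x, c)"
      unfolding Q'_def using pmf_map_inj'[of prod.swap Q "(x, c)"] by simp
    moreover have "pmf Q' (c, x) = pmf (map_pmf fst Q') c * pmf (K c) x"
      by (subst K) (rule pmf_bind_Pair)
    ultimately have Kc: "pmf (K c) x = pmf Q (x, c) / pmf (map_pmf snd Q) c" using p by (simp add: field_simps)
    have "b powr (- \<epsilon>) * (pmf Q (x, c) / pmf (map_pmf snd Q) c) \<le> pmf (V c) x"
      using V_ge(2)[of c x] by (simp add: Kc \<theta>(3)[symmetric])
    then have "log b (b powr (- \<epsilon>) * (pmf Q (x, c) / pmf (map_pmf snd Q) c)) \<le> log b (pmf (V c) x)"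
      using b_gt_1 p pos by (subst log_le_cancel_iff) auto
    moreover have "log b (b powr (- \<epsilon>) * (pmf Q (x, c) / pmf (map_pmf snd Q) c))
       = - \<epsilon> + (log b (pmf Q (x, c)) - log b (pmf (map_pmf snd Q) c))"
      using b_gt_1 p by (subst log_mult_pos) (auto simp: log_divide_pos)
    ultimately show ?thesis by linarith
  qed
  have "measure_pmf.expectation Q (\<lambda>(x, c). - log b (pmf (V c) x))
    \<le> measure_pmf.expectation Q (\<lambda>z. (- log b (pmf Q z) + \<epsilon>) - - log b (pmf (map_pmf snd Q) (snd z)))"
    by (rule expectation_mono_finite[OF fin]) (use bound in force)
  also have "\<dots> = H Q - H (map_pmf snd Q) + \<epsilon>"
    unfolding H_def using fin
    by (subst Bochner_Integration.integral_diff) (auto simp: expectation_add_finite)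
  finally show ?thesis using that pos L by blast
qed

section \<open>The inner bound: test functions and constants\<close>

theorem R_in_subset_R_help:
  fixes P :: "('x::finite \<times> 'y::finite) pmf"
    and F :: "'x \<Rightarrow> 'y \<Rightarrow> 'f"
    and d :: "'f \<Rightarrow> 'h::finite \<Rightarrow> real"
  assumes d_nonneg: "\<And>a h. d a h \<ge> 0"
  shows "R_in b P F d \<subseteq> R_help b P F d"
proof
  fix t assume t: "t \<in> R_in b P F d"
  obtain R D \<Delta> where tt: "t = (R, D, \<Delta>)" by (cases t) auto
  from t obtain \<U> :: "nat set" and PU PH where nn: "0 \<le> R" "0 \<le> D" "0 \<le> \<Delta>"
    and fin\<U>: "finite \<U>" and PU\<U>: "\<forall>x. set_pmf (PU x) \<subseteq> \<U>"
    and single: "let Q = joint_in P PU PH;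
               X = (\<lambda>(x, y, u, h). x);
               Y = (\<lambda>(x, y, u, h). y);
               U = (\<lambda>(x, y, u, h). u);
               H = (\<lambda>(x, y, u, h). h)
           in R \<ge> cond_mutual_info b Q X U Y \<and>
              D \<ge> measure_pmf.expectation Q (\<lambda>\<omega>. d (F (X \<omega>) (Y \<omega>)) (H \<omega>)) \<and>
              \<Delta> \<le> cond_entropy b Q H (\<lambda>\<omega>. (U \<omega>, Y \<omega>)) + cond_mutual_info b Q X H Y"
    unfolding R_in_def tt by blast
  have finPU: "finite (set_pmf (PU x))" for x using PU\<U> fin\<U> finite_subset by blast
  define Q where "Q = joint P PU PH"
  have finQ: "finite (set_pmf Q)" unfolding Q_def by (rule finite_set_joint[OF finPU])
  define J where "J = P \<bind> (\<lambda>(x, y). map_pmf (\<lambda>u. (x, y, u)) (PU x))"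
  have finJ: "finite (set_pmf J)" using finPU by (auto simp: J_def split_beta')
  define pu where "pu = map_pmf (\<lambda>(x, y, u). u) J"
  define puy where "puy = map_pmf (\<lambda>(x, y, u). (u, y)) J"
  have Q_J: "Q = J \<bind> (\<lambda>(x, y, u). map_pmf (\<lambda>h. (x, y, u, h)) (PH u y))"
    by (simp add: Q_def joint_def J_def bind_assoc_pmf bind_map_pmf split_beta')
  have E_Q: "measure_pmf.expectation Q g = measure_pmf.expectation J (\<lambda>(x, y, u). measure_pmf.expectation (PH u y) (\<lambda>h. g (x, y, u, h)))"
    for g :: "'x \<times> 'y \<times> nat \<times> 'h \<Rightarrow> real"
    unfolding Q_J using finJ by (subst expectation_bind_finite) (auto simp: split_beta')
  have J_Q: "map_pmf (\<lambda>(x, y, u, h). (x, y, u)) Q = J"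
    by (simp add: Q_J map_bind_pmf pmf.map_comp o_def split_beta' map_pmf_const bind_return_pmf')
  define K where "K = H P - H (map_pmf snd P)"
  note src = ent_joint_source[of P PU PH, folded Q_def]
  note dens = information_densities[of PU P, OF finPU, folded J_def, folded pu_def puy_def]
  define I1 where "I1 = measure_pmf.expectation J (\<lambda>(x, y, u). log b (pmf (PU x) u / pmf pu u))"
  define I2 where "I2 = measure_pmf.expectation J (\<lambda>(x, y, u). log b (pmf pu u * pmf (map_pmf snd P) y / pmf puy (u, y)))"
  have entXUY: "ent Q (\<lambda>(x, y, u, h). (x, u, y)) = H J"
  proof -
    have "ent Q (\<lambda>(x, y, u, h). (x, u, y)) = ent Q (\<lambda>(x, y, u, h). (x, y, u))" by (rule ent_cong_inj) auto
    then show ?thesis by (simp add: ent_def J_Q)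
  qed
  have entUY: "ent Q (\<lambda>(x, y, u, h). (u, y)) = H puy"
    unfolding ent_def puy_def J_Q[symmetric] by (simp add: pmf.map_comp o_def split_beta')
  have single': "cond_mutual_info b Q (\<lambda>(x, y, u, h). x) (\<lambda>(x, y, u, h). u) (\<lambda>(x, y, u, h). y) \<le> R"
    "measure_pmf.expectation Q (\<lambda>\<omega>. d (F ((\<lambda>(x, y, u, h). x) \<omega>) ((\<lambda>(x, y, u, h). y) \<omega>)) ((\<lambda>(x, y, u, h). h) \<omega>)) \<le> D"
    "\<Delta> \<le> cond_entropy b Q (\<lambda>(x, y, u, h). h) (\<lambda>\<omega>. ((\<lambda>(x, y, u, h). u) \<omega>, (\<lambda>(x, y, u, h). y) \<omega>))
       + cond_mutual_info b Q (\<lambda>(x, y, u, h). x) (\<lambda>(x, y, u, h). h) (\<lambda>(x, y, u, h). y)"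
    using single unfolding joint_in_eq Let_def Q_def[symmetric] by auto
  \<comment> \<open>In the sum \<open>I1 + I2\<close> the entropy \<open>H pu\<close> cancels, and
    what is left is \<open>I(X;U|Y)\<close>.\<close>
  have rate: "I1 + I2 \<le> R"
  proof -
    have "cond_mutual_info b Q (\<lambda>(x, y, u, h). x) (\<lambda>(x, y, u, h). u) (\<lambda>(x, y, u, h). y)
      = ent Q (\<lambda>(x, y, u, h). (x, y)) + ent Q (\<lambda>(x, y, u, h). (u, y)) - ent Q (\<lambda>(x, y, u, h). (x, u, y)) - ent Q (\<lambda>(x, y, u, h). y)"
      by (subst cond_mutual_info_eq_ent[OF finQ]) (simp add: split_beta')
    then show ?thesis using single'(1) dens(1,2,4) src entXUY entUY by (simp add: I1_def I2_def)
  qed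
  have I1: "0 \<le> I1" using dens(1,3) by (simp add: I1_def)
  define \<psi>1 where "\<psi>1 = (\<lambda>(x, y, u). measure_pmf.expectation (PH u y) (d (F x y)))"
  \<comment> \<open>The equivocation needs the letter entropies bounded from below; the sign turns
    this into the upper bound that good sequences provide.\<close>
  define \<psi>2 where "\<psi>2 = (\<lambda>(x :: 'x, y, u). - H (PH u y))"
  have E1: "measure_pmf.expectation J \<psi>1 \<le> D"
    using single'(2) unfolding E_Q \<psi>1_def by (simp add: split_beta')
  have E2: "measure_pmf.expectation J \<psi>2 = - (ent Q (\<lambda>(x, y, u, h). (h, u, y)) - ent Q (\<lambda>(x, y, u, h). (u, y)))"
  proof -
    have "ent Q (\<lambda>(x, y, u, h). (h, u, y)) - ent Q (\<lambda>(x, y, u, h). (u, y)) = measure_pmf.expectation Q (\<lambda>(x, y, u, h). H (PH u y))"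
      unfolding Q_def by (rule ent_joint_H(1)[OF finPU])
    also have "\<dots> = measure_pmf.expectation J (\<lambda>(x, y, u). H (PH u y))"
      unfolding E_Q by (simp add: split_beta')
    finally show ?thesis by (simp add: \<psi>2_def split_beta')
  qed
  have equiv: "\<Delta> \<le> (ent Q (\<lambda>(x, y, u, h). (h, u, y)) - ent Q (\<lambda>(x, y, u, h). (u, y)))
     + K - (ent Q (\<lambda>(x, y, u, h). (x, h, y)) - ent Q (\<lambda>(x, y, u, h). (h, y)))"
  proof -
    have "cond_entropy b Q (\<lambda>(x, y, u, h). h) (\<lambda>\<omega>. ((\<lambda>(x, y, u, h). u) \<omega>, (\<lambda>(x, y, u, h). y) \<omega>))
      = ent Q (\<lambda>(x, y, u, h). (h, u, y)) - ent Q (\<lambda>(x, y, u, h). (u, y))"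
      by (subst cond_entropy_eq_ent[OF finQ]) (simp add: split_beta')
    moreover have "cond_mutual_info b Q (\<lambda>(x, y, u, h). x) (\<lambda>(x, y, u, h). h) (\<lambda>(x, y, u, h). y)
      = ent Q (\<lambda>(x, y, u, h). (x, y)) + ent Q (\<lambda>(x, y, u, h). (h, y)) - ent Q (\<lambda>(x, y, u, h). (x, h, y)) - ent Q (\<lambda>(x, y, u, h). y)"
      by (subst cond_mutual_info_eq_ent[OF finQ]) (simp add: split_beta')
    ultimately show ?thesis using single'(3) src by (simp add: K_def)
  qed
  have "achievable b P F d R D \<Delta>"
    unfolding achievable_def
  proof (intro allI impI)
    fix \<delta> :: real assume \<delta>: "0 < \<delta>"
    \<comment> \<open>The rate takes \<open>4 * \<epsilon>\<close>; the equivocation takes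
      \<open>2 * \<epsilon>\<close> for each of \<open>\<psi>2\<close> and \<open>\<psi>3\<close>,
      and one more for the smoothing.\<close>
    define \<epsilon> where "\<epsilon> = \<delta> / 5"
    have \<epsilon>: "0 < \<epsilon>" "\<delta> = 5 * \<epsilon>" using \<delta> by (auto simp: \<epsilon>_def)
    define Q3 where "Q3 = map_pmf (\<lambda>(x, y, u, h). (x, h, y)) Q"
    have finQ3: "finite (set_pmf Q3)" using finQ by (simp add: Q3_def)
    obtain V :: "'h \<times> 'y \<Rightarrow> 'x pmf" and L where V_pos: "\<And>c x. 0 < pmf (V c) x" and V_L: "\<And>c x. - log b (pmf (V c) x) \<le> L"
      and V_E: "measure_pmf.expectation Q3 (\<lambda>(x, c). - log b (pmf (V c) x)) \<le> H Q3 - H (map_pmf snd Q3) + \<epsilon>"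
      using smoothed_conditional[OF finQ3 \<epsilon>(1)] by blast
    define \<psi>3 where "\<psi>3 = (\<lambda>(x, y, u). measure_pmf.expectation (PH u y) (\<lambda>h. - log b (pmf (V (h, y)) x)))"
    have E3: "measure_pmf.expectation J \<psi>3 \<le> ent Q (\<lambda>(x, y, u, h). (x, h, y)) - ent Q (\<lambda>(x, y, u, h). (h, y)) + \<epsilon>"
    proof -
      have "measure_pmf.expectation J \<psi>3 = measure_pmf.expectation Q3 (\<lambda>(x, c). - log b (pmf (V c) x))"
        by (simp add: Q3_def E_Q \<psi>3_def split_beta')
      moreover have "map_pmf snd Q3 = map_pmf (\<lambda>(x, y, u, h). (h, y)) Q"
        by (simp add: Q3_def pmf.map_comp o_def split_beta')
      ultimately show ?thesis using V_E by (simp add: ent_def Q3_def)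
    qed
    \<comment> \<open>\<open>d\<close> may be unbounded on the type \<open>'f\<close>, so the bound
      is taken over the finitely many values \<open>F x y\<close>.\<close>
    define dmax where "dmax = (\<Sum>x\<in>UNIV. \<Sum>y\<in>UNIV. \<Sum>h\<in>UNIV. d (F x y) h)"
    have dmax: "d (F x y) h \<le> dmax" for x y h
    proof -
      have "d (F x y) h \<le> (\<Sum>h\<in>UNIV. d (F x y) h)" by (rule member_le_sum) (auto simp: d_nonneg)
      also have "\<dots> \<le> (\<Sum>y\<in>UNIV. \<Sum>h\<in>UNIV. d (F x y) h)"
        by (rule member_le_sum[where f = "\<lambda>y. \<Sum>h\<in>UNIV. d (F x y) h"]) (auto intro!: sum_nonneg simp: d_nonneg)
      also have "\<dots> \<le> dmax" unfolding dmax_def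
        by (rule member_le_sum[where f = "\<lambda>x. \<Sum>y\<in>UNIV. \<Sum>h\<in>UNIV. d (F x y) h"]) (auto intro!: sum_nonneg simp: d_nonneg)
      finally show ?thesis .
    qed
    define B where "B = dmax + log b CARD('h) + \<bar>L\<bar>"
    have dmax0: "0 \<le> dmax" using dmax d_nonneg by (meson order_trans)
    have logh0: "0 \<le> log b CARD('h)" using b_gt_1 by simp
    have E_bounds: "0 \<le> measure_pmf.expectation p k \<and> measure_pmf.expectation p k \<le> c"
      if "\<And>h. 0 \<le> k h" "\<And>h. k h \<le> c" for p :: "'h pmf" and k :: "'h \<Rightarrow> real" and c
      using expectation_mono_finite[of p "\<lambda>_. 0" k] expectation_mono_finite[of p k "\<lambda>_. c"] that by simp
    have b1: "\<bar>\<psi>1 z\<bar> \<le> B" and b2: "\<bar>\<psi>2 z\<bar> \<le> B" and b3: "\<bar>\<psi>3 z\<bar> \<le> B" for z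
    proof -
      obtain x y u where z: "z = (x, y, u)" by (cases z) auto
      show "\<bar>\<psi>1 z\<bar> \<le> B"
        using E_bounds[of "d (F x y)" dmax "PH u y"] d_nonneg dmax logh0 by (simp add: z \<psi>1_def B_def)
      show "\<bar>\<psi>2 z\<bar> \<le> B"
        using H_nonneg[of "PH u y"] H_le_log_card[of "PH u y"] dmax0 by (simp add: z \<psi>2_def B_def)
      have "0 \<le> - log b (pmf (V (h, y)) x)" for h
        using V_pos[of "(h, y)" x] pmf_le_1[of "V (h, y)" x] b_gt_1 by simp
      then show "\<bar>\<psi>3 z\<bar> \<le> B"
        using E_bounds[of "\<lambda>h. - log b (pmf (V (h, y)) x)" L "PH u y"] V_L dmax0 logh0
        by (simp add: z \<psi>3_def B_def)
    qed
    have B0: "0 \<le> B" using dmax0 logh0 by (simp add: B_def)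
    \<comment> \<open>Failures of this probability shift each letter average by at most
      \<open>\<epsilon>\<close>; the summand 1 keeps the denominator positive if
      \<open>B = 0\<close>.\<close>
    define \<kappa> where "\<kappa> = \<epsilon> / (2 * B + 1)"
    have \<kappa>: "0 < \<kappa>" "2 * B * \<kappa> \<le> \<epsilon>" using B0 \<epsilon> by (auto simp: \<kappa>_def field_simps)
    define \<Psi> where "\<Psi> = {\<psi>1, \<psi>2, \<psi>3}"
    have "\<forall>\<^sub>F n in sequentially. \<exists>K f \<phi>. 0 < K \<and> (\<forall>xs. f xs < K) \<and> log b (real K) \<le> n * (R + 4 * \<epsilon>) \<and>
      measure_pmf.prob (replicate_pmf n P) {xys. \<not> (\<exists>zs. length zs = n \<and> xys = map (\<lambda>(x, y, u). (x, y)) zs \<and>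
        \<phi> (f (map fst xys)) (map snd xys) = map (\<lambda>(x, y, u). u) zs \<and>
        (\<forall>\<psi>\<in>\<Psi>. (\<Sum>z\<leftarrow>zs. \<psi> z) \<le> n * (measure_pmf.expectation J \<psi> + \<epsilon>)))} \<le> \<kappa>"
      unfolding J_def
      by (rule wyner_ziv_coding[OF _ finPU, where \<Psi> = \<Psi> and R = R, folded J_def, folded pu_def puy_def, folded I1_def I2_def])
         (use I1 rate nn \<epsilon> \<kappa> in \<open>simp_all add: \<Psi>_def I1_def I2_def pu_def puy_def J_def\<close>)
    then show "\<forall>\<^sub>F n in sequentially. \<exists>W f g. is_code n W f g \<and> (1 / real n) * log b (real (card W)) \<le> R + \<delta> \<and>
        measure_pmf.expectation (code_joint P n f g) (\<lambda>(xs, ys, hs). block_distortion F d n xs ys hs) \<le> D + \<delta> \<and>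
        \<Delta> - \<delta> \<le> (1 / real n) * cond_entropy b (code_joint P n f g) (\<lambda>(xs, ys, hs). hs) (\<lambda>(xs, ys, hs). ys)"
      using eventually_gt_at_top[of 0]
    proof eventually_elim
      case (elim n)
      then obtain k f \<phi> where k: "0 < k" and f: "\<And>xs. f xs < k" and logk: "log b (real k) \<le> n * (R + 4 * \<epsilon>)"
        and fail: "measure_pmf.prob (replicate_pmf n P) {xys. \<not> (\<exists>zs. length zs = n \<and> xys = map (\<lambda>(x, y, u). (x, y)) zs \<and>
        \<phi> (f (map fst xys)) (map snd xys) = map (\<lambda>(x, y, u). u) zs \<and>
        (\<forall>\<psi>\<in>\<Psi>. (\<Sum>z\<leftarrow>zs. \<psi> z) \<le> n * (measure_pmf.expectation J \<psi> + \<epsilon>)))} \<le> \<kappa>" (is "measure_pmf.prob _ ?Bad \<le> \<kappa>")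
        by blast
      have n: "0 < n" using elim by simp
      \<comment> \<open>\<open>\<phi>\<close> may return a word of the wrong length. The filler of
        length \<open>n\<close> makes \<open>dec\<close> a valid decoder and never replaces the
        output on good sequences.\<close>
      define dec where "dec w ys = (if length (\<phi> w ys) = n then \<phi> w ys else replicate n 0)" for w and ys :: "'y list"
      have len: "length (dec w ys) = n" for w ys by (simp add: dec_def)
      define S where "S \<psi> = measure_pmf.expectation (replicate_pmf n P)
       (\<lambda>xys. \<Sum>((x, y), u)\<leftarrow>zip xys (dec (f (map fst xys)) (map snd xys)). \<psi> (x, y, u))" for \<psi> :: "'x \<times> 'y \<times> nat \<Rightarrow> real"
      have S: "S \<psi> \<le> n * (measure_pmf.expectation J \<psi> + 2 * \<epsilon>)" if \<psi>: "\<psi> \<in> \<Psi>" for \<psi>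
      proof -
        have bnd: "\<bar>\<psi> z\<bar> \<le> B" for z using \<psi> b1[of z] b2[of z] b3[of z] unfolding \<Psi>_def by blast
        have "- B \<le> measure_pmf.expectation J \<psi>"
        proof -
          have "measure_pmf.expectation J (\<lambda>_. - B) \<le> measure_pmf.expectation J \<psi>"
            by (rule expectation_mono_finite[OF finJ]) (use bnd in \<open>auto simp: abs_le_iff minus_le_iff\<close>)
          then show ?thesis by simp
        qed
        \<comment> \<open>One \<open>\<epsilon>\<close> is the tolerance of good sequences; the term
          \<open>2 * B * \<kappa>\<close>, at most another \<open>\<epsilon>\<close>, pays for the
          failures.\<close>
        then have "S \<psi> \<le> n * ((measure_pmf.expectation J \<psi> + \<epsilon>) + 2 * B * \<kappa>)"
          unfolding S_def
        proof (intro typical_decoder_expectation[OF len bnd _ fail])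
          fix xys assume "xys \<in> set_pmf (replicate_pmf n P)" and "xys \<notin> ?Bad"
          then obtain zs where zs: "length zs = n" "xys = map (\<lambda>(x, y, u). (x, y)) zs"
            "\<phi> (f (map fst xys)) (map snd xys) = map (\<lambda>(x, y, u). u) zs"
            "(\<Sum>z\<leftarrow>zs. \<psi> z) \<le> n * (measure_pmf.expectation J \<psi> + \<epsilon>)" using \<psi> by blast
          have "dec (f (map fst xys)) (map snd xys) = map (\<lambda>(x, y, u). u) zs"
            unfolding dec_def zs(3) using zs(1) by simp
          moreover have "(\<Sum>((x, y), u)\<leftarrow>zip xys (map (\<lambda>(x, y, u). u) zs). \<psi> (x, y, u)) = (\<Sum>z\<leftarrow>zs. \<psi> z)"
            unfolding zs(2) by (simp add: zip_map_map zip_same_conv_map o_def split_beta')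
          ultimately show "(\<Sum>((x, y), u)\<leftarrow>zip xys (dec (f (map fst xys)) (map snd xys)). \<psi> (x, y, u))
            \<le> n * (measure_pmf.expectation J \<psi> + \<epsilon>)" using zs(4) by simp
        qed (use \<epsilon> in auto)
        also have "\<dots> \<le> n * (measure_pmf.expectation J \<psi> + 2 * \<epsilon>)" using \<kappa> by (intro mult_left_mono) auto
        finally show ?thesis .
      qed
      define g where "g = (\<lambda>w ys. seq_pmf (map2 PH (dec w ys) ys))"
      note cd = code_from_decoder[where dec = dec and n = n and f = f and K = k and V = "\<lambda>h y. V (h, y)",
        OF len f V_pos, where PH = PH, folded g_def]
      note cd2 = cd(2,3)[where P = P, folded S_def]
      have code: "is_code n {..<k} f g" by (rule cd(1))
      have "measure_pmf.expectation (code_joint P n f g) (\<lambda>(xs, ys, hs). block_distortion F d n xs ys hs) = S \<psi>1 / n"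
        unfolding cd2(1) \<psi>1_def ..
      also have "\<dots> \<le> measure_pmf.expectation J \<psi>1 + 2 * \<epsilon>"
        using S[of \<psi>1] n by (simp add: \<Psi>_def field_simps)
      finally have dist: "measure_pmf.expectation (code_joint P n f g) (\<lambda>(xs, ys, hs). block_distortion F d n xs ys hs) \<le> D + \<delta>"
        using E1 \<epsilon> by linarith
      have "S (\<lambda>(x, y, u). H (PH u y)) = - S \<psi>2"
      proof -
        have "(\<Sum>((x, y), u)\<leftarrow>ws. \<psi>2 (x, y, u)) = - (\<Sum>((x, y), u)\<leftarrow>ws. H (PH u y))" for ws :: "(('x \<times> 'y) \<times> nat) list"
          by (induction ws) (auto simp: \<psi>2_def)
        then show ?thesis by (simp add: S_def split_beta')
      qed
      then have "n * K - S \<psi>2 - S \<psi>3 \<le> ent (code_joint P n f g) (\<lambda>(xs, ys, hs). (hs, ys)) - ent (code_joint P n f g) (\<lambda>(xs, ys, hs). ys)"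
        using cd2(2) by (simp add: K_def \<psi>3_def)
      also have "\<dots> = cond_entropy b (code_joint P n f g) (\<lambda>(xs, ys, hs). hs) (\<lambda>(xs, ys, hs). ys)"
        by (subst cond_entropy_eq_ent[OF finite_set_code_joint(1)[OF code]]) (simp add: split_beta')
      finally have ce: "n * K - S \<psi>2 - S \<psi>3 \<le> cond_entropy b (code_joint P n f g) (\<lambda>(xs, ys, hs). hs) (\<lambda>(xs, ys, hs). ys)" .
      have "n * (\<Delta> - \<delta>) \<le> n * (K - (measure_pmf.expectation J \<psi>2 + 2 * \<epsilon>) - (measure_pmf.expectation J \<psi>3 + 2 * \<epsilon>))"
        using equiv E2 E3 \<epsilon> by (intro mult_left_mono) auto
      also have "\<dots> \<le> n * K - S \<psi>2 - S \<psi>3"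
        using S[of \<psi>2] S[of \<psi>3] by (simp add: \<Psi>_def algebra_simps)
      finally have "n * (\<Delta> - \<delta>) \<le> cond_entropy b (code_joint P n f g) (\<lambda>(xs, ys, hs). hs) (\<lambda>(xs, ys, hs). ys)"
        using ce by linarith
      then have eq: "\<Delta> - \<delta> \<le> (1 / real n) * cond_entropy b (code_joint P n f g) (\<lambda>(xs, ys, hs). hs) (\<lambda>(xs, ys, hs). ys)"
        using n by (simp add: field_simps)
      have "(1 / real n) * log b (real (card {..<k})) \<le> R + 4 * \<epsilon>" using logk n by (simp add: field_simps)
      then have "(1 / real n) * log b (real (card {..<k})) \<le> R + \<delta>" using \<epsilon> by linarith
      then show ?case using code dist eq by blast
    qed
  qed
  then show "t \<in> R_help b P F d" using nn by (simp add: R_help_def tt)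
qed

end

theorem proposition4:
  fixes b :: real
    and P :: "('x::finite \<times> 'y::finite) pmf"
    and F :: "'x \<Rightarrow> 'y \<Rightarrow> 'f"
    and d :: "'f \<Rightarrow> 'xh::finite \<Rightarrow> real"
  assumes "b > 1"
    and "\<And>a h. d a h \<ge> 0"
  shows "R_in b P F d \<subseteq> R_help b P F d \<and> R_help b P F d \<subseteq> R_out b P F d"
proof -
  interpret entropy_base b by unfold_locales (rule assms(1))
  show ?thesis
    using R_in_subset_R_help[where d = d, OF assms(2)] R_help_subset_R_out by blast
qed

end
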